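(* Let $M$ be a special Lagrangian submanifold of $\mathbb{C}P^4$ with $SO(2)\rtimes S_3$-symmetry, with adapted local orthonormal frame $\{X_1,X_2,X_3,X_4\}$. Suppose that $\mathcal{N}_1=\mathrm{span}\{X_1,X_2\}$ is integrable. Then $M$ can be lifted horizontally (locally) to a submanifold $F$ of the unit sphere of $\mathbb{C}^5$, and this lift is congruent to $$F(t,s,u,v)=\big(\phi(u,v)\cos(s),\,\sin(s)\cos(t),\,\sin(s)\sin(t)\big),$$ where $\phi$ is the horizontal lift of a special Lagrangian submanifold of $\mathbb{C}P^2$ to the unit sphere $S^5\subset\mathbb{C}^3$.
   Context: Let $(N,J,g)$ be a Kähler manifold with Levi-Civita connection $D$ and $\omega(X,Y)=g(X,JY)$. A submanifold $M$ is Lagrangian if $\omega$ vanishes on $M$ and $\dim_{\mathbb{R}}M=\dim_{\mathbb{C}}N$. Its Levi-Civita connection $\nabla$ and its symmetric $(1,2)$-tensor $A$ are given by $D_XY=\nabla_XY+JA(X,Y)$. "Special Lagrangian" means Lagrangian and minimal, i.e. $\mathrm{Tr}(A(X,\cdot))=0$ for all $X$. A special Lagrangian 4-fold has $SO(2)\rtimes S_3$-symmetry if locally there is an orthonormal frame $\{X_1,X_2,X_3,X_4\}$ (the adapted frame) and a strictly positive function $r$ with $A(X_1,X_1)=rX_1$, $A(X_1,X_2)=A(X_2,X_1)=-rX_2$, $A(X_2,X_2)=-rX_1$, and $A(X_i,X_j)=0$ whenever $i\in\{3,4\}$ or $j\in\{3,4\}$. $\mathbb{C}P^n$ is the quotient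 $S^{2n+1}/S^1$ of the unit sphere in $\mathbb{C}^{n+1}$, with the metric of constant holomorphic sectional curvature $4$ that makes the Hopf fibration $\pi$ a Riemannian submersion. A horizontal lift of a special Lagrangian submanifold of $\mathbb{C}P^n$ is an immersion $\phi$ into $S^{2n+1}$ with $i\phi$ orthogonal to the image of $d\phi$, which projects isometrically under $\pi$ onto that submanifold; such lifts are minimal C-totally real submanifolds of $S^{2n+1}$. *)

theory Defs
  imports "HOL-Analysis.Analysis"
begin

section \<open>Smooth maps and smooth manifolds\<close>

primrec Ck_on :: "nat \<Rightarrow> 'a::euclidean_space set \<Rightarrow> ('a \<Rightarrow> 'b::real_normed_vector) \<Rightarrow> bool" where
  "Ck_on 0 S f \<longleftrightarrow> continuous_on S f"
| "Ck_on (Suc k) S f \<longleftrightarrow>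
     (\<forall>x\<in>S. f differentiable (at x)) \<and> (\<forall>v. Ck_on k S (\<lambda>x. frechet_derivative f (at x) v))"

text \<open>The derivatives are taken in the whole space, so \<open>S\<close> is meant to be open.\<close>

definition smooth_on :: "'a::euclidean_space set \<Rightarrow> ('a \<Rightarrow> 'b::real_normed_vector) \<Rightarrow> bool" where
  "smooth_on S f \<longleftrightarrow> (\<forall>k. Ck_on k S f)"

text \<open>An atlas is a set of pairs \<open>(D, y)\<close>, where \<open>y\<close> is a local parametrization
  (the inverse of a chart) defined on the open set \<open>D\<close> of the model space.\<close>

type_synonym ('a, 'm) atlas = "('a set \<times> ('a \<Rightarrow> 'm)) set"

definition smooth_manifold :: "'m topology \<Rightarrow> ('a::euclidean_space, 'm) atlas \<Rightarrow> bool" where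
  "smooth_manifold M \<A> \<longleftrightarrow>
     Hausdorff_space M \<and> second_countable M \<and>
     topspace M = (\<Union>(D, y)\<in>\<A>. y ` D) \<and>
     (\<forall>(D, y)\<in>\<A>. open D \<and> openin M (y ` D) \<and>
        homeomorphic_map (top_of_set D) (subtopology M (y ` D)) y) \<and>
     (\<forall>(D, y)\<in>\<A>. \<forall>(E, z)\<in>\<A>. smooth_on (D \<inter> y -` (z ` E)) (inv_into E z \<circ> y))"

definition smooth_map_into ::
    "'m topology \<Rightarrow> ('a::euclidean_space, 'm) atlas \<Rightarrow> 'b::euclidean_space set \<Rightarrow> ('b \<Rightarrow> 'm) \<Rightarrow> bool" where
  "smooth_map_into M \<A> \<Omega> \<psi> \<longleftrightarrow>
     continuous_map (top_of_set \<Omega>) M \<psi> \<and>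
     (\<forall>(D, y)\<in>\<A>. smooth_on (\<Omega> \<inter> \<psi> -` (y ` D)) (inv_into D y \<circ> \<psi>))"

text \<open>The set \<open>{(D, id)}\<close> is the standard atlas of an open set \<open>D\<close> of a Euclidean space.\<close>


section \<open>Levi-Civita connections in coordinates\<close>

text \<open>A metric on an open set of a Euclidean space is written \<open>g p u v\<close>, with base point \<open>p\<close>
  and tangent vectors \<open>u\<close>, \<open>v\<close>. For constant vector fields \<open>u\<close>, \<open>v\<close>, \<open>z\<close> all Lie brackets
  vanish, and the Koszul formula reduces to the equation below.\<close>

definition christoffel ::
    "('a::euclidean_space \<Rightarrow> 'a \<Rightarrow> 'a \<Rightarrow> real) \<Rightarrow> 'a \<Rightarrow> 'a \<Rightarrow> 'a \<Rightarrow> 'a" where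
  "christoffel g p u v = (THE w. \<forall>z. 2 * g p w z =
       frechet_derivative (\<lambda>q. g q v z) (at p) u
     + frechet_derivative (\<lambda>q. g q u z) (at p) v
     - frechet_derivative (\<lambda>q. g q u v) (at p) z)"

text \<open>The covariant derivative, in the direction of the vector field \<open>X\<close> on the domain of \<open>h\<close>,
  of a vector field \<open>V\<close> along the map \<open>h\<close>. The Levi-Civita connection of \<open>g\<close> itself is
  the case \<open>h = id\<close>.\<close>

definition cov_deriv ::
    "('b::euclidean_space \<Rightarrow> 'b \<Rightarrow> 'b \<Rightarrow> real) \<Rightarrow> ('a::euclidean_space \<Rightarrow> 'b)
       \<Rightarrow> ('a \<Rightarrow> 'a) \<Rightarrow> ('a \<Rightarrow> 'b) \<Rightarrow> 'a \<Rightarrow> 'b" where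
  "cov_deriv g h X V p =
     frechet_derivative V (at p) (X p)
     + christoffel g (h p) (frechet_derivative h (at p) (X p)) (V p)"


section \<open>Complex projective space\<close>

text \<open>A point of projective space is a fibre of the Hopf fibration of the unit sphere;
  \<open>hopf\<close> is only meant for unit vectors.\<close>

definition hopf :: "complex^'n \<Rightarrow> (complex^'n) set" where
  "hopf z = {c *s z | c. cmod c = 1}"

definition complex_projective_space :: "(complex^'n) set set" where
  "complex_projective_space = hopf ` sphere 0 1"

text \<open>The affine charts: a decomposition of \<open>\<complex>\<^sup>n\<^sup>+\<^sup>1\<close> as the direct sum of the line of \<open>e\<close> and
  the hyperplane parametrized by \<open>P\<close> gives the holomorphic parametrization of projective space
  sending \<open>w\<close> in \<open>\<complex>\<^sup>n\<close> to the line of \<open>e + P w\<close>. Its range consists of the lines that are not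
  contained in the hyperplane. The unit vector \<open>affine_lift e P w\<close> spans that line.\<close>

definition affine_frame :: "complex^'n \<Rightarrow> complex^'k^'n \<Rightarrow> bool" where
  "affine_frame e P \<longleftrightarrow> bij (\<lambda>(c, w). c *s e + P *v w)"

definition affine_lift :: "complex^'n \<Rightarrow> complex^'k^'n \<Rightarrow> complex^'k \<Rightarrow> complex^'n" where
  "affine_lift e P w = sgn (e + P *v w)"

text \<open>Projection of a tangent vector of the sphere at \<open>z\<close> to the orthogonal complement of the
  tangent \<open>\<i> *s z\<close> of the Hopf fibre.\<close>

definition horizontal_part :: "complex^'n \<Rightarrow> complex^'n \<Rightarrow> complex^'n" where
  "horizontal_part z v = v - (v \<bullet> (\<i> *s z)) *\<^sub>R (\<i> *s z)"

text \<open>The metric of projective space in an affine chart: since the Hopf fibration is a Riemannian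
  submersion, the length of a tangent vector is the length of the horizontal part of any lift of
  it. As affine charts are holomorphic, the complex structure \<open>J\<close> is multiplication by \<open>\<i>\<close>
  in these coordinates.\<close>

definition projective_metric ::
    "complex^'n \<Rightarrow> complex^'k^'n \<Rightarrow> complex^'k \<Rightarrow> complex^'k \<Rightarrow> complex^'k \<Rightarrow> real" where
  "projective_metric e P w u v =
     (let z = affine_lift e P w; L = frechet_derivative (affine_lift e P) (at w)
      in horizontal_part z (L u) \<bullet> horizontal_part z (L v))"

definition kaehler_form ::
    "complex^'n \<Rightarrow> complex^'k^'n \<Rightarrow> complex^'k \<Rightarrow> complex^'k \<Rightarrow> complex^'k \<Rightarrow> real" where
  "kaehler_form e P w u v = projective_metric e P w u (\<i> *s v)"


section \<open>Special Lagrangian submanifolds of complex projective space\<close>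

text \<open>A submanifold is an immersion \<open>f\<close> of a smooth manifold. Because the index type \<open>'k\<close> of the
  model space \<open>real^'k\<close> of the manifold is also that of the affine coordinates \<open>complex^'k\<close>,
  the real dimension of the manifold is the complex dimension of the projective space.
  The map \<open>h\<close> below is the expression of \<open>f\<close> in local coordinates of both spaces.\<close>

definition coord_rep ::
    "(real^'k, 'm) atlas \<Rightarrow> ('m \<Rightarrow> (complex^'n) set) \<Rightarrow> (real^'k) set \<Rightarrow> (real^'k \<Rightarrow> 'm)
      \<Rightarrow> complex^'n \<Rightarrow> complex^'k^'n \<Rightarrow> (real^'k \<Rightarrow> complex^'k) \<Rightarrow> bool" where
  "coord_rep \<A> f D y e P h \<longleftrightarrow>
     open D \<and> (\<exists>E. D \<subseteq> E \<and> (E, y) \<in> \<A>) \<and> affine_frame e P \<and>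
     (\<forall>q\<in>D. f (y q) = hopf (affine_lift e P (h q)))"

definition induced_metric ::
    "complex^'n \<Rightarrow> complex^'k^'n \<Rightarrow> (real^'k \<Rightarrow> complex^'k) \<Rightarrow> real^'k \<Rightarrow> real^'k \<Rightarrow> real^'k \<Rightarrow> real" where
  "induced_metric e P h q u v =
     projective_metric e P (h q) (frechet_derivative h (at q) u) (frechet_derivative h (at q) v)"

text \<open>The tensor \<open>A\<close> of a Lagrangian immersion, applied to vector fields \<open>X\<close> and \<open>Y\<close>, is defined
  by \<open>D\<^sub>X Y = \<nabla>\<^sub>X Y + J A(X, Y)\<close>.\<close>

definition tensor_A ::
    "complex^'n \<Rightarrow> complex^'k^'n \<Rightarrow> (real^'k \<Rightarrow> complex^'k)
      \<Rightarrow> (real^'k \<Rightarrow> real^'k) \<Rightarrow> (real^'k \<Rightarrow> real^'k) \<Rightarrow> real^'k \<Rightarrow> real^'k" where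
  "tensor_A e P h X Y q = (THE a.
     cov_deriv (projective_metric e P) h X (\<lambda>p. frechet_derivative h (at p) (Y p)) q
     = frechet_derivative h (at q) (cov_deriv (induced_metric e P h) id X Y q)
       + \<i> *s frechet_derivative h (at q) a)"

definition lagrangian_on ::
    "complex^'n \<Rightarrow> complex^'k^'n \<Rightarrow> (real^'k) set \<Rightarrow> (real^'k \<Rightarrow> complex^'k) \<Rightarrow> bool" where
  "lagrangian_on e P D h \<longleftrightarrow>
     (\<forall>q\<in>D. \<forall>u v. kaehler_form e P (h q)
        (frechet_derivative h (at q) u) (frechet_derivative h (at q) v) = 0)"

definition minimal_on ::
    "complex^'n \<Rightarrow> complex^'k^'n \<Rightarrow> (real^'k) set \<Rightarrow> (real^'k \<Rightarrow> complex^'k) \<Rightarrow> bool" where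
  "minimal_on e P D h \<longleftrightarrow>
     (\<forall>q\<in>D. \<forall>v. trace (matrix (\<lambda>u. tensor_A e P h (\<lambda>_. v) (\<lambda>_. u) q)) = 0)"

definition special_lagrangian ::
    "'m topology \<Rightarrow> (real^'k, 'm) atlas \<Rightarrow> ('m \<Rightarrow> (complex^'n) set) \<Rightarrow> bool" where
  "special_lagrangian M \<A> f \<longleftrightarrow>
     f ` topspace M \<subseteq> complex_projective_space \<and>
     (\<forall>p\<in>topspace M. \<exists>D y e P h. coord_rep \<A> f D y e P h \<and> p \<in> y ` D \<and>
        smooth_on D h \<and> (\<forall>q\<in>D. inj (frechet_derivative h (at q))) \<and>
        lagrangian_on e P D h \<and> minimal_on e P D h)"

text \<open>\<open>G\<close> is a horizontal lift, over the open set \<open>W\<close>, of the immersion \<open>f\<close>. The last condition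
  says that \<open>G\<close> projects isometrically.\<close>

definition horizontal_lift ::
    "(real^'k, 'm) atlas \<Rightarrow> ('m \<Rightarrow> (complex^'n) set) \<Rightarrow> 'm set \<Rightarrow> ('m \<Rightarrow> complex^'n) \<Rightarrow> bool" where
  "horizontal_lift \<A> f W G \<longleftrightarrow>
     (\<forall>p\<in>W. norm (G p) = 1 \<and> hopf (G p) = f p) \<and>
     (\<forall>(D, y)\<in>\<A>. smooth_on (D \<inter> y -` W) (G \<circ> y) \<and>
        (\<forall>q\<in>D \<inter> y -` W. inj (frechet_derivative (G \<circ> y) (at q)) \<and>
           (\<forall>u. (\<i> *s G (y q)) \<bullet> frechet_derivative (G \<circ> y) (at q) u = 0))) \<and>
     (\<forall>D y e P h. coord_rep \<A> f D y e P h \<longrightarrow> (\<forall>q\<in>D \<inter> y -` W. \<forall>u v.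
        induced_metric e P h q u v =
        frechet_derivative (G \<circ> y) (at q) u \<bullet> frechet_derivative (G \<circ> y) (at q) v))"


section \<open>Adapted frames\<close>

definition adapted_frame ::
    "complex^5 \<Rightarrow> complex^4^5 \<Rightarrow> (real^4) set \<Rightarrow> (real^4 \<Rightarrow> complex^4)
      \<Rightarrow> (4 \<Rightarrow> real^4 \<Rightarrow> real^4) \<Rightarrow> (real^4 \<Rightarrow> real) \<Rightarrow> bool" where
  "adapted_frame e P D h X r \<longleftrightarrow>
     (\<forall>i. smooth_on D (X i)) \<and>
     (\<forall>q\<in>D. r q > 0 \<and>
        (\<forall>i j. induced_metric e P h q (X i q) (X j q) = (if i = j then 1 else 0)) \<and>
        tensor_A e P h (X 1) (X 1) q = r q *\<^sub>R X 1 q \<and>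
        tensor_A e P h (X 1) (X 2) q = - r q *\<^sub>R X 2 q \<and>
        tensor_A e P h (X 2) (X 1) q = - r q *\<^sub>R X 2 q \<and>
        tensor_A e P h (X 2) (X 2) q = - r q *\<^sub>R X 1 q \<and>
        (\<forall>i j. i \<in> {3, 4} \<or> j \<in> {3, 4} \<longrightarrow> tensor_A e P h (X i) (X j) q = 0))"

definition so2_s3_symmetric ::
    "'m topology \<Rightarrow> (real^4, 'm) atlas \<Rightarrow> ('m \<Rightarrow> (complex^5) set) \<Rightarrow> bool" where
  "so2_s3_symmetric M \<A> f \<longleftrightarrow>
     (\<forall>p\<in>topspace M. \<exists>D y e P h X r. coord_rep \<A> f D y e P h \<and> p \<in> y ` D \<and>
        adapted_frame e P D h X r)"

text \<open>Integrability of the plane field spanned by \<open>X\<close> and \<open>Y\<close>: every point lies on an integral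
  surface.\<close>

definition integrable_span ::
    "'a::euclidean_space set \<Rightarrow> ('a \<Rightarrow> 'a) \<Rightarrow> ('a \<Rightarrow> 'a) \<Rightarrow> bool" where
  "integrable_span D X Y \<longleftrightarrow>
     (\<forall>q\<in>D. \<exists>E (\<sigma> :: real^2 \<Rightarrow> 'a). open E \<and> smooth_on E \<sigma> \<and> \<sigma> ` E \<subseteq> D \<and> q \<in> \<sigma> ` E \<and>
        (\<forall>w\<in>E. inj (frechet_derivative \<sigma> (at w)) \<and>
           range (frechet_derivative \<sigma> (at w)) = span {X (\<sigma> w), Y (\<sigma> w)}))"

text \<open>The distribution \<open>N\<^sub>1\<close> spanned by the first two vectors of an adapted frame does not depend
  on the frame: it is the orthogonal complement of the kernel of \<open>A\<close>. It therefore suffices to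
  ask for one adapted frame around each point.\<close>

definition integrable_N1 ::
    "'m topology \<Rightarrow> (real^4, 'm) atlas \<Rightarrow> ('m \<Rightarrow> (complex^5) set) \<Rightarrow> bool" where
  "integrable_N1 M \<A> f \<longleftrightarrow>
     (\<forall>p\<in>topspace M. \<exists>D y e P h X r. coord_rep \<A> f D y e P h \<and> p \<in> y ` D \<and>
        adapted_frame e P D h X r \<and> integrable_span D (X 1) (X 2))"


section \<open>Congruence, and the model immersion\<close>

definition unitary_matrix :: "complex^'n^'n \<Rightarrow> bool" where
  "unitary_matrix Q \<longleftrightarrow>
     (let Q' = (\<chi> i j. cnj (Q $ j $ i)) in Q ** Q' = mat 1 \<and> Q' ** Q = mat 1)"

definition model_F :: "(real^2 \<Rightarrow> complex^3) \<Rightarrow> real \<Rightarrow> real \<Rightarrow> real \<Rightarrow> real \<Rightarrow> complex^5" where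
  "model_F \<phi> t s u v =
     (let z = \<phi> (vector [u, v]) in
      vector [z $ 1 * complex_of_real (cos s), z $ 2 * complex_of_real (cos s),
              z $ 3 * complex_of_real (cos s),
              complex_of_real (sin s * cos t), complex_of_real (sin s * sin t)])"

lemma model_F_nth:
  "model_F \<phi> t s u v $ 1 = \<phi> (vector [u, v]) $ 1 * complex_of_real (cos s)"
  "model_F \<phi> t s u v $ 2 = \<phi> (vector [u, v]) $ 2 * complex_of_real (cos s)"
  "model_F \<phi> t s u v $ 3 = \<phi> (vector [u, v]) $ 3 * complex_of_real (cos s)"
  "model_F \<phi> t s u v $ 4 = complex_of_real (sin s * cos t)"
  "model_F \<phi> t s u v $ 5 = complex_of_real (sin s * sin t)"
  by (simp_all add: model_F_def vector_def Let_def)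

text \<open>Over the open set \<open>W\<close>, the map \<open>G\<close> is congruent to \<open>F\<close>: up to a unitary transformation \<open>Q\<close>
  of \<open>\<complex>\<^sup>5\<close>, it becomes \<open>F\<close> after the change of parameters \<open>\<psi>\<close>. The parameters \<open>t\<close> and \<open>s\<close> are polar
  coordinates with origin at \<open>s = 0\<close>. The change of parameters is a local diffeomorphism
  where \<open>sin s \<noteq> 0\<close>, but it cannot be one on the axis \<open>s = 0\<close>, which \<open>W\<close> may meet.\<close>

definition congruent_to_model ::
    "'m topology \<Rightarrow> (real^4, 'm) atlas \<Rightarrow> 'm set \<Rightarrow> ('m \<Rightarrow> complex^5)
      \<Rightarrow> (real^2) set \<Rightarrow> (real^2 \<Rightarrow> complex^3) \<Rightarrow> bool" where
  "congruent_to_model M \<A> W G \<Theta> \<phi> \<longleftrightarrow>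
     (\<exists>Q \<Omega> \<psi>. unitary_matrix Q \<and> open \<Omega> \<and> (\<forall>(t, s, u, v)\<in>\<Omega>. vector [u, v] \<in> \<Theta>) \<and>
        smooth_map_into M \<A> \<Omega> \<psi> \<and> \<psi> ` \<Omega> = W \<and>
        (\<forall>(D, y)\<in>\<A>. \<forall>(t, s, u, v)\<in>\<Omega> \<inter> \<psi> -` (y ` D). sin s \<noteq> 0 \<longrightarrow>
           inj (frechet_derivative (inv_into D y \<circ> \<psi>) (at (t, s, u, v)))) \<and>
        (\<forall>(t, s, u, v)\<in>\<Omega>. Q *v G (\<psi> (t, s, u, v)) = model_F \<phi> t s u v))"

end

theory Submission
  imports Defs
begin

text \<open>The reason for the theorem is that a certain real plane of \<open>\<complex>\<^sup>5\<close>, read off from the adapted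
  frame, does not move.

  A Lagrangian immersion into projective space is locally covered by a horizontal immersion \<open>G\<close>
  into the sphere, since the connection form of the Hopf fibration is closed along it
  (\<open>lagrangian_horizontal_lift\<close>). Horizontal immersions are also called C-totally real or, as below,
  Legendrian. For such a lift the tensor \<open>A\<close> is visible in the flat space: \<open>dG (A(X, Y))\<close> is
  obtained from the derivative of the vector \<open>dG Y\<close> in the direction \<open>X\<close> by keeping its part in
  \<open>\<i> dG (TM)\<close> (\<open>tensor_A_lift\<close>). So the hypotheses become equations for the vectors
  \<open>E\<^sub>i = dG X\<^sub>i\<close>, which together with \<open>G\<close> form a unitary basis of \<open>\<complex>\<^sup>5\<close> at each point.

  As \<open>A\<close> vanishes on \<open>X\<^sub>3\<close> and \<open>X\<^sub>4\<close>, the derivatives of \<open>E\<^sub>3\<close> and \<open>E\<^sub>4\<close> lie in the real span of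
  \<open>G, E\<^sub>1, \<dots>, E\<^sub>4\<close>. The symmetry of their second derivatives is the Codazzi equation. It says that
  \<open>E\<^sub>3\<close> and \<open>E\<^sub>4\<close> acquire no \<open>E\<^sub>1\<close>, \<open>E\<^sub>2\<close> components along \<open>X\<^sub>3\<close>, \<open>X\<^sub>4\<close>, and that along \<open>X\<^sub>1\<close>, \<open>X\<^sub>2\<close>
  these components are a multiple of a rotation matrix. Integrability of the span of \<open>X\<^sub>1\<close> and
  \<open>X\<^sub>2\<close> makes that matrix symmetric, hence a multiple \<open>\<lambda>\<^sub>a\<close> of the identity (\<open>umbilical\<close>).
  Therefore the vectors \<open>E\<^sub>a - \<lambda>\<^sub>a G\<close>, for \<open>a = 3, 4\<close>, have derivatives in the real span of
  \<open>G, E\<^sub>3, E\<^sub>4\<close>, and once more by symmetry of second derivatives even in the plane that they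
  span themselves (\<open>spine_derivative_in_V0\<close>). So this real plane is constant (\<open>constant_plane\<close>).

  Let \<open>a, b\<close> be the components of \<open>G\<close> in an orthonormal basis \<open>e\<^sub>4, e\<^sub>5\<close> of the plane, and write
  \<open>G = \<rho> \<phi> + a e\<^sub>4 + b e\<^sub>5\<close> with a unit vector \<open>\<phi>\<close>. Then \<open>\<phi>\<close> is constant along \<open>X\<^sub>3\<close>, \<open>X\<^sub>4\<close>, and
  \<open>d\<phi> X\<^sub>i = E\<^sub>i / \<rho>\<close> for \<open>i = 1, 2\<close> (\<open>splitting\<close>). Hence \<open>\<phi>\<close> depends on two parameters only and is a
  Legendrian surface in the unit sphere of the complement \<open>\<complex>\<^sup>3\<close> of \<open>e\<^sub>4, e\<^sub>5\<close>; its second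
  fundamental form is, up to scale, the restriction of \<open>A\<close> to \<open>X\<^sub>1, X\<^sub>2\<close>, which is traceless
  (\<open>traceless_\<phi>\<^sub>3\<close>). Polar coordinates \<open>a = sin s cos t\<close>, \<open>b = sin s sin t\<close>, \<open>\<rho> = cos s\<close>
  give the model immersion (\<open>model_equation\<close>).\<close>

section \<open>Directional derivatives and the calculus of smooth maps\<close>

abbreviation directional_derivative ("\<partial>")
  where "\<partial> f x \<equiv> frechet_derivative f (at x)"

lemma directional_derivative_eq: "(f has_derivative f') (at x) \<Longrightarrow> \<partial> f x = f'"
  by (rule frechet_derivative_at[symmetric])

lemma has_derivative_directional: "f differentiable (at x) \<Longrightarrow> (f has_derivative \<partial> f x) (at x)"
  by (simp add: frechet_derivative_works)

text \<open>The choice operator behind \<open>frechet_derivative\<close> gives equal results on equal sets of derivatives,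
  so agreement near the point suffices even where no derivative exists.\<close>

lemma directional_derivative_cong:
  assumes "open S" "x \<in> S" "\<And>y. y \<in> S \<Longrightarrow> f y = g y"
  shows "\<partial> f x = \<partial> g x"
proof -
  have "(f has_derivative D) (at x) \<longleftrightarrow> (g has_derivative D) (at x)" for D
    using has_derivative_transform_within_open[OF _ assms(1,2), of f D UNIV g]
      has_derivative_transform_within_open[OF _ assms(1,2), of g D UNIV f] assms(3)
    by auto
  then show ?thesis by (simp add: frechet_derivative_def)
qed

lemma Ck_on_subset: "Ck_on k S f \<Longrightarrow> T \<subseteq> S \<Longrightarrow> Ck_on k T f"
  by (induction k arbitrary: f) (auto intro: continuous_on_subset)

lemma Ck_on_imp_continuous_on: "Ck_on k S f \<Longrightarrow> continuous_on S f"
  by (cases k) (auto intro!: continuous_at_imp_continuous_on differentiable_imp_continuous_within)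

lemma Ck_on_SucD: "Ck_on (Suc k) S f \<Longrightarrow> Ck_on k S f"
proof (induction k arbitrary: f)
  case 0
  then show ?case using Ck_on_imp_continuous_on[OF 0] by simp
next
  case (Suc k)
  have d: "f differentiable (at x)" if "x \<in> S" for x using Suc.prems that by auto
  have "Ck_on (Suc k) S (\<lambda>x. \<partial> f x v)" for v
    using Suc.prems unfolding Ck_on.simps(2)[of "Suc k"] by blast
  then have "Ck_on k S (\<lambda>x. \<partial> f x v)" for v by (rule Suc.IH)
  then show ?case using d by simp
qed

lemma Ck_on_cong:
  assumes "open S" "\<And>x. x \<in> S \<Longrightarrow> f x = g x" "Ck_on k S f"
  shows "Ck_on k S g"
  using assms(2,3)
proof (induction k arbitrary: f g)
  case 0
  then show ?case using continuous_on_cong[of S S f g] by simp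
next
  case (Suc k)
  have "g differentiable (at x)" if "x \<in> S" for x
  proof -
    have "(f has_derivative \<partial> f x) (at x)" using Suc.prems that has_derivative_directional by auto
    then have "(g has_derivative \<partial> f x) (at x)"
      using has_derivative_transform_within_open[OF _ assms(1) that] Suc.prems(1) by blast
    then show ?thesis by (rule differentiableI)
  qed
  moreover have "Ck_on k S (\<lambda>x. \<partial> g x v)" for v
  proof (rule Suc.IH[of "\<lambda>x. \<partial> f x v"])
    show "Ck_on k S (\<lambda>x. \<partial> f x v)" using Suc.prems by simp
    show "\<partial> f x v = \<partial> g x v" if "x \<in> S" for x
      using directional_derivative_cong[OF assms(1) that, of f g] Suc.prems(1) by simp
  qed
  ultimately show ?case by simp
qed

text \<open>On an open set it is enough to know some formula for the derivative. The closure
  properties below follow from this rule by induction on the order, with the classical formulas.\<close>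

lemma Ck_on_SucI:
  assumes "open S" "\<And>x. x \<in> S \<Longrightarrow> (f has_derivative f' x) (at x)" "\<And>v. Ck_on k S (\<lambda>x. f' x v)"
  shows "Ck_on (Suc k) S f"
proof -
  have "Ck_on k S (\<lambda>x. \<partial> f x v)" for v
    by (rule Ck_on_cong[OF assms(1) _ assms(3)[of v]]) (simp add: directional_derivative_eq[OF assms(2)])
  then show ?thesis using assms(2) by (auto intro: differentiableI)
qed

lemma Ck_on_Suc_derivative:
  "Ck_on (Suc k) S f \<Longrightarrow> x \<in> S \<Longrightarrow> (f has_derivative \<partial> f x) (at x)"
  "Ck_on (Suc k) S f \<Longrightarrow> Ck_on k S (\<lambda>x. \<partial> f x v)"
  by (auto intro: has_derivative_directional)

lemma Ck_on_const: "open S \<Longrightarrow> Ck_on k S (\<lambda>x. c)"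
proof (induction k arbitrary: c)
  case (Suc k) show ?case by (rule Ck_on_SucI[where f'="\<lambda>x v. 0"]) (use Suc in auto)
qed simp

lemma Ck_on_linear:
  assumes "bounded_linear L" "open S" "Ck_on k S f" shows "Ck_on k S (\<lambda>x. L (f x))"
  using assms(3)
proof (induction k arbitrary: f)
  case 0 then show ?case
    by (simp add: bounded_linear.continuous_on[OF assms(1)])
next
  case (Suc k)
  show ?case
    by (rule Ck_on_SucI[where f'="\<lambda>x v. L (\<partial> f x v)"])
      (use assms Suc Ck_on_Suc_derivative[OF Suc.prems] in \<open>auto intro: bounded_linear.has_derivative\<close>)
qed

lemma Ck_on_add:
  assumes "open S" "Ck_on k S f" "Ck_on k S g" shows "Ck_on k S (\<lambda>x. f x + g x)"
  using assms(2,3)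
proof (induction k arbitrary: f g)
  case 0 then show ?case by (simp add: continuous_on_add)
next
  case (Suc k)
  show ?case
    by (rule Ck_on_SucI[where f'="\<lambda>x v. \<partial> f x v + \<partial> g x v"])
      (use assms Suc Ck_on_Suc_derivative[OF Suc.prems(1)] Ck_on_Suc_derivative[OF Suc.prems(2)]
       in \<open>auto intro: has_derivative_add\<close>)
qed

lemma Ck_on_bilinear:
  assumes "bounded_bilinear h" "open S" "Ck_on k S f" "Ck_on k S g"
  shows "Ck_on k S (\<lambda>x. h (f x) (g x))"
  using assms(3,4)
proof (induction k arbitrary: f g)
  case 0 then show ?case using bounded_bilinear.continuous_on[OF assms(1)] by simp
next
  case (Suc k)
  note f = Ck_on_Suc_derivative[OF Suc.prems(1)] and g = Ck_on_Suc_derivative[OF Suc.prems(2)]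
  show ?case
  proof (rule Ck_on_SucI[where f'="\<lambda>x v. h (f x) (\<partial> g x v) + h (\<partial> f x v) (g x)", OF assms(2)])
    show "((\<lambda>x. h (f x) (g x)) has_derivative (\<lambda>v. h (f x) (\<partial> g x v) + h (\<partial> f x v) (g x))) (at x)"
      if "x \<in> S" for x using bounded_bilinear.FDERIV[OF assms(1) f(1) g(1)] that by simp
    show "Ck_on k S (\<lambda>x. h (f x) (\<partial> g x v) + h (\<partial> f x v) (g x))" for v
      by (intro Ck_on_add Suc.IH assms f g Ck_on_SucD[OF Suc.prems(1)] Ck_on_SucD[OF Suc.prems(2)])
  qed
qed

lemma Ck_on_sum:
  assumes "open S" "\<And>i. i \<in> I \<Longrightarrow> Ck_on k S (f i)" shows "Ck_on k S (\<lambda>x. \<Sum>i\<in>I. f i x)"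
  using assms(2)
proof (induction I rule: infinite_finite_induct)
  case (insert i I)
  then show ?case by (simp add: Ck_on_add[OF assms(1)])
qed (auto simp: Ck_on_const[OF assms(1)])

lemma directional_derivative_basis_expansion:
  fixes f :: "'a::euclidean_space \<Rightarrow> 'b::real_normed_vector"
  assumes "f differentiable (at x)"
  shows "\<partial> f x v = (\<Sum>b\<in>Basis. (v \<bullet> b) *\<^sub>R \<partial> f x b)"
proof -
  interpret linear "\<partial> f x" using linear_frechet_derivative[OF assms] .
  have "\<partial> f x v = \<partial> f x (\<Sum>b\<in>Basis. (v \<bullet> b) *\<^sub>R b)" by (simp add: euclidean_representation)
  then show ?thesis by (simp add: sum scale)
qed

text \<open>The derivative of the composition is expanded in a basis, so that the chain rule becomes a sum
  of products of functions that are covered by the induction hypothesis.\<close>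

lemma Ck_on_compose:
  fixes f :: "'b::euclidean_space \<Rightarrow> 'c::real_normed_vector" and g :: "'a::euclidean_space \<Rightarrow> 'b"
  assumes "open S" "open T" "g ` S \<subseteq> T" "Ck_on k S g" "Ck_on k T f"
  shows "Ck_on k S (\<lambda>x. f (g x))"
  using assms(4,5)
proof (induction k arbitrary: f)
  case 0 then show ?case using assms(3) continuous_on_compose2[of T f S g] by simp
next
  case (Suc k)
  note g = Ck_on_Suc_derivative[OF Suc.prems(1)] and f = Ck_on_Suc_derivative[OF Suc.prems(2)]
  have gS: "g x \<in> T" if "x \<in> S" for x using that assms(3) by blast
  show ?case
  proof (rule Ck_on_SucI[where f'="\<lambda>x v. \<Sum>b\<in>Basis. (\<partial> g x v \<bullet> b) *\<^sub>R \<partial> f (g x) b", OF assms(1)])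
    show "((\<lambda>x. f (g x)) has_derivative (\<lambda>v. \<Sum>b\<in>Basis. (\<partial> g x v \<bullet> b) *\<^sub>R \<partial> f (g x) b)) (at x)"
      if "x \<in> S" for x
    proof -
      have "\<partial> f (g x) (\<partial> g x v) = (\<Sum>b\<in>Basis. (\<partial> g x v \<bullet> b) *\<^sub>R \<partial> f (g x) b)" for v
        using directional_derivative_basis_expansion f(1) gS that differentiableI by blast
      then show ?thesis
        using has_derivative_compose[OF g(1)[OF that] f(1)[OF gS[OF that]]] by simp
    qed
    have *: "bounded_linear (\<lambda>y. y \<bullet> b)" for b :: 'b by (rule bounded_linear_inner_left)
    show "Ck_on k S (\<lambda>x. \<Sum>b\<in>Basis. (\<partial> g x v \<bullet> b) *\<^sub>R \<partial> f (g x) b)" for v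
      by (intro Ck_on_sum Ck_on_bilinear[OF bounded_bilinear_scaleR] assms(1) Suc.IH f
        Ck_on_linear[OF *] g Ck_on_SucD[OF Suc.prems(1)])
  qed
qed

lemma Ck_on_inverse:
  fixes f :: "'a::euclidean_space \<Rightarrow> 'b::real_normed_field"
  assumes "open S" "\<And>x. x \<in> S \<Longrightarrow> f x \<noteq> 0" "Ck_on k S f"
  shows "Ck_on k S (\<lambda>x. inverse (f x))"
  using assms(3)
proof (induction k)
  case 0 then show ?case using assms(2) by (simp add: continuous_on_inverse)
next
  case (Suc k)
  note f = Ck_on_Suc_derivative[OF Suc.prems]
  show ?case
  proof (rule Ck_on_SucI[where f'="\<lambda>x v. - (inverse (f x) * \<partial> f x v * inverse (f x))", OF assms(1)])
    show "((\<lambda>x. inverse (f x)) has_derivative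
      (\<lambda>v. - (inverse (f x) * \<partial> f x v * inverse (f x)))) (at x)" if "x \<in> S" for x
      by (rule Deriv.has_derivative_inverse[where f=f and f'="\<partial> f x"]) (use assms(2) f(1) that in auto)
    have *: "bounded_linear (\<lambda>y :: 'b. - y)" by (simp add: bounded_linear_minus bounded_linear_ident)
    show "Ck_on k S (\<lambda>x. - (inverse (f x) * \<partial> f x v * inverse (f x)))" for v
      by (intro Ck_on_linear[OF *] Ck_on_bilinear[OF bounded_bilinear_mult] assms(1) f
        Suc.IH Ck_on_SucD[OF Suc.prems])
  qed
qed

lemma Ck_on_sqrt:
  assumes "open S" "\<And>x. x \<in> S \<Longrightarrow> f x > 0" "Ck_on k S f"
  shows "Ck_on k S (\<lambda>x. sqrt (f x))"
  using assms(3)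
proof (induction k)
  case 0 then show ?case by (simp add: continuous_on_real_sqrt)
next
  case (Suc k)
  note f = Ck_on_Suc_derivative[OF Suc.prems]
  show ?case
  proof (rule Ck_on_SucI[where f'="\<lambda>x v. \<partial> f x v * (inverse (sqrt (f x)) * (1/2))", OF assms(1)])
    show "((\<lambda>x. sqrt (f x)) has_derivative (\<lambda>v. \<partial> f x v * (inverse (sqrt (f x)) * (1/2)))) (at x)"
      if "x \<in> S" for x
      using has_derivative_compose[OF f(1)[OF that] DERIV_real_sqrt[OF assms(2)[OF that],
         unfolded has_field_derivative_def]] by (simp add: field_simps)
    have "sqrt (f x) \<noteq> 0" if "x \<in> S" for x using assms(2)[OF that] by simp
    then show "Ck_on k S (\<lambda>x. \<partial> f x v * (inverse (sqrt (f x)) * (1/2)))" for v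
      by (intro Ck_on_bilinear[OF bounded_bilinear_mult] assms(1) f
        Ck_on_inverse Suc.IH Ck_on_SucD[OF Suc.prems] Ck_on_const)
  qed
qed

lemma Ck_on_cos_sin:
  assumes "open S" "Ck_on k S f"
  shows "Ck_on k S (\<lambda>x. cos (f x :: real)) \<and> Ck_on k S (\<lambda>x. sin (f x))"
  using assms(2)
proof (induction k)
  case 0 then show ?case by (simp add: continuous_on_cos continuous_on_sin)
next
  case (Suc k)
  note f = Ck_on_Suc_derivative[OF Suc.prems]
  note IH = Suc.IH[OF Ck_on_SucD[OF Suc.prems]]
  have *: "bounded_linear (\<lambda>y :: real. - y)" by (simp add: bounded_linear_minus bounded_linear_ident)
  show ?case
  proof
    show "Ck_on (Suc k) S (\<lambda>x. cos (f x))"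
    proof (rule Ck_on_SucI[where f'="\<lambda>x v. - (\<partial> f x v * sin (f x))", OF assms(1)])
      show "((\<lambda>x. cos (f x)) has_derivative (\<lambda>v. - (\<partial> f x v * sin (f x)))) (at x)" if "x \<in> S" for x
        using f(1)[OF that] by (auto intro!: derivative_eq_intros)
      show "Ck_on k S (\<lambda>x. - (\<partial> f x v * sin (f x)))" for v
        using IH by (intro Ck_on_linear[OF *] Ck_on_bilinear[OF bounded_bilinear_mult] assms(1) f) auto
    qed
    show "Ck_on (Suc k) S (\<lambda>x. sin (f x))"
    proof (rule Ck_on_SucI[where f'="\<lambda>x v. \<partial> f x v * cos (f x)", OF assms(1)])
      show "((\<lambda>x. sin (f x)) has_derivative (\<lambda>v. \<partial> f x v * cos (f x))) (at x)" if "x \<in> S" for x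
        using f(1)[OF that] by (auto intro!: derivative_eq_intros)
      show "Ck_on k S (\<lambda>x. \<partial> f x v * cos (f x))" for v
        using IH by (intro Ck_on_bilinear[OF bounded_bilinear_mult] assms(1) f) auto
    qed
  qed
qed

lemma smooth_on_subset: "smooth_on S f \<Longrightarrow> T \<subseteq> S \<Longrightarrow> smooth_on T f"
  using Ck_on_subset unfolding smooth_on_def by blast

lemma smooth_on_cong:
  "smooth_on S f \<Longrightarrow> open S \<Longrightarrow> (\<And>x. x \<in> S \<Longrightarrow> f x = g x) \<Longrightarrow> smooth_on S g"
  using Ck_on_cong unfolding smooth_on_def by blast

lemma smooth_on_imp_continuous_on: "smooth_on S f \<Longrightarrow> continuous_on S f"
  using Ck_on_imp_continuous_on unfolding smooth_on_def by blast

lemma smooth_onD: "smooth_on S f \<Longrightarrow> Ck_on k S f"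
  by (simp add: smooth_on_def)

lemma smooth_on_differentiable: "smooth_on S f \<Longrightarrow> x \<in> S \<Longrightarrow> f differentiable (at x)"
  using smooth_onD[of S f "Suc 0"] by simp

lemma smooth_on_has_derivative: "smooth_on S f \<Longrightarrow> x \<in> S \<Longrightarrow> (f has_derivative \<partial> f x) (at x)"
  using smooth_on_differentiable has_derivative_directional by blast

lemma smooth_on_directional_derivative: "smooth_on S f \<Longrightarrow> smooth_on S (\<lambda>x. \<partial> f x v)"
  unfolding smooth_on_def[of S "\<lambda>x. \<partial> f x v"]
proof
  fix k assume "smooth_on S f"
  from smooth_onD[OF this, of "Suc k"] show "Ck_on k S (\<lambda>x. \<partial> f x v)" by simp
qed

lemma smooth_onI:
  assumes "open S" "\<And>x. x \<in> S \<Longrightarrow> (f has_derivative f' x) (at x)" "\<And>v. smooth_on S (\<lambda>x. f' x v)"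
  shows "smooth_on S f"
  unfolding smooth_on_def
proof
  fix k
  have "Ck_on (Suc k) S f"
    using Ck_on_SucI[OF assms(1,2)] assms(3) unfolding smooth_on_def by blast
  then show "Ck_on k S f" by (rule Ck_on_SucD)
qed

lemma smooth_on_const: "open S \<Longrightarrow> smooth_on S (\<lambda>x. c)"
  by (simp add: smooth_on_def Ck_on_const)

lemma smooth_on_linear: "bounded_linear L \<Longrightarrow> open S \<Longrightarrow> smooth_on S f \<Longrightarrow> smooth_on S (\<lambda>x. L (f x))"
  by (simp add: smooth_on_def Ck_on_linear)

lemma smooth_on_ident: "open S \<Longrightarrow> smooth_on S (\<lambda>x. x)"
  by (rule smooth_onI[where f'="\<lambda>x v. v"]) (auto intro: smooth_on_const)

lemma smooth_on_add: "open S \<Longrightarrow> smooth_on S f \<Longrightarrow> smooth_on S g \<Longrightarrow> smooth_on S (\<lambda>x. f x + g x)"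
  by (simp add: smooth_on_def Ck_on_add)

lemma smooth_on_minus: "open S \<Longrightarrow> smooth_on S f \<Longrightarrow> smooth_on S (\<lambda>x. - f x)"
  by (rule smooth_on_linear[OF bounded_linear_minus[OF bounded_linear_ident]])

lemma smooth_on_diff:
  "open S \<Longrightarrow> smooth_on S f \<Longrightarrow> smooth_on S g \<Longrightarrow> smooth_on S (\<lambda>x. f x - g x)"
  using smooth_on_add[of S f "\<lambda>x. - g x"] smooth_on_minus[of S g] by simp

lemma smooth_on_bilinear:
  "bounded_bilinear h \<Longrightarrow> open S \<Longrightarrow> smooth_on S f \<Longrightarrow> smooth_on S g \<Longrightarrow> smooth_on S (\<lambda>x. h (f x) (g x))"
  by (simp add: smooth_on_def Ck_on_bilinear)

lemmas smooth_on_inner = smooth_on_bilinear[OF bounded_bilinear_inner]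
lemmas smooth_on_scaleR = smooth_on_bilinear[OF bounded_bilinear_scaleR]
lemmas smooth_on_mult = smooth_on_bilinear[OF bounded_bilinear_mult]

lemma smooth_on_sum:
  "open S \<Longrightarrow> (\<And>i. i \<in> I \<Longrightarrow> smooth_on S (f i)) \<Longrightarrow> smooth_on S (\<lambda>x. \<Sum>i\<in>I. f i x)"
  by (simp add: smooth_on_def Ck_on_sum)

lemma smooth_on_prod:
  fixes f :: "'i \<Rightarrow> 'a::euclidean_space \<Rightarrow> real"
  assumes "open S" "\<And>i. i \<in> I \<Longrightarrow> smooth_on S (f i)"
  shows "smooth_on S (\<lambda>x. \<Prod>i\<in>I. f i x)"
  using assms(2)
proof (induction I rule: infinite_finite_induct)
  case (insert i I)
  then show ?case by (simp add: smooth_on_mult[OF assms(1)])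
qed (auto simp: smooth_on_const[OF assms(1)])

lemma smooth_on_compose:
  fixes f :: "'b::euclidean_space \<Rightarrow> 'c::real_normed_vector" and g :: "'a::euclidean_space \<Rightarrow> 'b"
  assumes "smooth_on T f" "open T" "smooth_on S g" "open S" "\<And>x. x \<in> S \<Longrightarrow> g x \<in> T"
  shows "smooth_on S (\<lambda>x. f (g x))"
  using Ck_on_compose[OF assms(4,2) _ smooth_onD[OF assms(3)] smooth_onD[OF assms(1)]] assms(5)
  by (auto simp: smooth_on_def)

lemma smooth_on_inverse:
  fixes f :: "'a::euclidean_space \<Rightarrow> 'b::real_normed_field"
  shows "open S \<Longrightarrow> smooth_on S f \<Longrightarrow> (\<And>x. x \<in> S \<Longrightarrow> f x \<noteq> 0) \<Longrightarrow> smooth_on S (\<lambda>x. inverse (f x))"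
  by (simp add: smooth_on_def Ck_on_inverse)

lemma smooth_on_divide:
  fixes f :: "'a::euclidean_space \<Rightarrow> 'b::real_normed_field"
  shows "open S \<Longrightarrow> smooth_on S f \<Longrightarrow> smooth_on S g \<Longrightarrow> (\<And>x. x \<in> S \<Longrightarrow> g x \<noteq> 0) \<Longrightarrow> smooth_on S (\<lambda>x. f x / g x)"
  by (simp add: divide_inverse smooth_on_mult smooth_on_inverse)

lemma smooth_on_sqrt:
  "open S \<Longrightarrow> smooth_on S f \<Longrightarrow> (\<And>x. x \<in> S \<Longrightarrow> f x > 0) \<Longrightarrow> smooth_on S (\<lambda>x. sqrt (f x))"
  by (simp add: smooth_on_def Ck_on_sqrt)

lemma smooth_on_cos: "open S \<Longrightarrow> smooth_on S f \<Longrightarrow> smooth_on S (\<lambda>x. cos (f x :: real))"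
  and smooth_on_sin: "open S \<Longrightarrow> smooth_on S f \<Longrightarrow> smooth_on S (\<lambda>x. sin (f x :: real))"
  by (simp_all add: smooth_on_def Ck_on_cos_sin)

lemma smooth_on_norm:
  fixes f :: "'a::euclidean_space \<Rightarrow> 'b::euclidean_space"
  shows "open S \<Longrightarrow> smooth_on S f \<Longrightarrow> (\<And>x. x \<in> S \<Longrightarrow> f x \<noteq> 0) \<Longrightarrow> smooth_on S (\<lambda>x. norm (f x))"
  by (simp add: norm_eq_sqrt_inner smooth_on_sqrt smooth_on_inner)

lemma smooth_on_sgn:
  fixes f :: "'a::euclidean_space \<Rightarrow> 'b::euclidean_space"
  shows "open S \<Longrightarrow> smooth_on S f \<Longrightarrow> (\<And>x. x \<in> S \<Longrightarrow> f x \<noteq> 0) \<Longrightarrow> smooth_on S (\<lambda>x. sgn (f x))"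
  by (simp add: sgn_div_norm smooth_on_scaleR smooth_on_inverse smooth_on_norm)

lemma smooth_on_vec_nth:
  fixes f :: "'a::euclidean_space \<Rightarrow> 'b::real_normed_vector ^ 'n"
  shows "open S \<Longrightarrow> smooth_on S f \<Longrightarrow> smooth_on S (\<lambda>x. f x $ i)"
  by (rule smooth_on_linear[OF bounded_linear_vec_nth])

lemma smooth_on_vec_lambda:
  fixes f :: "'n::finite \<Rightarrow> 'a::euclidean_space \<Rightarrow> 'b::euclidean_space"
  assumes "open S" "\<And>i. smooth_on S (f i)"
  shows "smooth_on S (\<lambda>x. \<chi> i. f i x)"
proof -
  have "bounded_linear (axis i :: 'b \<Rightarrow> 'b ^ 'n)" for i
    by (intro linear_conv_bounded_linear[THEN iffD1] linearI) (auto simp: vec_eq_iff axis_def)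
  then have "smooth_on S (\<lambda>x. axis i (f i x) :: 'b ^ 'n)" for i
    using smooth_on_linear[OF _ assms(1), of "axis i :: 'b \<Rightarrow> 'b ^ 'n"] assms(2) by blast
  then have "smooth_on S (\<lambda>x. \<Sum>i\<in>UNIV. axis i (f i x) :: 'b ^ 'n)"
    by (rule smooth_on_sum[OF assms(1)])
  moreover have "(\<Sum>i\<in>UNIV. axis i (f i x) :: 'b ^ 'n) = (\<chi> i. f i x)" for x
    by (simp add: vec_eq_iff axis_def)
  ultimately show ?thesis by simp
qed

lemma smooth_on_directional_derivative_along:
  fixes f :: "'a::euclidean_space \<Rightarrow> 'b::real_normed_vector"
  assumes "open S" "smooth_on S f" "smooth_on S X"
  shows "smooth_on S (\<lambda>x. \<partial> f x (X x))"
proof (rule smooth_on_cong)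
  show "smooth_on S (\<lambda>x. \<Sum>b\<in>Basis. (X x \<bullet> b) *\<^sub>R \<partial> f x b)"
    by (intro smooth_on_sum smooth_on_scaleR smooth_on_inner smooth_on_const assms
      smooth_on_directional_derivative)
  show "(\<Sum>b\<in>Basis. (X x \<bullet> b) *\<^sub>R \<partial> f x b) = \<partial> f x (X x)" if "x \<in> S" for x
    using directional_derivative_basis_expansion[OF smooth_on_differentiable[OF assms(2) that]] by metis
qed (rule assms(1))

lemma derivative_inner:
  assumes "f differentiable (at q)" "g differentiable (at q)"
  shows "\<partial> (\<lambda>p. f p \<bullet> g p) q u = f q \<bullet> \<partial> g q u + \<partial> f q u \<bullet> g q"
  using directional_derivative_eq[OF has_derivative_inner[OF has_derivative_directional[OF assms(1)]
    has_derivative_directional[OF assms(2)]]] by simp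

lemma derivative_locally_constant:
  assumes "open D" "q \<in> D" "\<And>p. p \<in> D \<Longrightarrow> f p = k" shows "\<partial> f q u = 0"
  using directional_derivative_cong[OF assms(1,2), of f "\<lambda>_. k"] assms(3) by simp

lemma derivative_chain:
  assumes "f differentiable (at (g x))" "g differentiable (at x)"
  shows "\<partial> (\<lambda>y. f (g y)) x u = \<partial> f (g x) (\<partial> g x u)"
  using directional_derivative_eq[OF has_derivative_compose[OF has_derivative_directional[OF assms(2)]
    has_derivative_directional[OF assms(1)]]] by simp

lemma constant_inner_derivative:
  fixes f g :: "'a::euclidean_space \<Rightarrow> 'b::euclidean_space"
  assumes "open B" "q \<in> B" "smooth_on B f" "smooth_on B g" "\<And>p. p \<in> B \<Longrightarrow> f p \<bullet> g p = k"
  shows "\<partial> f q u \<bullet> g q = - (f q \<bullet> \<partial> g q u)"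
  using derivative_locally_constant[OF assms(1,2,5), where u=u]
    derivative_inner[OF smooth_on_differentiable[OF assms(3,2)] smooth_on_differentiable[OF assms(4,2)], where u=u]
  by simp

lemma derivative_vec_nth:
  fixes f :: "'a::euclidean_space \<Rightarrow> real^'n"
  assumes "f differentiable (at x)" shows "\<partial> f x u $ i = \<partial> (\<lambda>y. f y $ i) x u"
  using directional_derivative_eq[OF bounded_linear.has_derivative[OF bounded_linear_vec_nth has_derivative_directional[OF assms]], of i]
  by simp

text \<open>The product rule for the evaluation \<open>F p (Y p)\<close> of a field of linear maps on a vector field.\<close>

lemma has_derivative_linear_family:
  fixes F :: "'a::euclidean_space \<Rightarrow> 'c::euclidean_space \<Rightarrow> 'b::real_normed_vector"
  assumes S: "open S" "q \<in> S" and lin: "\<And>p. p \<in> S \<Longrightarrow> linear (F p)"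
    and F: "\<And>v. (\<lambda>p. F p v) differentiable (at q)" and Y: "Y differentiable (at q)"
  shows "((\<lambda>p. F p (Y p)) has_derivative (\<lambda>u. \<partial> (\<lambda>p. F p (Y q)) q u + F q (\<partial> Y q u))) (at q)"
proof -
  have expand: "F p v = (\<Sum>b\<in>Basis. (v \<bullet> b) *\<^sub>R F p b)" if "p \<in> S" for p v
    using euclidean_representation[of v] linear_sum[OF lin[OF that], of "\<lambda>b. (v \<bullet> b) *\<^sub>R b" Basis]
      linear_cmul[OF lin[OF that]] by simp
  have dF: "((\<lambda>p. F p v) has_derivative \<partial> (\<lambda>p. F p v) q) (at q)" for v
    by (rule has_derivative_directional[OF F])
  have "((\<lambda>p. \<Sum>b\<in>Basis. (v \<bullet> b) *\<^sub>R F p b) has_derivative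
      (\<lambda>u. \<Sum>b\<in>Basis. (v \<bullet> b) *\<^sub>R \<partial> (\<lambda>p. F p b) q u)) (at q)" for v
    by (intro has_derivative_sum has_derivative_scaleR_right dF)
  then have "((\<lambda>p. F p v) has_derivative (\<lambda>u. \<Sum>b\<in>Basis. (v \<bullet> b) *\<^sub>R \<partial> (\<lambda>p. F p b) q u)) (at q)" for v
    by (rule has_derivative_transform_within_open[OF _ S]) (metis expand)
  note const = directional_derivative_eq[OF this]
  have "((\<lambda>p. \<Sum>b\<in>Basis. (Y p \<bullet> b) *\<^sub>R F p b) has_derivative
      (\<lambda>u. \<Sum>b\<in>Basis. (Y q \<bullet> b) *\<^sub>R \<partial> (\<lambda>p. F p b) q u + (\<partial> Y q u \<bullet> b) *\<^sub>R F q b)) (at q)"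
    by (intro has_derivative_sum has_derivative_scaleR dF has_derivative_inner_left
      has_derivative_directional Y)
  then have "((\<lambda>p. F p (Y p)) has_derivative
      (\<lambda>u. \<Sum>b\<in>Basis. (Y q \<bullet> b) *\<^sub>R \<partial> (\<lambda>p. F p b) q u + (\<partial> Y q u \<bullet> b) *\<^sub>R F q b)) (at q)"
    by (rule has_derivative_transform_within_open[OF _ S]) (metis expand)
  then show ?thesis
    by (simp only: const[of "Y q"] sum.distrib expand[OF S(2), of "\<partial> Y q _"])
qed

section \<open>Symmetry of second derivatives, inverse functions, primitives\<close>

lemma directional_derivative_inner_right:
  assumes "f differentiable (at x)"
  shows "\<partial> (\<lambda>y. f y \<bullet> b) x v = \<partial> f x v \<bullet> b"
proof -
  have "((\<lambda>y. f y \<bullet> b) has_derivative (\<lambda>v. \<partial> f x v \<bullet> b)) (at x)"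
    by (rule has_derivative_inner_left[OF has_derivative_directional[OF assms]])
  then show ?thesis by (simp add: directional_derivative_eq)
qed

lemma has_real_derivative_along_line:
  fixes g :: "'a::euclidean_space \<Rightarrow> real"
  assumes "g differentiable (at (x + s *\<^sub>R u))"
  shows "((\<lambda>s. g (x + s *\<^sub>R u)) has_real_derivative \<partial> g (x + s *\<^sub>R u) u) (at s)"
proof -
  have "((\<lambda>s. x + s *\<^sub>R u) has_derivative (\<lambda>h. h *\<^sub>R u)) (at s)"
    by (auto intro!: derivative_eq_intros)
  from has_derivative_compose[OF this has_derivative_directional[OF assms]]
  have "((\<lambda>s. g (x + s *\<^sub>R u)) has_derivative (\<lambda>h. \<partial> g (x + s *\<^sub>R u) (h *\<^sub>R u))) (at s)" .
  moreover have "\<partial> g (x + s *\<^sub>R u) (h *\<^sub>R u) = \<partial> g (x + s *\<^sub>R u) u * h" for h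
    using linear_cmul[OF linear_frechet_derivative[OF assms], of h u] by simp
  ultimately show ?thesis by (simp add: has_field_derivative_def)
qed

text \<open>The second difference of \<open>g\<close> over a parallelogram is a value of the mixed second derivative, by
  two applications of the mean value theorem. The order of the two steps is the order of the
  derivatives, while the second difference itself is symmetric in \<open>u\<close> and \<open>v\<close>.\<close>

lemma second_difference_mean_value:
  fixes g :: "'a::euclidean_space \<Rightarrow> real"
  assumes g: "Ck_on 2 S g" and h: "h > 0"
    and S: "\<And>s t. 0 \<le> s \<Longrightarrow> s \<le> h \<Longrightarrow> 0 \<le> t \<Longrightarrow> t \<le> h \<Longrightarrow> x + s *\<^sub>R u + t *\<^sub>R v \<in> S"
  obtains s t where "0 \<le> s" "s \<le> h" "0 \<le> t" "t \<le> h"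
    "g (x + h *\<^sub>R u + h *\<^sub>R v) - g (x + h *\<^sub>R u) - g (x + h *\<^sub>R v) + g x
      = h * h * \<partial> (\<lambda>y. \<partial> g y u) (x + s *\<^sub>R u + t *\<^sub>R v) v"
proof -
  have g1: "g differentiable (at y)" and g2: "(\<lambda>y. \<partial> g y u) differentiable (at y)" if "y \<in> S" for y
    using g that by (simp_all add: numeral_2_eq_2)
  define F where "F s = g (x + h *\<^sub>R v + s *\<^sub>R u) - g (x + s *\<^sub>R u)" for s
  have "(F has_real_derivative \<partial> g (x + h *\<^sub>R v + s *\<^sub>R u) u - \<partial> g (x + s *\<^sub>R u) u) (at s)"
    if "0 \<le> s" "s \<le> h" for s
    unfolding F_def
    using S[of s h] S[of s 0] that h
    by (intro DERIV_diff has_real_derivative_along_line g1) (auto simp: algebra_simps)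
  from MVT2[OF h this] obtain s where s: "0 < s" "s < h"
    "F h - F 0 = h * (\<partial> g (x + h *\<^sub>R v + s *\<^sub>R u) u - \<partial> g (x + s *\<^sub>R u) u)"
    by auto
  have "((\<lambda>t. \<partial> g (x + s *\<^sub>R u + t *\<^sub>R v) u) has_real_derivative
      \<partial> (\<lambda>y. \<partial> g y u) (x + s *\<^sub>R u + t *\<^sub>R v) v) (at t)" if "0 \<le> t" "t \<le> h" for t
    by (rule has_real_derivative_along_line[of "\<lambda>y. \<partial> g y u"]) (use g2 S[of s t] that s in auto)
  from MVT2[OF h this] obtain t where t: "0 < t" "t < h"
    "\<partial> g (x + s *\<^sub>R u + h *\<^sub>R v) u - \<partial> g (x + s *\<^sub>R u) u
       = h * \<partial> (\<lambda>y. \<partial> g y u) (x + s *\<^sub>R u + t *\<^sub>R v) v"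
    by auto
  have "x + h *\<^sub>R v + s *\<^sub>R u = x + s *\<^sub>R u + h *\<^sub>R v" "x + h *\<^sub>R v + h *\<^sub>R u = x + h *\<^sub>R u + h *\<^sub>R v"
    by (simp_all add: algebra_simps)
  then show thesis using s t by (intro that[of s t]) (auto simp: F_def algebra_simps)
qed

lemma second_derivative_symmetric_real:
  fixes g :: "'a::euclidean_space \<Rightarrow> real"
  assumes S: "open S" "x \<in> S" and g: "Ck_on 2 S g"
  shows "\<partial> (\<lambda>y. \<partial> g y u) x v = \<partial> (\<lambda>y. \<partial> g y v) x u"
proof (rule ccontr)
  define p q where "p y = \<partial> (\<lambda>y. \<partial> g y u) y v" and "q y = \<partial> (\<lambda>y. \<partial> g y v) y u" for y
  assume "\<not> ?thesis"
  then have e: "\<bar>p x - q x\<bar> > 0" by (simp add: p_def q_def)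
  \<comment> \<open>values of both mixed derivatives agree on arbitrarily small parallelograms, so by continuity
    they agree at the point\<close>
  have "continuous_on S p" "continuous_on S q"
    using g by (simp_all add: numeral_2_eq_2 p_def[abs_def] q_def[abs_def])
  then have "isCont p x" "isCont q x" using S continuous_on_eq_continuous_at by blast+
  have e2: "\<bar>p x - q x\<bar> / 2 > 0" using e by simp
  obtain d1 where d1: "d1 > 0" "\<And>y. dist y x < d1 \<Longrightarrow> \<bar>p y - p x\<bar> < \<bar>p x - q x\<bar> / 2"
    using \<open>isCont p x\<close> e2 unfolding continuous_at_eps_delta dist_real_def by blast
  obtain d2 where d2: "d2 > 0" "\<And>y. dist y x < d2 \<Longrightarrow> \<bar>q y - q x\<bar> < \<bar>p x - q x\<bar> / 2"
    using \<open>isCont q x\<close> e2 unfolding continuous_at_eps_delta dist_real_def by blast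
  obtain d3 where d3: "d3 > 0" "ball x d3 \<subseteq> S" using S open_contains_ball by blast
  define d where "d = min d1 (min d2 d3)"
  define h where "h = d / (2 * (norm u + norm v + 1))"
  have n: "norm u + norm v + 1 > 0" using norm_ge_zero[of u] norm_ge_zero[of v] by linarith
  have h: "h > 0" using d1(1) d2(1) d3(1) n by (simp add: h_def d_def)
  have small: "dist (x + s *\<^sub>R a + t *\<^sub>R b) x < d"
    if "0 \<le> s" "s \<le> h" "0 \<le> t" "t \<le> h" "norm a + norm b = norm u + norm v" for s t a b
  proof -
    have "dist (x + s *\<^sub>R a + t *\<^sub>R b) x \<le> s * norm a + t * norm b"
      using norm_triangle_ineq[of "s *\<^sub>R a" "t *\<^sub>R b"] that by (simp add: dist_norm add.assoc)
    also have "\<dots> \<le> h * norm a + h * norm b"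
      using that by (intro add_mono mult_right_mono) auto
    also have "\<dots> = h * (norm u + norm v)"
      unfolding that(5)[symmetric] by (simp add: algebra_simps)
    also have "\<dots> < h * (2 * (norm u + norm v + 1))"
      using h n by (intro mult_strict_left_mono) (simp_all add: distrib_left)
    also have "\<dots> = d" using n by (simp add: h_def)
    finally show ?thesis .
  qed
  have S': "x + s *\<^sub>R a + t *\<^sub>R b \<in> S"
    if "0 \<le> s" "s \<le> h" "0 \<le> t" "t \<le> h" "norm a + norm b = norm u + norm v" for s t a b
    using small[OF that] d3(2) by (auto simp: d_def dist_commute)
  obtain s t where 1: "0 \<le> s" "s \<le> h" "0 \<le> t" "t \<le> h"
    "g (x + h *\<^sub>R u + h *\<^sub>R v) - g (x + h *\<^sub>R u) - g (x + h *\<^sub>R v) + g x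
      = h * h * p (x + s *\<^sub>R u + t *\<^sub>R v)"
    unfolding p_def using second_difference_mean_value[OF g h, of x u v] S' by blast
  obtain s' t' where 2: "0 \<le> s'" "s' \<le> h" "0 \<le> t'" "t' \<le> h"
    "g (x + h *\<^sub>R v + h *\<^sub>R u) - g (x + h *\<^sub>R v) - g (x + h *\<^sub>R u) + g x
      = h * h * q (x + s' *\<^sub>R v + t' *\<^sub>R u)"
    unfolding q_def using second_difference_mean_value[OF g h, of x v u] S' by (metis add.commute)
  have xx: "x + h *\<^sub>R v + h *\<^sub>R u = x + h *\<^sub>R u + h *\<^sub>R v" by (simp add: algebra_simps)
  have "h * h * p (x + s *\<^sub>R u + t *\<^sub>R v) = h * h * q (x + s' *\<^sub>R v + t' *\<^sub>R u)"
    using 1(5) 2(5)[unfolded xx] by linarith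
  then have "p (x + s *\<^sub>R u + t *\<^sub>R v) = q (x + s' *\<^sub>R v + t' *\<^sub>R u)" using h by simp
  moreover have "\<bar>p (x + s *\<^sub>R u + t *\<^sub>R v) - p x\<bar> < \<bar>p x - q x\<bar> / 2"
    using small[of s t u v] 1 by (intro d1(2)) (simp add: d_def)
  moreover have "\<bar>q (x + s' *\<^sub>R v + t' *\<^sub>R u) - q x\<bar> < \<bar>p x - q x\<bar> / 2"
    using small[of s' t' v u] 2 by (intro d2(2)) (simp add: d_def)
  ultimately show False
    using abs_triangle_ineq4[of "p (x + s *\<^sub>R u + t *\<^sub>R v) - q x" "p (x + s *\<^sub>R u + t *\<^sub>R v) - p x"]
    by simp
qed

lemma second_derivative_symmetric:
  fixes f :: "'a::euclidean_space \<Rightarrow> 'b::euclidean_space"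
  assumes S: "open S" "x \<in> S" and f: "smooth_on S f"
  shows "\<partial> (\<lambda>y. \<partial> f y u) x v = \<partial> (\<lambda>y. \<partial> f y v) x u"
proof (rule euclidean_eqI)
  fix b :: 'b
  have c: "\<partial> (\<lambda>y. \<partial> f y u) x v \<bullet> b = \<partial> (\<lambda>y. \<partial> (\<lambda>z. f z \<bullet> b) y u) x v" for u v
  proof -
    have "\<partial> (\<lambda>y. \<partial> f y u) x v \<bullet> b = \<partial> (\<lambda>y. \<partial> f y u \<bullet> b) x v"
      by (rule directional_derivative_inner_right[symmetric])
        (rule smooth_on_differentiable[OF smooth_on_directional_derivative[OF f] S(2)])
    also have "\<dots> = \<partial> (\<lambda>y. \<partial> (\<lambda>z. f z \<bullet> b) y u) x v"
      using directional_derivative_cong[OF S, of "\<lambda>y. \<partial> f y u \<bullet> b" "\<lambda>y. \<partial> (\<lambda>z. f z \<bullet> b) y u"]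
        directional_derivative_inner_right[OF smooth_on_differentiable[OF f]] by simp
    finally show ?thesis .
  qed
  have "smooth_on S (\<lambda>z. f z \<bullet> b)" by (intro smooth_on_inner smooth_on_const S f)
  from second_derivative_symmetric_real[OF S smooth_onD[OF this]]
  show "\<partial> (\<lambda>y. \<partial> f y u) x v \<bullet> b = \<partial> (\<lambda>y. \<partial> f y v) x u \<bullet> b" by (simp add: c)
qed

lemma linear_directional_derivative: "smooth_on S f \<Longrightarrow> x \<in> S \<Longrightarrow> linear (\<partial> f x)"
  by (rule linear_frechet_derivative[OF smooth_on_differentiable])

text \<open>By the rule of Cramer, the entries of the inverse matrix are rational in the entries of the
  matrix.\<close>

lemma smooth_on_inverse_operator:
  fixes f :: "real^'n \<Rightarrow> real^'n"
  assumes U: "open U" and f: "smooth_on U f" and b: "\<And>x. x \<in> U \<Longrightarrow> bij (\<partial> f x)"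
  shows "smooth_on U (\<lambda>x. inv (\<partial> f x) v)"
proof -
  define A where "A x = matrix (\<partial> f x)" for x
  have lin: "linear (\<partial> f x)" if "x \<in> U" for x using linear_directional_derivative[OF f that] .
  have d: "det (A x) \<noteq> 0" if "x \<in> U" for x
    using det_nz_iff_inj[OF lin[OF that]] b[OF that] by (simp add: A_def bij_is_inj)
  have eq: "(\<chi> k. det (\<chi> i j. if j = k then v $ i else A x $ i $ j) / det (A x)) = inv (\<partial> f x) v"
    if "x \<in> U" for x
  proof -
    have "A x *v (inv (\<partial> f x) v) = v"
      using matrix_vector_mul(2)[OF lin[OF that]] b[OF that]
      by (metis A_def bij_is_surj surj_f_inv_f)
    then show ?thesis by (subst (asm) cramer[OF d[OF that]]) simp
  qed
  have A: "smooth_on U (\<lambda>x. A x $ i $ j)" for i j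
    unfolding A_def matrix_def using smooth_on_vec_nth[OF U smooth_on_directional_derivative[OF f]] by simp
  have D: "smooth_on U (\<lambda>x. det (B x))" if "\<And>i j. smooth_on U (\<lambda>x. B x $ i $ j)" for B :: "_ \<Rightarrow> real^'n^'n"
    unfolding det_def by (intro smooth_on_sum smooth_on_mult smooth_on_prod smooth_on_const U that)
  have "smooth_on U (\<lambda>x. \<chi> k. det (\<chi> i j. if j = k then v $ i else A x $ i $ j) / det (A x))"
  proof (intro smooth_on_vec_lambda smooth_on_divide U D A d)
    fix k i j
    show "smooth_on U (\<lambda>x. (\<chi> i j. if j = k then v $ i else A x $ i $ j) $ i $ j)"
      by (cases "j = k") (simp_all add: A smooth_on_const[OF U])
  qed
  then show ?thesis by (rule smooth_on_cong[OF _ U eq])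
qed

text \<open>The derivative of the inverse is \<open>inv (\<partial> f (g y))\<close>, so \<open>g\<close> is of class \<open>C\<^sup>k\<^sup>+\<^sup>1\<close> if it is of
  class \<open>C\<^sup>k\<close>.\<close>

theorem smooth_inverse_function:
  fixes f :: "real^'n \<Rightarrow> real^'n"
  assumes S: "open S" "x0 \<in> S" and f: "smooth_on S f" and inj: "inj (\<partial> f x0)"
  obtains U V g where "open U" "U \<subseteq> S" "x0 \<in> U" "open V" "homeomorphism U V f g" "smooth_on V g"
    "\<And>x. x \<in> U \<Longrightarrow> bij (\<partial> f x)"
proof -
  define f' where "f' x = Blinfun (\<partial> f x)" for x
  have bl: "bounded_linear (\<partial> f x)" if "x \<in> S" for x
    using linear_directional_derivative[OF f that] by (simp add: linear_conv_bounded_linear)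
  have f': "blinfun_apply (f' x) = \<partial> f x" if "x \<in> S" for x
    by (simp add: f'_def bounded_linear_Blinfun_apply[OF bl[OF that]])
  have der: "(f has_derivative blinfun_apply (f' x)) (at x)" if "x \<in> S" for x
    using smooth_on_has_derivative[OF f that] by (simp add: f'[OF that])
  have cont: "continuous_on S f'"
  proof (rule continuous_on_blinfun_componentwise)
    fix i :: "real^'n"
    show "continuous_on S (\<lambda>x. blinfun_apply (f' x) i)"
      using smooth_on_imp_continuous_on[OF smooth_on_directional_derivative[OF f]]
      by (rule continuous_on_eq) (simp add: f')
  qed
  obtain k where k: "linear k" "k \<circ> \<partial> f x0 = id"
    using linear_injective_left_inverse[OF linear_directional_derivative[OF f S(2)] inj] by blast
  have "Blinfun k o\<^sub>L f' x0 = id_blinfun"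
    using k bounded_linear_Blinfun_apply[of k]
    by (intro blinfun_eqI) (simp add: f'[OF S(2)] linear_conv_bounded_linear[symmetric] fun_eq_iff o_def)
  from inverse_function_theorem[OF S(1) der cont S(2) this]
  obtain U V g g' where *: "open U" "U \<subseteq> S" "x0 \<in> U" "open V" "f x0 \<in> V" "homeomorphism U V f g"
    "\<And>y. y \<in> V \<Longrightarrow> (g has_derivative (g' y)) (at y)"
    "\<And>y. y \<in> V \<Longrightarrow> g' y = inv (blinfun_apply (f'(g y)))"
    "\<And>y. y \<in> V \<Longrightarrow> bij (blinfun_apply (f'(g y)))" by blast
  have gU: "g y \<in> U" if "y \<in> V" for y using *(6) that by (auto simp: homeomorphism_def)
  have b: "bij (\<partial> f x)" if "x \<in> U" for x
  proof -
    have "x \<in> S" "f x \<in> V" "g (f x) = x" using *(2,6) that by (auto simp: homeomorphism_def)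
    then show ?thesis using *(9)[of "f x"] f'[of x] by simp
  qed
  have g': "(g has_derivative (\<lambda>v. inv (\<partial> f (g y)) v)) (at y)" if "y \<in> V" for y
    using *(7)[OF that] *(8)[OF that] f'[of "g y"] gU[OF that] *(2) by auto
  note inv_smooth = smooth_on_inverse_operator[OF *(1) smooth_on_subset[OF f *(2)] b]
  have "Ck_on k V g" for k
  proof (induction k)
    case 0
    show ?case using *(6) by (simp add: homeomorphism_def)
  next
    case (Suc k)
    show ?case
    proof (rule Ck_on_SucI[OF *(4) g'])
      show "Ck_on k V (\<lambda>y. inv (\<partial> f (g y)) v)" for v
        by (rule Ck_on_compose[OF *(4,1) _ Suc, of "\<lambda>x. inv (\<partial> f x) v"])
          (use gU smooth_onD[OF inv_smooth] in auto)
    qed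
  qed
  then have "smooth_on V g" by (simp add: smooth_on_def)
  then show thesis using that * b by blast
qed

text \<open>The Poincare lemma for 1-forms, written as vector fields: integrating along the segments from
  the centre of the ball gives a primitive, because symmetry of the derivative turns the
  derivative under the integral sign into the total derivative of \<open>t * (w (c x t) \<bullet> v)\<close>.\<close>

lemma closed_field_has_primitive:
  fixes w :: "'a::euclidean_space \<Rightarrow> 'a"
  assumes w: "smooth_on (ball a r) w"
    and sym: "\<And>x u v. x \<in> ball a r \<Longrightarrow> \<partial> w x u \<bullet> v = \<partial> w x v \<bullet> u"
  shows "\<exists>\<theta>. \<forall>x\<in>ball a r. (\<theta> has_derivative (\<lambda>v. w x \<bullet> v)) (at x)"
proof -
  define c where "c x t = a + t *\<^sub>R (x - a)" for x and t :: real
  have cB: "c x t \<in> ball a r" if "x \<in> ball a r" "t \<in> cbox 0 1" for x t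
  proof -
    have "norm (t *\<^sub>R (x - a)) \<le> norm (x - a)" using that by (simp add: mult_left_le_one_le)
    then show ?thesis using that by (simp add: c_def dist_norm norm_minus_commute)
  qed
  define f where "f x t = w (c x t) \<bullet> (x - a)" for x t
  define f' where "f' x t v = t * (\<partial> w (c x t) v \<bullet> (x - a)) + w (c x t) \<bullet> v" for x t v
  have bl: "bounded_linear (f' x t)" if "x \<in> ball a r" "t \<in> cbox 0 1" for x t
  proof -
    interpret linear "\<partial> w (c x t)" using linear_directional_derivative[OF w cB[OF that]] .
    have "linear (f' x t)" by (rule linearI) (simp_all add: f'_def add scale algebra_simps inner_add)
    then show ?thesis by (simp add: linear_conv_bounded_linear)
  qed
  note app = bounded_linear_Blinfun_apply[OF bl]
  have dw: "(w has_derivative \<partial> w (c x t)) (at (c x t))" if "x \<in> ball a r" "t \<in> cbox 0 1" for x t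
    using smooth_on_has_derivative[OF w cB[OF that]] .
  have df: "((\<lambda>x. f x t) has_derivative blinfun_apply (Blinfun (f' x t))) (at x within ball a r)"
    if xt: "x \<in> ball a r" "t \<in> cbox 0 1" for x t
  proof -
    have "((\<lambda>x. c x t) has_derivative (\<lambda>v. t *\<^sub>R v)) (at x)"
      unfolding c_def by (auto intro!: derivative_eq_intros)
    from has_derivative_compose[OF this dw[OF xt]]
    have "((\<lambda>x. w (c x t)) has_derivative (\<lambda>v. \<partial> w (c x t) (t *\<^sub>R v))) (at x)" .
    moreover have "\<partial> w (c x t) (t *\<^sub>R v) = t *\<^sub>R \<partial> w (c x t) v" for v
      using linear_cmul[OF linear_directional_derivative[OF w cB[OF xt]]] .
    ultimately have "((\<lambda>x. w (c x t)) has_derivative (\<lambda>v. t *\<^sub>R \<partial> w (c x t) v)) (at x)" by simp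
    then have "((\<lambda>x. f x t) has_derivative f' x t) (at x)"
      unfolding f_def[abs_def] f'_def[abs_def]
      by (auto intro!: derivative_eq_intros simp: fun_eq_iff inner_commute)
    then show ?thesis by (simp add: app[OF xt] has_derivative_at_withinI)
  qed
  have contc: "continuous_on (ball a r \<times> cbox 0 1) (\<lambda>z. c (fst z) (snd z))"
    unfolding c_def by (intro continuous_intros)
  have sub: "(\<lambda>z. c (fst z) (snd z)) ` (ball a r \<times> cbox 0 1) \<subseteq> ball a r" using cB by auto
  have contB: "continuous_on (ball a r \<times> cbox 0 1) (\<lambda>(x, t). Blinfun (f' x t))"
  proof (rule continuous_on_blinfun_componentwise)
    fix v :: 'a
    have "continuous_on (ball a r \<times> cbox 0 1) (\<lambda>z. \<partial> w (c (fst z) (snd z)) v)"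
      "continuous_on (ball a r \<times> cbox 0 1) (\<lambda>z. w (c (fst z) (snd z)))"
      using continuous_on_compose2[OF smooth_on_imp_continuous_on[OF smooth_on_directional_derivative[OF w]] contc sub]
        continuous_on_compose2[OF smooth_on_imp_continuous_on[OF w] contc sub] by auto
    then have "continuous_on (ball a r \<times> cbox 0 1) (\<lambda>z. f' (fst z) (snd z) v)"
      unfolding f'_def by (intro continuous_intros) auto
    then show "continuous_on (ball a r \<times> cbox 0 1) (\<lambda>z. blinfun_apply (case z of (x, t) \<Rightarrow> Blinfun (f' x t)) v)"
      by (rule continuous_on_eq) (auto simp: app)
  qed
  have cont1: "continuous_on (cbox 0 1) (\<lambda>t. g (x, t))"
    if "continuous_on (ball a r \<times> cbox 0 1) g" "x \<in> ball a r" for g :: "'a \<times> real \<Rightarrow> 'c::topological_space" and x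
    by (rule continuous_on_compose2[OF that(1)]) (use that in \<open>auto intro!: continuous_intros\<close>)
  have intf: "f x integrable_on cbox 0 1" if "x \<in> ball a r" for x
  proof (rule integrable_continuous)
    have "continuous_on (cbox 0 1) (\<lambda>t. w (c x t))"
      using cont1[OF continuous_on_compose2[OF smooth_on_imp_continuous_on[OF w] contc sub] that] by simp
    then show "continuous_on (cbox 0 1) (f x)" unfolding f_def by (intro continuous_intros)
  qed
  define \<theta> where "\<theta> x = integral (cbox 0 1) (f x)" for x
  have "(\<theta> has_derivative (\<lambda>v. w x \<bullet> v)) (at x)" if x: "x \<in> ball a r" for x
  proof -
    have "(\<theta> has_derivative blinfun_apply (integral (cbox 0 1) (\<lambda>t. Blinfun (f' x t)))) (at x within ball a r)"
      unfolding \<theta>_def[abs_def] by (rule leibniz_rule[OF df intf contB x convex_ball])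
    moreover have "blinfun_apply (integral (cbox 0 1) (\<lambda>t. Blinfun (f' x t))) v = w x \<bullet> v" for v
    proof -
      have "(\<lambda>t. Blinfun (f' x t)) integrable_on cbox 0 1"
        using integrable_continuous[OF cont1[OF contB x]] by simp
      then have "blinfun_apply (integral (cbox 0 1) (\<lambda>t. Blinfun (f' x t))) v
          = integral (cbox 0 1) (\<lambda>t. blinfun_apply (Blinfun (f' x t)) v)"
        by (rule blinfun_apply_integral)
      also have "\<dots> = integral (cbox 0 1) (\<lambda>t. f' x t v)"
        by (rule integral_cong) (simp add: app[OF x])
      also have "\<dots> = 1 * (w (c x 1) \<bullet> v) - 0 * (w (c x 0) \<bullet> v)"
      proof (rule integral_unique, unfold cbox_interval, rule fundamental_theorem_of_calculus)
        fix t :: real assume "t \<in> {0..1}"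
        then have t: "t \<in> cbox 0 1" by simp
        have "(c x has_derivative (\<lambda>h. h *\<^sub>R (x - a))) (at t)"
          unfolding c_def[abs_def] by (auto intro!: derivative_eq_intros)
        from has_derivative_compose[OF this dw[OF x t]]
        have "((\<lambda>t. w (c x t)) has_derivative (\<lambda>h. \<partial> w (c x t) (h *\<^sub>R (x - a)))) (at t)" .
        then have "((\<lambda>t. w (c x t)) has_derivative (\<lambda>h. h *\<^sub>R \<partial> w (c x t) (x - a))) (at t)"
          using linear_cmul[OF linear_directional_derivative[OF w cB[OF x t]]] by simp
        then have "((\<lambda>t. t * (w (c x t) \<bullet> v)) has_derivative
            (\<lambda>h. h * (t * (\<partial> w (c x t) (x - a) \<bullet> v) + w (c x t) \<bullet> v))) (at t)"
          by (auto intro!: derivative_eq_intros simp: algebra_simps)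
        then show "((\<lambda>t. t * (w (c x t) \<bullet> v)) has_vector_derivative f' x t v) (at t within {0..1})"
          by (simp add: has_vector_derivative_def f'_def sym[OF cB[OF x t], of _ v] has_derivative_at_withinI)
      qed simp
      also have "\<dots> = w x \<bullet> v" by (simp add: c_def)
      finally show ?thesis .
    qed
    ultimately show ?thesis using at_within_open[OF x open_ball] by (metis (no_types, lifting) ext)
  qed
  then show ?thesis by blast
qed

section \<open>The complex structure and the fibres of the Hopf fibration\<close>

abbreviation J :: "complex^'n \<Rightarrow> complex^'n" where "J v \<equiv> \<i> *s v"

lemma J_add: "J (v + w) = J v + J w"
  and J_scaleR: "J (r *\<^sub>R v) = r *\<^sub>R J v"
  and J_diff: "J (v - w) = J v - J w"
  and J_J: "J (J v) = - v"
  and J_csmult: "J (c *s v) = c *s J v"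
  for v w :: "complex^'n"
  by (simp_all add: vec_eq_iff complex_eq_iff algebra_simps)

lemma J_inner_J: "J v \<bullet> J w = v \<bullet> w"
  and J_inner: "J v \<bullet> w = - (v \<bullet> J w)"
  for v w :: "complex^'n"
  by (auto simp: inner_vec_def inner_complex_def simp flip: sum_negf intro!: sum.cong)

lemma inner_J_self: "v \<bullet> J v = 0" "J v \<bullet> v = 0" for v :: "complex^'n"
  using J_inner[of v v] inner_commute[of v "J v"] by simp_all

lemma linear_J: "linear (J :: complex^'n \<Rightarrow> complex^'n)"
  by (rule linearI) (simp_all add: J_add J_scaleR)

lemma bounded_linear_J: "bounded_linear (J :: complex^'n \<Rightarrow> complex^'n)"
  using linear_J by (simp add: linear_conv_bounded_linear)

text \<open>Multiplication by complex scalars is expressed by \<open>J\<close>, so that below only the real inner product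
  is used; the Hermitian product of \<open>v\<close> and \<open>w\<close> is \<open>Complex (v \<bullet> w) (v \<bullet> J w)\<close>.\<close>

lemma csmult_eq: "c *s v = Re c *\<^sub>R v + Im c *\<^sub>R J v" for v :: "complex^'n"
  by (simp add: vec_eq_iff complex_eq_iff)

lemma csmult_inner_csmult: "(c *s v) \<bullet> (c *s w) = (cmod c)\<^sup>2 * (v \<bullet> w)" for v w :: "complex^'n"
  by (simp add: csmult_eq[of c] inner_add_left inner_add_right J_inner_J J_inner cmod_power2)
    (simp add: power2_eq_square algebra_simps)

lemma csmult_add_left: "(a + b) *s v = a *s v + b *s v"
  and csmult_add_right: "c *s (v + w) = c *s v + c *s w"
  and csmult_scaleR: "c *s (r *\<^sub>R v) = r *\<^sub>R (c *s v)" "(r *\<^sub>R c) *s v = r *\<^sub>R (c *s v)"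
  and csmult_of_real: "of_real r *s v = r *\<^sub>R v"
  for v w :: "complex^'n"
  by (simp_all add: vec_eq_iff algebra_simps complex_eq_iff)

lemma norm_csmult: "norm (c *s v) = cmod c * norm v" for v :: "complex^'n"
  by (simp add: norm_eq_sqrt_inner csmult_inner_csmult real_sqrt_mult)

lemma bounded_bilinear_csmult: "bounded_bilinear (\<lambda>(c::complex) (v::complex^'n). c *s v)"
  by (rule bounded_bilinear.intro)
    (auto simp: csmult_add_left csmult_add_right csmult_scaleR norm_csmult intro!: exI[of _ 1])

lemmas smooth_on_csmult = smooth_on_bilinear[OF bounded_bilinear_csmult]
lemmas smooth_on_J = smooth_on_linear[OF bounded_linear_J]

lemma derivative_J:
  "f differentiable (at x) \<Longrightarrow> ((\<lambda>y. J (f y)) has_derivative (\<lambda>u. J (\<partial> f x u))) (at x)"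
  by (rule bounded_linear.has_derivative[OF bounded_linear_J has_derivative_directional])

lemma mem_hopf: "x \<in> hopf z \<longleftrightarrow> (\<exists>c. cmod c = 1 \<and> x = c *s z)"
  by (auto simp: hopf_def)

lemma hopf_csmult:
  assumes c: "cmod c = 1" shows "hopf (c *s z) = hopf z"
proof (intro set_eqI iffI)
  fix x assume "x \<in> hopf (c *s z)"
  then obtain b where "cmod b = 1" "x = b *s (c *s z)" unfolding mem_hopf by blast
  then have "cmod (b * c) = 1" "x = (b * c) *s z"
    using c by (simp_all add: norm_mult vector_smult_assoc)
  then show "x \<in> hopf z" unfolding mem_hopf by blast
next
  fix x assume "x \<in> hopf z"
  then obtain b where b: "cmod b = 1" "x = b *s z" unfolding mem_hopf by blast
  have "c \<noteq> 0" using c by auto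
  then have "cmod (b / c) = 1" "x = (b / c) *s (c *s z)"
    using b c by (simp_all add: norm_divide vector_smult_assoc)
  then show "x \<in> hopf (c *s z)" unfolding mem_hopf by blast
qed

lemma hopf_eqD:
  assumes "hopf a = hopf b" shows "\<exists>c. cmod c = 1 \<and> a = c *s b"
proof -
  have "a \<in> hopf a" unfolding mem_hopf by (rule exI[of _ 1]) simp
  then show ?thesis using assms mem_hopf by metis
qed

text \<open>For a unit vector \<open>z\<close>, the orthogonal projection to the Hermitian complement of \<open>z\<close>. Unlike
  \<open>horizontal_part z\<close> it also removes the multiples of \<open>z\<close>, and it is complex linear.\<close>

definition complex_complement_part :: "complex^'n \<Rightarrow> complex^'n \<Rightarrow> complex^'n" where
  "complex_complement_part z v = v - (v \<bullet> z) *\<^sub>R z - (v \<bullet> J z) *\<^sub>R J z"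

lemma complex_complement_part_linear:
  "complex_complement_part z (v + w) = complex_complement_part z v + complex_complement_part z w"
  "complex_complement_part z (r *\<^sub>R v) = r *\<^sub>R complex_complement_part z v"
  "complex_complement_part z (J v) = J (complex_complement_part z v)"
  by (simp_all add: complex_complement_part_def inner_add_left scaleR_add_left algebra_simps
      J_add J_scaleR J_diff J_J J_inner J_inner_J)

lemma complex_complement_part_id:
  "v \<bullet> z = 0 \<Longrightarrow> v \<bullet> J z = 0 \<Longrightarrow> complex_complement_part z v = v"
  by (simp add: complex_complement_part_def)

lemma complex_complement_part_line:
  assumes "norm z = 1" shows "complex_complement_part z (c *s z) = 0"
proof -
  have "z \<bullet> z = 1" using assms by (simp add: norm_eq_1)
  then show ?thesis
    by (simp add: complex_complement_part_def csmult_eq[of c] inner_add_left J_inner_J inner_J_self)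
qed

lemma complex_complement_part_csmult:
  assumes "cmod c = 1"
  shows "complex_complement_part (c *s z) (c *s v) = c *s complex_complement_part z v"
proof -
  have "(c *s v) \<bullet> J (c *s z) = v \<bullet> J z" "(c *s v) \<bullet> (c *s z) = v \<bullet> z"
    unfolding J_csmult csmult_inner_csmult using assms by simp_all
  then show ?thesis
    by (simp add: complex_complement_part_def vec_eq_iff algebra_simps)
qed

section \<open>Levi-Civita connections of pulled back inner products\<close>

text \<open>The Riesz representation for the inner product pulled back by \<open>T\<close>. The functional is given by
  any vector \<open>k\<close> of the target space, so that \<open>T a\<close> is the projection of \<open>k\<close> to the range of \<open>T\<close>.\<close>

lemma inner_representation:
  fixes T :: "'a::euclidean_space \<Rightarrow> 'b::euclidean_space"
  assumes T: "linear T" "inj T"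
  shows "\<exists>a. \<forall>x. T a \<bullet> T x = k \<bullet> T x"
proof -
  have lin: "linear (\<lambda>a. adjoint T (T a))"
    using linear_compose[OF T(1) adjoint_linear[OF T(1)]] by (simp add: o_def)
  have "a = 0" if "adjoint T (T a) = 0" for a
  proof -
    have "T a \<bullet> T a = 0" using adjoint_works[OF T(1), of a "T a"] that by simp
    then show ?thesis using linear_injective_0[OF T(1)] T(2) by simp
  qed
  then have "inj (\<lambda>a. adjoint T (T a))" using linear_injective_0[OF lin] by blast
  then have "surj (\<lambda>a. adjoint T (T a))" using linear_injective_imp_surjective[OF lin] by simp
  then obtain a where a: "adjoint T (T a) = adjoint T k" by (metis surjE)
  have "T a \<bullet> T x = k \<bullet> T x" for x
    using a adjoint_works[OF T(1), of x "T a"] adjoint_works[OF T(1), of x k]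
    by (simp add: inner_commute)
  then show ?thesis by blast
qed

text \<open>If the metric at \<open>p\<close> is induced by an injective linear map into a Euclidean space, then the
  Christoffel symbol is the projection of any \<open>k\<close> that satisfies the Koszul formula. This is used
  both for projective space and for the metrics induced on submanifolds.\<close>

lemma christoffel_inner:
  fixes T :: "'a::euclidean_space \<Rightarrow> 'b::euclidean_space"
  assumes T: "linear T" "inj T" and g: "\<And>a b. g p a b = T a \<bullet> T b"
    and k: "\<And>x. 2 * (k \<bullet> T x) = \<partial> (\<lambda>q. g q v x) p u + \<partial> (\<lambda>q. g q u x) p v - \<partial> (\<lambda>q. g q u v) p x"
  shows "T (christoffel g p u v) \<bullet> T x = k \<bullet> T x"
proof -
  obtain a where a: "\<And>x. T a \<bullet> T x = k \<bullet> T x" using inner_representation[OF T] by blast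
  have "christoffel g p u v = a"
    unfolding christoffel_def
  proof (rule the_equality)
    show "\<forall>z. 2 * g p a z = \<partial> (\<lambda>q. g q v z) p u + \<partial> (\<lambda>q. g q u z) p v - \<partial> (\<lambda>q. g q u v) p z"
      by (simp add: g a k[symmetric])
  next
    fix w
    assume w: "\<forall>z. 2 * g p w z = \<partial> (\<lambda>q. g q v z) p u + \<partial> (\<lambda>q. g q u z) p v - \<partial> (\<lambda>q. g q u v) p z"
    have "T w \<bullet> T z = T a \<bullet> T z" for z using w by (simp add: g a k[symmetric])
    then have "(T w - T a) \<bullet> T (w - a) = 0" by (simp add: inner_diff_left)
    then have "T (w - a) = 0" by (simp add: linear_diff[OF T(1)])
    then have "w - a = 0" using linear_injective_0[OF T(1)] T(2) by blast
    then show "w = a" by simp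
  qed
  then show ?thesis using a by simp
qed

section \<open>Affine charts of projective space\<close>

text \<open>The horizontal lift of a tangent vector \<open>u\<close> of projective space at the point with affine
  coordinates \<open>w\<close>, to the point \<open>affine_lift e P w\<close> of the sphere.\<close>

definition horizontal_derivative :: "complex^'n \<Rightarrow> complex^'k^'n \<Rightarrow> complex^'k \<Rightarrow> complex^'k \<Rightarrow> complex^'n" where
  "horizontal_derivative e P w u = horizontal_part (affine_lift e P w) (\<partial> (affine_lift e P) w u)"

text \<open>The affine lift is not horizontal. Its vertical part is this pullback of the connection form of
  the Hopf fibration.\<close>

definition connection_form :: "complex^'n \<Rightarrow> complex^'k^'n \<Rightarrow> complex^'k \<Rightarrow> complex^'k \<Rightarrow> real" where
  "connection_form e P w u = \<partial> (affine_lift e P) w u \<bullet> J (affine_lift e P w)"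

lemma matrix_vector_csmult: "P *v (c *s w) = c *s (P *v w)" for P :: "complex^'k^'n"
  by (simp add: vec_eq_iff matrix_vector_mult_def sum_distrib_left algebra_simps)

lemma matrix_vector_scaleR: "P *v (r *\<^sub>R w) = r *\<^sub>R (P *v w)" for P :: "complex^'k^'n"
  using matrix_vector_csmult[of P "of_real r" w] by (simp add: csmult_of_real)

lemma bounded_linear_matrix_vector: "bounded_linear (\<lambda>w. P *v w)" for P :: "complex^'k^'n"
  unfolding linear_conv_bounded_linear[symmetric]
  by (rule linearI) (simp_all add: matrix_vector_right_distrib matrix_vector_scaleR)

lemma affine_frame_zeroD:
  assumes "affine_frame e P" "c *s e + P *v w = 0" shows "c = 0" "w = 0"
proof -
  have "inj (\<lambda>(c, w). c *s e + P *v w)" using assms(1) by (simp add: affine_frame_def bij_is_inj)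
  then have "(c, w) = (0, 0)"
    by (rule injD) (simp add: assms(2) matrix_vector_mult_0_right)
  then show "c = 0" "w = 0" by auto
qed

context
  fixes e :: "complex^'n" and P :: "complex^'k^'n"
  assumes frame: "affine_frame e P"
begin

lemma affine_vector_nonzero: "e + P *v w \<noteq> 0"
  using affine_frame_zeroD[OF frame, of 1 w] by (auto simp: vec_eq_iff)

lemma smooth_on_affine_vector: "smooth_on UNIV (\<lambda>w. e + P *v w)"
  by (intro smooth_on_add smooth_on_const smooth_on_linear[OF bounded_linear_matrix_vector] smooth_on_ident) auto

lemma smooth_on_affine_lift: "smooth_on UNIV (affine_lift e P)"
  unfolding affine_lift_def[abs_def]
  by (intro smooth_on_sgn smooth_on_affine_vector affine_vector_nonzero open_UNIV)

lemma norm_affine_lift: "norm (affine_lift e P w) = 1"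
  by (simp add: affine_lift_def norm_sgn affine_vector_nonzero)

lemma affine_lift_derivative: "(affine_lift e P has_derivative \<partial> (affine_lift e P) w) (at w)"
  by (rule smooth_on_has_derivative[OF smooth_on_affine_lift]) simp

lemma affine_lift_derivative_orthogonal: "\<partial> (affine_lift e P) w u \<bullet> affine_lift e P w = 0"
proof -
  let ?z = "affine_lift e P"
  have "((\<lambda>w. ?z w \<bullet> ?z w) has_derivative (\<lambda>u. ?z w \<bullet> \<partial> ?z w u + \<partial> ?z w u \<bullet> ?z w)) (at w)"
    by (rule has_derivative_inner[OF affine_lift_derivative affine_lift_derivative])
  moreover have "(\<lambda>w. ?z w \<bullet> ?z w) = (\<lambda>w. 1)" using norm_affine_lift by (simp add: norm_eq_1)
  ultimately have "((\<lambda>w. 1) has_derivative (\<lambda>u. ?z w \<bullet> \<partial> ?z w u + \<partial> ?z w u \<bullet> ?z w)) (at w)" by simp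
  from has_derivative_unique[OF this has_derivative_const]
  have "?z w \<bullet> \<partial> ?z w u + \<partial> ?z w u \<bullet> ?z w = 0" by (rule fun_cong)
  then show ?thesis unfolding inner_commute[of "?z w"] by simp
qed

text \<open>The normalization of \<open>e + P *v w\<close> contributes a real multiple of that vector only, which the
  projection removes. The remaining formula shows that the horizontal lift is complex linear
  and injective.\<close>

lemma horizontal_derivative_eq:
  "horizontal_derivative e P w u =
    inverse (norm (e + P *v w)) *\<^sub>R complex_complement_part (affine_lift e P w) (P *v u)"
proof -
  let ?z = "affine_lift e P" and ?N = "\<lambda>w. e + P *v w" and ?r = "\<lambda>w. inverse (norm (e + P *v w))"
  have r: "smooth_on UNIV ?r"
    by (intro smooth_on_inverse smooth_on_norm smooth_on_affine_vector) (simp_all add: affine_vector_nonzero)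
  have z: "?z = (\<lambda>w. ?r w *\<^sub>R ?N w)" by (simp add: affine_lift_def sgn_div_norm fun_eq_iff)
  have "(?N has_derivative (\<lambda>u. P *v u)) (at w)"
    by (rule has_derivative_add[OF has_derivative_const[of e] bounded_linear.has_derivative[OF bounded_linear_matrix_vector has_derivative_ident],
       simplified])
  then have "((\<lambda>w. ?r w *\<^sub>R ?N w) has_derivative (\<lambda>u. ?r w *\<^sub>R (P *v u) + \<partial> ?r w u *\<^sub>R ?N w)) (at w)"
    using smooth_on_has_derivative[OF r, of w] by (auto intro!: has_derivative_scaleR)
  then have dz: "\<partial> ?z w u = ?r w *\<^sub>R (P *v u) + \<partial> ?r w u *\<^sub>R ?N w"
    unfolding z by (simp add: directional_derivative_eq)
  have N: "\<partial> ?r w u *\<^sub>R ?N w = of_real (\<partial> ?r w u * norm (?N w)) *s ?z w"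
    unfolding csmult_of_real using affine_vector_nonzero by (simp add: affine_lift_def sgn_div_norm)
  have "horizontal_derivative e P w u = complex_complement_part (?z w) (\<partial> ?z w u)"
    by (simp add: horizontal_derivative_def horizontal_part_def complex_complement_part_def
        affine_lift_derivative_orthogonal)
  also have "\<dots> = ?r w *\<^sub>R complex_complement_part (?z w) (P *v u)"
    unfolding dz N complex_complement_part_linear complex_complement_part_line[OF norm_affine_lift] by simp
  finally show ?thesis .
qed

lemma linear_horizontal_derivative: "linear (horizontal_derivative e P w)"
  by (rule linearI)
    (simp_all add: horizontal_derivative_eq matrix_vector_right_distrib matrix_vector_scaleR
      complex_complement_part_linear scaleR_add_right)

lemma horizontal_derivative_J: "horizontal_derivative e P w (J u) = J (horizontal_derivative e P w u)"
  by (simp add: horizontal_derivative_eq matrix_vector_csmult complex_complement_part_linear J_scaleR)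

lemma horizontal_derivative_zeroD:
  assumes "horizontal_derivative e P w u = 0" shows "u = 0"
proof -
  let ?z = "affine_lift e P w" and ?r = "inverse (norm (e + P *v w))"
  have "complex_complement_part ?z (P *v u) = 0"
    using assms affine_vector_nonzero by (simp add: horizontal_derivative_eq)
  then have "P *v u = Complex ((P *v u) \<bullet> ?z) ((P *v u) \<bullet> J ?z) *s ?z"
    by (simp add: complex_complement_part_def csmult_eq[of "Complex _ _"] algebra_simps)
  moreover have "b *s ?z = (?r *\<^sub>R b) *s (e + P *v w)" for b
    by (simp only: affine_lift_def sgn_div_norm csmult_scaleR)
  ultimately obtain c where "P *v u = c *s (e + P *v w)" by metis
  then have "(- c) *s e + P *v (u - c *s w) = 0"
    by (simp add: matrix_vector_mult_diff_distrib matrix_vector_csmult csmult_add_right vec_eq_iff)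
  from affine_frame_zeroD[OF frame this] show "u = 0" by simp
qed

lemma inj_horizontal_derivative: "inj (horizontal_derivative e P w)"
  using linear_injective_0[OF linear_horizontal_derivative] horizontal_derivative_zeroD by blast

lemma horizontal_derivative_orthogonal:
  "horizontal_derivative e P w u \<bullet> affine_lift e P w = 0"
  "horizontal_derivative e P w u \<bullet> J (affine_lift e P w) = 0"
  using norm_affine_lift[of w]
  by (simp_all add: horizontal_derivative_def horizontal_part_def inner_diff_left
      affine_lift_derivative_orthogonal J_inner_J inner_J_self norm_eq_1)

lemma affine_lift_derivative_split:
  "\<partial> (affine_lift e P) w u
    = horizontal_derivative e P w u + connection_form e P w u *\<^sub>R J (affine_lift e P w)"
  by (simp add: horizontal_derivative_def horizontal_part_def connection_form_def)

lemma smooth_on_horizontal_derivative: "smooth_on UNIV (\<lambda>w. horizontal_derivative e P w v)"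
  unfolding horizontal_derivative_def horizontal_part_def
  by (intro smooth_on_diff smooth_on_scaleR smooth_on_inner smooth_on_J smooth_on_directional_derivative
    smooth_on_affine_lift open_UNIV)

text \<open>The asymmetry of the derivatives of horizontal lifts comes from the connection form only: the
  other terms are second derivatives of the affine lift.\<close>

lemma horizontal_derivative_derivative:
  "\<partial> (\<lambda>w. horizontal_derivative e P w v) w u \<bullet> horizontal_derivative e P w x
    = \<partial> (\<lambda>w. \<partial> (affine_lift e P) w v) w u \<bullet> horizontal_derivative e P w x
      - connection_form e P w v * (J (horizontal_derivative e P w u) \<bullet> horizontal_derivative e P w x)"
proof -
  let ?z = "affine_lift e P" and ?l = "horizontal_derivative e P"
  have a: "((\<lambda>w. connection_form e P w v) has_derivative \<partial> (\<lambda>w. connection_form e P w v) w) (at w)"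
    unfolding connection_form_def
    by (rule smooth_on_has_derivative[of UNIV])
      (intro smooth_on_inner smooth_on_J smooth_on_directional_derivative smooth_on_affine_lift open_UNIV, simp)
  have z2: "((\<lambda>w. \<partial> ?z w v) has_derivative \<partial> (\<lambda>w. \<partial> ?z w v) w) (at w)"
    by (rule smooth_on_has_derivative[OF smooth_on_directional_derivative[OF smooth_on_affine_lift]]) simp
  have "((\<lambda>w. \<partial> ?z w v - connection_form e P w v *\<^sub>R J (?z w)) has_derivative
     (\<lambda>u. \<partial> (\<lambda>w. \<partial> ?z w v) w u
       - (connection_form e P w v *\<^sub>R J (\<partial> ?z w u) + \<partial> (\<lambda>w. connection_form e P w v) w u *\<^sub>R J (?z w)))) (at w)"
    by (intro has_derivative_diff has_derivative_scaleR a z2 derivative_J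
      differentiableI[OF affine_lift_derivative])
  moreover have "(\<lambda>w. ?l w v) = (\<lambda>w. \<partial> ?z w v - connection_form e P w v *\<^sub>R J (?z w))"
    by (simp add: affine_lift_derivative_split)
  ultimately have "\<partial> (\<lambda>w. ?l w v) w u = \<partial> (\<lambda>w. \<partial> ?z w v) w u
       - (connection_form e P w v *\<^sub>R J (\<partial> ?z w u) + \<partial> (\<lambda>w. connection_form e P w v) w u *\<^sub>R J (?z w))"
    by (simp add: directional_derivative_eq)
  then show ?thesis
    using horizontal_derivative_orthogonal[of w x]
    by (simp add: affine_lift_derivative_split[of w u] J_add J_scaleR J_J inner_diff_left inner_add_left
        inner_commute[of _ "?l w x"] inner_add_right inner_diff_right)
qed

lemma projective_metric_eq:
  "projective_metric e P w u v = horizontal_derivative e P w u \<bullet> horizontal_derivative e P w v"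
  by (simp add: projective_metric_def horizontal_derivative_def Let_def)

text \<open>The Levi-Civita connection of projective space is the horizontal part of the derivative in the
  flat space, with the correction for the rotation of the affine lift in the fibres. The
  correction makes the right hand side symmetric in \<open>u\<close> and \<open>v\<close>, and it does not affect the
  derivative of the metric because \<open>J\<close> is skew; these two properties give the Koszul formula.\<close>

lemma horizontal_christoffel:
  "horizontal_derivative e P w (christoffel (projective_metric e P) w u v) \<bullet> horizontal_derivative e P w x
   = (\<partial> (\<lambda>w. horizontal_derivative e P w v) w u - connection_form e P w u *\<^sub>R J (horizontal_derivative e P w v))
      \<bullet> horizontal_derivative e P w x"
proof (rule christoffel_inner[OF linear_horizontal_derivative inj_horizontal_derivative projective_metric_eq])
  fix x
  let ?z = "affine_lift e P" and ?l = "horizontal_derivative e P"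
  have d: "\<partial> (\<lambda>w. projective_metric e P w a b) w c
     = \<partial> (\<lambda>w. ?l w a) w c \<bullet> ?l w b + \<partial> (\<lambda>w. ?l w b) w c \<bullet> ?l w a" for a b c
  proof -
    have "((\<lambda>w. ?l w a) has_derivative \<partial> (\<lambda>w. ?l w a) w) (at w)" for a
      by (rule smooth_on_has_derivative[OF smooth_on_horizontal_derivative]) simp
    from has_derivative_inner[OF this[of a] this[of b]]
    show ?thesis by (simp add: projective_metric_eq directional_derivative_eq inner_commute)
  qed
  have sym: "\<partial> (\<lambda>w. \<partial> ?z w a) w b = \<partial> (\<lambda>w. \<partial> ?z w b) w a" for a b
    by (rule second_derivative_symmetric[OF open_UNIV _ smooth_on_affine_lift]) simp
  have anti: "J (?l w a) \<bullet> ?l w b = - (J (?l w b) \<bullet> ?l w a)" for a b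
    using J_inner[of "?l w a" "?l w b"] by (simp add: inner_commute)
  show "2 * ((\<partial> (\<lambda>w. ?l w v) w u - connection_form e P w u *\<^sub>R J (?l w v)) \<bullet> ?l w x)
     = \<partial> (\<lambda>w. projective_metric e P w v x) w u + \<partial> (\<lambda>w. projective_metric e P w u x) w v
       - \<partial> (\<lambda>w. projective_metric e P w u v) w x"
    unfolding d inner_diff_left horizontal_derivative_derivative
    using sym[of u v] sym[of u x] sym[of v x] anti[of u v] anti[of u x] anti[of v x]
    by (simp add: algebra_simps)
qed

end

section \<open>Legendrian immersions into the sphere\<close>

text \<open>Products of scalars are kept apart, so that \<open>J\<close> remains visible in \<open>J (c *s v)\<close>.\<close>

declare vector_smult_assoc [simp del] vec.scale_scale [simp del]

lemma derivative_J_eq: "f differentiable (at x) \<Longrightarrow> \<partial> (\<lambda>y. J (f y)) x u = J (\<partial> f x u)"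
  using directional_derivative_eq[OF derivative_J] by metis

text \<open>Horizontal immersions into the unit sphere. A horizontal lift of a submanifold of projective
  space is of this kind in each parametrization.\<close>

definition legendrian_on :: "'a::euclidean_space set \<Rightarrow> ('a \<Rightarrow> complex^'n) \<Rightarrow> bool" where
  "legendrian_on D G \<longleftrightarrow> open D \<and> smooth_on D G \<and>
     (\<forall>q\<in>D. norm (G q) = 1 \<and> inj (\<partial> G q) \<and> (\<forall>u. J (G q) \<bullet> \<partial> G q u = 0))"

lemma legendrian_on_subset: "legendrian_on D G \<Longrightarrow> open E \<Longrightarrow> E \<subseteq> D \<Longrightarrow> legendrian_on E G"
  unfolding legendrian_on_def using smooth_on_subset by blast

context
  fixes D :: "'a::euclidean_space set" and G :: "'a \<Rightarrow> complex^'n"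
  assumes leg: "legendrian_on D G"
begin

lemma legendrian_open: "open D" and legendrian_smooth: "smooth_on D G"
  using leg by (simp_all add: legendrian_on_def)

lemma legendrian_norm: "q \<in> D \<Longrightarrow> norm (G q) = 1"
  and legendrian_inj: "q \<in> D \<Longrightarrow> inj (\<partial> G q)"
  and legendrian_orthogonal_J: "q \<in> D \<Longrightarrow> J (G q) \<bullet> \<partial> G q u = 0"
  using leg by (simp_all add: legendrian_on_def)

lemma legendrian_linear: "q \<in> D \<Longrightarrow> linear (\<partial> G q)"
  using linear_directional_derivative[OF legendrian_smooth] .

lemma legendrian_derivative_smooth: "smooth_on D (\<lambda>p. \<partial> G p v)"
  by (rule smooth_on_directional_derivative[OF legendrian_smooth])

lemma legendrian_orthogonal: assumes "q \<in> D" shows "G q \<bullet> \<partial> G q u = 0"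
proof -
  have "\<partial> (\<lambda>p. G p \<bullet> G p) q u = 0"
    by (rule derivative_locally_constant[OF legendrian_open assms, of _ 1])
      (simp add: norm_eq_1[symmetric] legendrian_norm)
  then show ?thesis
    using derivative_inner[of G q G u] smooth_on_differentiable[OF legendrian_smooth assms]
    by (simp add: inner_commute)
qed

lemma legendrian_second_symmetric:
  "q \<in> D \<Longrightarrow> \<partial> (\<lambda>p. \<partial> G p u) q v = \<partial> (\<lambda>p. \<partial> G p v) q u"
  by (rule second_derivative_symmetric[OF legendrian_open _ legendrian_smooth])

text \<open>Differentiate the horizontality condition: the term with the second derivative is symmetric in
  \<open>u\<close> and \<open>v\<close>, the other one is antisymmetric, so both vanish.\<close>

lemma legendrian_lagrangian: assumes "q \<in> D" shows "\<partial> G q u \<bullet> J (\<partial> G q v) = 0"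
proof -
  have G: "G differentiable (at q)" using smooth_on_differentiable[OF legendrian_smooth assms] .
  then have JG: "(\<lambda>p. J (G p)) differentiable (at q)" using differentiableI[OF derivative_J] by blast
  have S: "J (G q) \<bullet> \<partial> (\<lambda>p. \<partial> G p v) q u + J (\<partial> G q u) \<bullet> \<partial> G q v = 0" for u v
  proof -
    have "\<partial> (\<lambda>p. J (G p) \<bullet> \<partial> G p v) q u = 0"
      by (rule derivative_locally_constant[OF legendrian_open assms legendrian_orthogonal_J])
    then show ?thesis
      using derivative_inner[OF JG smooth_on_differentiable[OF legendrian_derivative_smooth assms, of v], of u]
      by (simp add: derivative_J_eq[OF G])
  qed
  show ?thesis
    using S[of u v] S[of v u] legendrian_second_symmetric[OF assms, of u v]
      J_inner[of "\<partial> G q u" "\<partial> G q v"] J_inner[of "\<partial> G q v" "\<partial> G q u"]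
    by (simp add: inner_commute)
qed

text \<open>The inverse of the linear isomorphism that belongs to the affine frame takes \<open>G q\<close> to the pair of
  \<open>k q\<close> and \<open>k q *s h q\<close>. Both are smooth, and \<open>k q\<close> does not vanish.\<close>

lemma legendrian_lift_affine_coordinates:
  fixes e :: "complex^'n" and P :: "complex^'k^'n"
  assumes frame: "affine_frame e P" and eq: "\<And>q. q \<in> D \<Longrightarrow> hopf (G q) = hopf (affine_lift e P (h q))"
  obtains c where "smooth_on D h" "smooth_on D c"
    "\<And>q. q \<in> D \<Longrightarrow> cmod (c q) = 1 \<and> G q = c q *s affine_lift e P (h q)"
proof -
  define B where "B = (\<lambda>(c, w). c *s e + P *v w)"
  have linB: "linear B"
    by (rule linearI) (auto simp: B_def csmult_add_left csmult_scaleR matrix_vector_right_distrib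
      matrix_vector_scaleR scaleR_add_right)
  have "inj B" using frame by (simp add: affine_frame_def B_def bij_is_inj)
  from linear_injective_left_inverse[OF linB this] obtain R where R: "linear R" "R \<circ> B = id" by blast
  have RB: "R (c *s e + P *v w) = (c, w)" for c w using fun_cong[OF R(2), of "(c, w)"] by (simp add: B_def)
  let ?n = "\<lambda>q. norm (e + P *v h q)"
  have "\<exists>c. cmod c = 1 \<and> G q = c *s affine_lift e P (h q)" if "q \<in> D" for q
    by (rule hopf_eqD[OF eq[OF that]])
  then obtain c where c: "\<And>q. q \<in> D \<Longrightarrow> cmod (c q) = 1" "\<And>q. q \<in> D \<Longrightarrow> G q = c q *s affine_lift e P (h q)"
    by metis
  \<comment> \<open>the coefficient of \<open>e\<close> in \<open>G q\<close>\<close>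
  define k where "k q = inverse (?n q) *\<^sub>R c q" for q
  have n: "?n q \<noteq> 0" for q using affine_vector_nonzero[OF frame] by simp
  have k0: "k q \<noteq> 0" if "q \<in> D" for q using c(1)[OF that] n[of q] by (auto simp: k_def)
  have RG: "R (G q) = (k q, k q *s h q)" if "q \<in> D" for q
  proof -
    have "G q = k q *s (e + P *v h q)"
      by (simp only: c(2)[OF that] affine_lift_def sgn_div_norm csmult_scaleR k_def)
    also have "\<dots> = k q *s e + P *v (k q *s h q)"
      by (simp only: csmult_add_right matrix_vector_csmult)
    finally show ?thesis by (simp add: RB)
  qed
  have blR: "bounded_linear (\<lambda>x. fst (R x))" "bounded_linear (\<lambda>x. snd (R x))"
    using R(1) bounded_linear_compose[OF bounded_linear_fst] bounded_linear_compose[OF bounded_linear_snd]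
    by (auto simp: linear_conv_bounded_linear)
  have "smooth_on D (\<lambda>q. fst (R (G q)))" "smooth_on D (\<lambda>q. snd (R (G q)))"
    by (rule smooth_on_linear[OF blR(1) legendrian_open legendrian_smooth],
        rule smooth_on_linear[OF blR(2) legendrian_open legendrian_smooth])
  then have sk: "smooth_on D k" and skh: "smooth_on D (\<lambda>q. k q *s h q)"
    by (auto intro: smooth_on_cong[OF _ legendrian_open] simp: RG)
  have "smooth_on D (\<lambda>q. inverse (k q) *s (k q *s h q))"
    by (intro smooth_on_csmult smooth_on_inverse legendrian_open sk skh k0)
  then have sh: "smooth_on D h"
    by (rule smooth_on_cong[OF _ legendrian_open]) (simp add: vector_smult_assoc k0)
  have "smooth_on D (\<lambda>q. ?n q *\<^sub>R k q)"
    by (intro smooth_on_scaleR smooth_on_norm legendrian_open sk affine_vector_nonzero[OF frame]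
      smooth_on_add smooth_on_const smooth_on_linear[OF bounded_linear_matrix_vector] sh)
  then have "smooth_on D c" by (rule smooth_on_cong[OF _ legendrian_open]) (use n in \<open>simp add: k_def\<close>)
  with sh c show thesis using that by blast
qed

end

section \<open>The second fundamental form of a lift\<close>

text \<open>A Legendrian map together with the affine coordinates \<open>h\<close> of its projection. The unimodular
  function \<open>c\<close> measures the rotation from the affine lift to the horizontal lift.\<close>

locale legendrian_chart =
  fixes D :: "(real^'k) set" and G :: "real^'k \<Rightarrow> complex^'n"
    and e :: "complex^'n" and P :: "complex^'k^'n" and h :: "real^'k \<Rightarrow> complex^'k" and c :: "real^'k \<Rightarrow> complex"
  assumes leg: "legendrian_on D G" and frame: "affine_frame e P"
    and h: "smooth_on D h" and c: "smooth_on D c"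
    and lift: "\<And>q. q \<in> D \<Longrightarrow> cmod (c q) = 1 \<and> G q = c q *s affine_lift e P (h q)"
begin

abbreviation "\<eta> \<equiv> horizontal_derivative e P"
abbreviation "\<zeta> \<equiv> affine_lift e P"

lemma linear_dh: "q \<in> D \<Longrightarrow> linear (\<partial> h q)" by (rule linear_directional_derivative[OF h])

lemma h_diff: "q \<in> D \<Longrightarrow> h differentiable (at q)" and c_diff: "q \<in> D \<Longrightarrow> c differentiable (at q)"
  by (rule smooth_on_differentiable[OF h], assumption) (rule smooth_on_differentiable[OF c], assumption)

lemma derivative_split:
  assumes "q \<in> D"
  shows "\<partial> G q u = \<partial> c q u *s \<zeta> (h q) + c q *s \<partial> \<zeta> (h q) (\<partial> h q u)"
proof -
  have "((\<lambda>p. \<zeta> (h p)) has_derivative (\<lambda>u. \<partial> \<zeta> (h q) (\<partial> h q u))) (at q)"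
    by (rule has_derivative_compose[OF has_derivative_directional[OF h_diff[OF assms]] affine_lift_derivative[OF frame]])
  from bounded_bilinear.FDERIV[OF bounded_bilinear_csmult has_derivative_directional[OF c_diff[OF assms]] this]
  have "((\<lambda>p. c p *s \<zeta> (h p)) has_derivative (\<lambda>u. c q *s \<partial> \<zeta> (h q) (\<partial> h q u) + \<partial> c q u *s \<zeta> (h q))) (at q)" .
  from directional_derivative_eq[OF this]
    directional_derivative_cong[OF legendrian_open[OF leg] assms, of G "\<lambda>p. c p *s \<zeta> (h p)"] lift
  show ?thesis by simp
qed

lemma derivative_horizontal:
  assumes "q \<in> D" shows "\<partial> G q u = c q *s \<eta> (h q) (\<partial> h q u)"
proof -
  note n = lift[OF assms] and zn = norm_affine_lift[OF frame, of "h q"]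
  have Gn: "norm (G q) = 1" using legendrian_norm[OF leg assms] .
  have c0: "c q \<noteq> 0" using n by auto
  have cc: "\<partial> c q u *s \<zeta> (h q) = (\<partial> c q u * inverse (c q)) *s G q"
    using n c0 by (simp add: vector_smult_assoc)
  have "\<partial> G q u = complex_complement_part (G q) (\<partial> G q u)"
    using legendrian_orthogonal[OF leg assms, of u] legendrian_orthogonal_J[OF leg assms, of u]
    by (simp add: complex_complement_part_id inner_commute)
  also have "\<dots> = complex_complement_part (G q) (c q *s \<partial> \<zeta> (h q) (\<partial> h q u))"
    unfolding derivative_split[OF assms] cc complex_complement_part_linear complex_complement_part_line[OF Gn] by simp
  also have "\<dots> = c q *s complex_complement_part (\<zeta> (h q)) (\<partial> \<zeta> (h q) (\<partial> h q u))"
    using n by (simp add: complex_complement_part_csmult)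
  also have "complex_complement_part (\<zeta> (h q)) (\<partial> \<zeta> (h q) (\<partial> h q u)) = \<eta> (h q) (\<partial> h q u)"
    by (simp add: horizontal_derivative_def horizontal_part_def complex_complement_part_def
        affine_lift_derivative_orthogonal[OF frame])
  finally show ?thesis .
qed

text \<open>The affine lift turns in the fibres at the rate given by the connection form, and \<open>c\<close> must turn it
  back at the same rate for the product to be horizontal.\<close>

lemma phase_derivative:
  assumes "q \<in> D" shows "\<partial> c q u = - (of_real (connection_form e P (h q) (\<partial> h q u)) * (\<i> * c q))"
proof -
  let ?a = "of_real (connection_form e P (h q) (\<partial> h q u))"
  have "\<partial> c q u *s \<zeta> (h q) + c q *s \<partial> \<zeta> (h q) (\<partial> h q u) = c q *s \<eta> (h q) (\<partial> h q u)"
    using derivative_split[OF assms, of u] derivative_horizontal[OF assms, of u] by simp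
  then have "\<partial> c q u *s \<zeta> (h q) + c q *s (connection_form e P (h q) (\<partial> h q u) *\<^sub>R J (\<zeta> (h q))) = 0"
    unfolding affine_lift_derivative_split[OF frame] csmult_add_right by (simp add: algebra_simps)
  then have "(\<partial> c q u + ?a * (\<i> * c q)) *s \<zeta> (h q) = 0"
    by (simp add: csmult_add_left csmult_of_real[symmetric] vector_smult_assoc mult_ac)
  moreover have "\<zeta> (h q) \<noteq> 0" using norm_affine_lift[OF frame, of "h q"] by auto
  ultimately have "\<partial> c q u + ?a * (\<i> * c q) = 0" by (metis vector_mul_eq_0)
  then show ?thesis by (simp add: eq_neg_iff_add_eq_0)
qed

lemma lift_inner: "q \<in> D \<Longrightarrow> (c q *s v) \<bullet> (c q *s w) = v \<bullet> w"
  using lift by (simp add: csmult_inner_csmult)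

lemma induced_metric_eq: "q \<in> D \<Longrightarrow> induced_metric e P h q u v = \<partial> G q u \<bullet> \<partial> G q v"
  by (simp add: induced_metric_def projective_metric_eq[OF frame] derivative_horizontal lift_inner)

lemma inj_dh: assumes "q \<in> D" shows "inj (\<partial> h q)"
proof -
  have "u = 0" if "\<partial> h q u = 0" for u
  proof -
    have "\<partial> G q u = 0"
      using that derivative_horizontal[OF assms, of u] linear_0[OF linear_horizontal_derivative[OF frame]] by simp
    then show ?thesis using legendrian_inj[OF leg assms] linear_injective_0[OF legendrian_linear[OF leg assms]] by blast
  qed
  then show ?thesis using linear_injective_0[OF linear_dh[OF assms]] by blast
qed

lemma lagrangian: "lagrangian_on e P D h"
  unfolding lagrangian_on_def
proof (intro ballI allI)
  fix q u v assume q: "q \<in> D"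
  have "kaehler_form e P (h q) (\<partial> h q u) (\<partial> h q v) = (c q *s \<eta> (h q) (\<partial> h q u)) \<bullet> (c q *s J (\<eta> (h q) (\<partial> h q v)))"
    by (simp add: kaehler_form_def projective_metric_eq[OF frame] horizontal_derivative_J[OF frame] lift_inner[OF q])
  also have "\<dots> = \<partial> G q u \<bullet> J (\<partial> G q v)" by (simp add: derivative_horizontal[OF q] J_csmult)
  finally show "kaehler_form e P (h q) (\<partial> h q u) (\<partial> h q v) = 0"
    using legendrian_lagrangian[OF leg q] by simp
qed

text \<open>After lifting by \<open>c\<close> times the horizontal lift, the covariant derivative of projective space is the
  horizontal part of the derivative in the flat space: the derivative of \<open>c\<close> supplies exactly the
  correction term of the connection form.\<close>

lemma lift_ambient_cov_deriv:
  assumes q: "q \<in> D" and V: "V differentiable (at q)"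
  shows "\<eta> (h q) (cov_deriv (projective_metric e P) h X V q) \<bullet> \<eta> (h q) x
     = \<partial> (\<lambda>p. c p *s \<eta> (h p) (V p)) q (X q) \<bullet> (c q *s \<eta> (h q) x)"
proof -
  let ?u = "\<partial> h q (X q)" and ?F = "\<lambda>p. \<eta> (h p) (V p)"
  have hdd: "(\<lambda>w. \<eta> w v) differentiable (at w)" for v w
    using smooth_on_differentiable[OF smooth_on_horizontal_derivative[OF frame]] by simp
  have d1: "\<partial> (\<lambda>p. \<eta> (h p) v) q u = \<partial> (\<lambda>w. \<eta> w v) (h q) (\<partial> h q u)" for v u
    by (rule derivative_chain[OF hdd h_diff[OF q]])
  have d2: "(\<lambda>p. \<eta> (h p) v) differentiable (at q)" for v
    by (rule differentiableI[OF has_derivative_compose[OF has_derivative_directional[OF h_diff[OF q]] has_derivative_directional[OF hdd]]])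
  have F: "(?F has_derivative (\<lambda>u. \<partial> (\<lambda>w. \<eta> w (V q)) (h q) (\<partial> h q u) + \<eta> (h q) (\<partial> V q u))) (at q)"
    using has_derivative_linear_family[OF open_UNIV _ linear_horizontal_derivative[OF frame] d2 V] by (simp add: d1)
  have "((\<lambda>p. c p *s ?F p) has_derivative (\<lambda>u. c q *s (\<partial> (\<lambda>w. \<eta> w (V q)) (h q) (\<partial> h q u) + \<eta> (h q) (\<partial> V q u))
       + \<partial> c q u *s ?F q)) (at q)"
    by (rule bounded_bilinear.FDERIV[OF bounded_bilinear_csmult has_derivative_directional[OF c_diff[OF q]] F])
  then have "\<partial> (\<lambda>p. c p *s ?F p) q (X q) = c q *s (\<partial> (\<lambda>w. \<eta> w (V q)) (h q) ?u + \<eta> (h q) (\<partial> V q (X q)))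
       + \<partial> c q (X q) *s ?F q" by (simp add: directional_derivative_eq)
  also have "\<partial> c q (X q) *s ?F q = c q *s (- (connection_form e P (h q) ?u *\<^sub>R J (?F q)))"
    by (simp add: phase_derivative[OF q] csmult_of_real[symmetric] vector_smult_assoc mult_ac vec_eq_iff)
  finally have eq: "\<partial> (\<lambda>p. c p *s ?F p) q (X q) = c q *s ((\<partial> (\<lambda>w. \<eta> w (V q)) (h q) ?u
      - connection_form e P (h q) ?u *\<^sub>R J (\<eta> (h q) (V q))) + \<eta> (h q) (\<partial> V q (X q)))"
    unfolding csmult_add_right[symmetric] by (simp add: add.commute add_diff_eq)
  have "\<partial> (\<lambda>p. c p *s ?F p) q (X q) \<bullet> (c q *s \<eta> (h q) x) =
      \<eta> (h q) (christoffel (projective_metric e P) (h q) ?u (V q)) \<bullet> \<eta> (h q) x + \<eta> (h q) (\<partial> V q (X q)) \<bullet> \<eta> (h q) x"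
    unfolding eq lift_inner[OF q] inner_add_left horizontal_christoffel[OF frame] ..
  then show ?thesis
    by (simp add: cov_deriv_def linear_add[OF linear_horizontal_derivative[OF frame]] inner_add_left)
qed

lemma derivative_along:
  assumes q: "q \<in> D" and Y: "Y differentiable (at q)"
  shows "\<partial> (\<lambda>p. \<partial> G p (Y p)) q u = \<partial> (\<lambda>p. \<partial> G p (Y q)) q u + \<partial> G q (\<partial> Y q u)"
  using directional_derivative_eq[OF has_derivative_linear_family[OF legendrian_open[OF leg] q
    legendrian_linear[OF leg] smooth_on_differentiable[OF legendrian_derivative_smooth[OF leg] q] Y]] by simp

text \<open>The classical description of the Levi-Civita connection of a submanifold of a flat space.\<close>

lemma lift_tangential_cov_deriv:
  assumes q: "q \<in> D" and Y: "Y differentiable (at q)"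
  shows "\<partial> G q (cov_deriv (induced_metric e P h) id X Y q) \<bullet> \<partial> G q x
     = \<partial> (\<lambda>p. \<partial> G p (Y p)) q (X q) \<bullet> \<partial> G q x"
proof -
  let ?H = "\<lambda>a b. \<partial> (\<lambda>p. \<partial> G p a) q b"
  have d: "\<partial> (\<lambda>p. induced_metric e P h p a b) q u = ?H a u \<bullet> \<partial> G q b + ?H b u \<bullet> \<partial> G q a" for a b u
  proof -
    have "\<partial> (\<lambda>p. induced_metric e P h p a b) q = \<partial> (\<lambda>p. \<partial> G p a \<bullet> \<partial> G p b) q"
      by (rule directional_derivative_cong[OF legendrian_open[OF leg] q]) (rule induced_metric_eq)
    then show ?thesis
      using derivative_inner[OF smooth_on_differentiable[OF legendrian_derivative_smooth[OF leg, of a] q]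
        smooth_on_differentiable[OF legendrian_derivative_smooth[OF leg, of b] q], of u]
      by (simp add: inner_commute)
  qed
  have "\<partial> G q (christoffel (induced_metric e P h) q (X q) (Y q)) \<bullet> \<partial> G q x = ?H (Y q) (X q) \<bullet> \<partial> G q x"
    by (rule christoffel_inner[where g="induced_metric e P h" and p=q and T="\<partial> G q", OF legendrian_linear[OF leg q] legendrian_inj[OF leg q] induced_metric_eq[OF q]])
      (use legendrian_second_symmetric[OF leg q] in \<open>simp add: d\<close>)
  then show ?thesis
    by (simp add: cov_deriv_def linear_add[OF legendrian_linear[OF leg q]] inner_add_left derivative_along[OF q Y])
qed

text \<open>The ranges of \<open>\<partial> h q\<close> and of its image under \<open>J\<close> are orthogonal for the projective metric, and
  their dimensions add up to the dimension of projective space.\<close>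

lemma tangent_normal_decomposition:
  assumes q: "q \<in> D" obtains a b where "x = \<partial> h q a + J (\<partial> h q b)"
proof -
  define T where "T = (\<lambda>(a, b). \<partial> h q a + J (\<partial> h q b))"
  have lin: "linear T"
    by (rule linearI) (auto simp: T_def linear_add[OF linear_dh[OF q]] linear_cmul[OF linear_dh[OF q]] J_add J_scaleR algebra_simps)
  have "a = 0 \<and> b = 0" if "\<partial> h q a + J (\<partial> h q b) = 0" for a b
  proof -
    have "\<eta> (h q) (\<partial> h q a) + J (\<eta> (h q) (\<partial> h q b)) = 0"
      using arg_cong[OF that, of "\<eta> (h q)"]
      by (simp add: linear_add[OF linear_horizontal_derivative[OF frame]] horizontal_derivative_J[OF frame]
          linear_0[OF linear_horizontal_derivative[OF frame]])
    then have "c q *s \<eta> (h q) (\<partial> h q a) + J (c q *s \<eta> (h q) (\<partial> h q b)) = 0"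
      by (simp only: J_csmult csmult_add_right[symmetric] vec.scale_zero_right)
    then have eq: "\<partial> G q a + J (\<partial> G q b) = 0" by (simp add: derivative_horizontal[OF q])
    have "(\<partial> G q a + J (\<partial> G q b)) \<bullet> \<partial> G q a = 0" "(\<partial> G q a + J (\<partial> G q b)) \<bullet> J (\<partial> G q b) = 0"
      by (simp_all add: eq)
    then have "\<partial> G q a = 0" "\<partial> G q b = 0"
      using legendrian_lagrangian[OF leg q, of a b] by (simp_all add: inner_add_left J_inner_J inner_commute[of "J (\<partial> G q b)" "\<partial> G q a"])
    then show ?thesis
      using legendrian_inj[OF leg q] linear_injective_0[OF legendrian_linear[OF leg q]] by blast
  qed
  then have "p = 0" if "T p = 0" for p
    using that by (cases p) (simp add: T_def zero_prod_def)
  then have "inj T" using linear_injective_0[OF lin] by blast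
  then have "surj T" using linear_injective_imp_surjective[OF lin] by simp
  then obtain y where "x = T y" by (metis surjE)
  then show thesis using that by (cases y) (auto simp: T_def)
qed

text \<open>The bridge to the flat space. Both covariant derivatives in the definition of the tensor lift to
  projections of the same vector, the derivative of \<open>\<partial> G p (Y p)\<close>; their difference is the
  projection to the \<open>J\<close>-image of the tangent space.\<close>

theorem tensor_A_lift:
  assumes q: "q \<in> D" and Y: "smooth_on D Y"
  shows "\<partial> G q (tensor_A e P h X Y q) \<bullet> \<partial> G q x = \<partial> (\<lambda>p. \<partial> G p (Y p)) q (X q) \<bullet> J (\<partial> G q x)"
proof -
  let ?S = "\<partial> (\<lambda>p. \<partial> G p (Y p)) q (X q)"
  let ?C = "cov_deriv (projective_metric e P) h X (\<lambda>p. \<partial> h p (Y p)) q"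
  let ?N = "cov_deriv (induced_metric e P h) id X Y q"
  note lh = linear_horizontal_derivative[OF frame]
  have Yd: "Y differentiable (at q)" using smooth_on_differentiable[OF Y q] .
  have Vd: "(\<lambda>p. \<partial> h p (Y p)) differentiable (at q)"
    by (rule smooth_on_differentiable[OF smooth_on_directional_derivative_along[OF legendrian_open[OF leg] h Y] q])
  have "\<partial> (\<lambda>p. c p *s \<eta> (h p) (\<partial> h p (Y p))) q = \<partial> (\<lambda>p. \<partial> G p (Y p)) q"
    by (rule directional_derivative_cong[OF legendrian_open[OF leg] q]) (simp add: derivative_horizontal)
  then have C: "\<eta> (h q) ?C \<bullet> \<eta> (h q) x = ?S \<bullet> (c q *s \<eta> (h q) x)" for x
    using lift_ambient_cov_deriv[OF q Vd, of X x] by simp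
  obtain a where a: "\<And>x. \<partial> G q a \<bullet> \<partial> G q x = - J ?S \<bullet> \<partial> G q x"
    using inner_representation[OF legendrian_linear[OF leg q] legendrian_inj[OF leg q], of "- J ?S"] by blast
  have a': "\<partial> G q a \<bullet> \<partial> G q x = ?S \<bullet> J (\<partial> G q x)" for x
    using a[of x] by (simp add: J_inner)
  have eq: "?C = \<partial> h q ?N + J (\<partial> h q a)"
  proof -
    let ?d = "?C - (\<partial> h q ?N + J (\<partial> h q a))"
    obtain b b' where b: "?d = \<partial> h q b + J (\<partial> h q b')" using tangent_normal_decomposition[OF q] by blast
    have hdG: "c q *s \<eta> (h q) (\<partial> h q x) = \<partial> G q x" "c q *s \<eta> (h q) (J (\<partial> h q x)) = J (\<partial> G q x)" for x
      by (simp_all add: derivative_horizontal[OF q] horizontal_derivative_J[OF frame] J_csmult)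
    have e: "\<partial> G q x \<bullet> (c q *s \<eta> (h q) y) = \<eta> (h q) (\<partial> h q x) \<bullet> \<eta> (h q) y"
      "J (\<partial> G q x) \<bullet> (c q *s \<eta> (h q) y) = \<eta> (h q) (J (\<partial> h q x)) \<bullet> \<eta> (h q) y" for x y
      by (simp_all only: hdG(1)[symmetric] J_csmult horizontal_derivative_J[OF frame] lift_inner[OF q])
    have split: "\<eta> (h q) ?d \<bullet> \<eta> (h q) y = ?S \<bullet> (c q *s \<eta> (h q) y)
        - \<partial> G q ?N \<bullet> (c q *s \<eta> (h q) y) - J (\<partial> G q a) \<bullet> (c q *s \<eta> (h q) y)" for y
      unfolding linear_diff[OF lh] linear_add[OF lh] inner_diff_left inner_add_left C e by simp
    have "\<eta> (h q) ?d \<bullet> \<eta> (h q) (\<partial> h q b) = 0"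
      unfolding split hdG using lift_tangential_cov_deriv[OF q Yd, of X b]
        legendrian_lagrangian[OF leg q, of b a] by (simp add: inner_commute)
    moreover have "\<eta> (h q) ?d \<bullet> \<eta> (h q) (J (\<partial> h q b')) = 0"
      unfolding split hdG J_inner_J using a'[of b'] legendrian_lagrangian[OF leg q, of ?N b']
      by simp
    ultimately have "\<eta> (h q) ?d \<bullet> \<eta> (h q) ?d = 0"
      by (subst (2) b) (simp add: linear_add[OF lh] inner_add_right)
    then have "\<eta> (h q) ?d = 0" by simp
    then have "?d = 0" by (rule horizontal_derivative_zeroD[OF frame])
    then show ?thesis by simp
  qed
  have "tensor_A e P h X Y q = a"
    unfolding tensor_A_def
  proof (rule the_equality)
    show "?C = \<partial> h q ?N + J (\<partial> h q a)" by (rule eq)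
  next
    fix a' assume "?C = \<partial> h q ?N + J (\<partial> h q a')"
    then have "J (\<partial> h q a') = J (\<partial> h q a)" using eq by simp
    then have "\<partial> h q a' = \<partial> h q a" using J_J by (metis minus_equation_iff)
    then show "a' = a" using inj_dh[OF q] by (simp add: inj_eq)
  qed
  then show ?thesis using a' by simp
qed

end

section \<open>Horizontal lifts of Lagrangian immersions\<close>

text \<open>The connection form \<open>\<beta>\<close> of the affine lift \<open>Z\<close> is closed by the Lagrangian condition. Rotating
  \<open>Z\<close> by an angle \<open>\<theta>\<close> with differential \<open>- \<beta>\<close> makes it horizontal.\<close>

lemma lagrangian_horizontal_lift:
  fixes h :: "real^'k \<Rightarrow> complex^'k" and e :: "complex^'n"
  assumes frame: "affine_frame e P" and D: "open D" "q0 \<in> D" and h: "smooth_on D h"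
    and inj: "\<And>q. q \<in> D \<Longrightarrow> inj (\<partial> h q)" and lag: "lagrangian_on e P D h"
  obtains r G where "r > 0" "ball q0 r \<subseteq> D" "legendrian_on (ball q0 r) G"
    "\<And>q. q \<in> ball q0 r \<Longrightarrow> hopf (G q) = hopf (affine_lift e P (h q))"
proof -
  obtain r where r: "r > 0" "ball q0 r \<subseteq> D" using D open_contains_ball by blast
  let ?B = "ball q0 r" and ?\<eta> = "horizontal_derivative e P"
  define Z where "Z q = affine_lift e P (h q)" for q
  have hB: "smooth_on ?B h" using smooth_on_subset[OF h r(2)] .
  have Z: "smooth_on ?B Z"
    unfolding Z_def[abs_def] by (rule smooth_on_compose[OF smooth_on_affine_lift[OF frame] open_UNIV hB]) auto
  have Zd: "Z differentiable (at q)" if "q \<in> ?B" for q using smooth_on_differentiable[OF Z that] .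
  define \<beta> where "\<beta> q u = \<partial> Z q u \<bullet> J (Z q)" for q u
  have dZ: "\<partial> Z q u = ?\<eta> (h q) (\<partial> h q u) + \<beta> q u *\<^sub>R J (Z q)" if q: "q \<in> ?B" for q u
  proof -
    have "\<partial> Z q u = \<partial> (affine_lift e P) (h q) (\<partial> h q u)"
      unfolding Z_def[abs_def]
      by (rule derivative_chain[OF differentiableI[OF affine_lift_derivative[OF frame]] smooth_on_differentiable[OF hB q]])
    moreover from this have "connection_form e P (h q) (\<partial> h q u) = \<beta> q u"
      by (simp add: \<beta>_def connection_form_def) (simp add: Z_def)
    ultimately show ?thesis
      using affine_lift_derivative_split[OF frame, of "h q" "\<partial> h q u"] by (simp add: Z_def)
  qed
  have lag': "\<partial> Z q u \<bullet> J (\<partial> Z q v) = 0" if q: "q \<in> ?B" for q u v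
  proof -
    have "?\<eta> (h q) (\<partial> h q u) \<bullet> J (?\<eta> (h q) (\<partial> h q v)) = 0"
      using lag q r(2) unfolding lagrangian_on_def kaehler_form_def projective_metric_eq[OF frame]
        horizontal_derivative_J[OF frame] by blast
    then show ?thesis
      using horizontal_derivative_orthogonal[OF frame, of "h q"]
      by (simp add: dZ[OF q] Z_def inner_add_left inner_diff_right J_add J_scaleR J_J J_inner_J inner_J_self
        inner_commute[of "affine_lift e P (h q)"])
  qed
  define w where "w q = (\<Sum>b\<in>Basis. (- \<beta> q b) *\<^sub>R b)" for q
  have wv: "w q \<bullet> v = - \<beta> q v" if "q \<in> ?B" for q v
  proof -
    note lZ = linear_directional_derivative[OF Z that]
    have lin: "linear (\<beta> q)"
      unfolding \<beta>_def[abs_def]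
      by (intro linearI) (simp_all add: linear_add[OF lZ] linear_cmul[OF lZ] inner_add_left)
    have "\<beta> q v = \<beta> q (\<Sum>b\<in>Basis. (v \<bullet> b) *\<^sub>R b)" by (simp add: euclidean_representation)
    also have "\<dots> = (\<Sum>b\<in>Basis. (v \<bullet> b) *\<^sub>R \<beta> q b)"
      by (simp only: linear_sum[OF lin] linear_cmul[OF lin])
    finally have "\<beta> q v = (\<Sum>b\<in>Basis. (v \<bullet> b) * \<beta> q b)" by simp
    then show ?thesis by (simp add: w_def inner_commute[of _ v] inner_sum_right mult.commute sum_negf)
  qed
  have \<beta>: "smooth_on ?B (\<lambda>q. \<beta> q u)" for u
    unfolding \<beta>_def by (intro smooth_on_inner smooth_on_directional_derivative smooth_on_J Z open_ball)
  have ws: "smooth_on ?B w"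
    unfolding w_def[abs_def] by (intro smooth_on_sum smooth_on_scaleR smooth_on_minus smooth_on_const \<beta> open_ball)
  have "\<partial> w q u \<bullet> v = \<partial> w q v \<bullet> u" if q: "q \<in> ?B" for q u v
  proof -
    have "\<partial> w q u \<bullet> v = - (\<partial> Z q v \<bullet> J (\<partial> Z q u) + \<partial> (\<lambda>q. \<partial> Z q v) q u \<bullet> J (Z q))" for u v
    proof -
      have "\<partial> w q u \<bullet> v = \<partial> (\<lambda>q. w q \<bullet> v) q u"
        using directional_derivative_inner_right[OF smooth_on_differentiable[OF ws q]] by simp
      also have "\<dots> = \<partial> (\<lambda>q. - \<beta> q v) q u"
        using directional_derivative_cong[OF open_ball q, of "\<lambda>q. w q \<bullet> v" "\<lambda>q. - \<beta> q v"] wv by simp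
      also have "\<dots> = - \<partial> (\<lambda>q. \<beta> q v) q u"
        using directional_derivative_eq[OF has_derivative_minus[OF smooth_on_has_derivative[OF \<beta> q]]] by simp
      also have "\<partial> (\<lambda>q. \<beta> q v) q u = \<partial> Z q v \<bullet> J (\<partial> Z q u) + \<partial> (\<lambda>q. \<partial> Z q v) q u \<bullet> J (Z q)"
        unfolding \<beta>_def derivative_J_eq[OF Zd[OF q], symmetric]
        by (rule derivative_inner[OF smooth_on_differentiable[OF smooth_on_directional_derivative[OF Z] q]
            differentiableI[OF derivative_J[OF Zd[OF q]]]])
      finally show ?thesis .
    qed
    then show ?thesis
      using second_derivative_symmetric[OF open_ball q Z, of u v] lag'[OF q] by simp
  qed
  from closed_field_has_primitive[OF ws this]
  obtain \<theta> where \<theta>: "\<And>q. q \<in> ?B \<Longrightarrow> (\<theta> has_derivative (\<lambda>v. w q \<bullet> v)) (at q)" by blast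
  have \<theta>s: "smooth_on ?B \<theta>"
    by (rule smooth_onI[OF open_ball \<theta>]) (auto intro!: smooth_on_inner ws smooth_on_const)
  define c where "c q = cos (\<theta> q) *\<^sub>R (1::complex) + sin (\<theta> q) *\<^sub>R \<i>" for q
  have cs: "smooth_on ?B c"
    unfolding c_def[abs_def] by (intro smooth_on_add smooth_on_scaleR smooth_on_const smooth_on_cos smooth_on_sin \<theta>s open_ball)
  have cn: "cmod (c q) = 1" for q by (simp add: c_def cmod_def)
  have dc: "(c has_derivative (\<lambda>u. - \<beta> q u *\<^sub>R (\<i> * c q))) (at q)" if q: "q \<in> ?B" for q
  proof -
    have "(c has_derivative (\<lambda>u. (- sin (\<theta> q) * (w q \<bullet> u)) *\<^sub>R 1 + (cos (\<theta> q) * (w q \<bullet> u)) *\<^sub>R \<i>)) (at q)"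
      unfolding c_def[abs_def] using \<theta>[OF q] by (auto intro!: derivative_eq_intros simp: mult.commute)
    moreover have "(\<lambda>u. (- sin (\<theta> q) * (w q \<bullet> u)) *\<^sub>R 1 + (cos (\<theta> q) * (w q \<bullet> u)) *\<^sub>R \<i>)
        = (\<lambda>u. - \<beta> q u *\<^sub>R (\<i> * c q))"
      by (simp add: fun_eq_iff wv[OF q] c_def complex_eq_iff)
    ultimately show ?thesis by simp
  qed
  define G where "G q = c q *s Z q" for q
  have dG: "\<partial> G q u = c q *s ?\<eta> (h q) (\<partial> h q u)" if q: "q \<in> ?B" for q u
  proof -
    have "(G has_derivative (\<lambda>u. c q *s \<partial> Z q u + (- \<beta> q u *\<^sub>R (\<i> * c q)) *s Z q)) (at q)"
      unfolding G_def[abs_def]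
      by (rule bounded_bilinear.FDERIV[OF bounded_bilinear_csmult dc[OF q] has_derivative_directional[OF Zd[OF q]]])
    then have "\<partial> G q u = c q *s \<partial> Z q u + (- \<beta> q u *\<^sub>R (\<i> * c q)) *s Z q"
      by (simp add: directional_derivative_eq)
    also have "\<dots> = c q *s ?\<eta> (h q) (\<partial> h q u)"
      by (simp add: dZ[OF q] vec_eq_iff algebra_simps)
    finally show ?thesis .
  qed
  have "legendrian_on ?B G"
    unfolding legendrian_on_def
  proof (intro conjI ballI allI)
    show "smooth_on ?B G" unfolding G_def[abs_def] by (intro smooth_on_csmult cs Z open_ball)
    fix q assume q: "q \<in> ?B"
    show "norm (G q) = 1" by (simp add: G_def norm_csmult cn Z_def norm_affine_lift[OF frame])
    show "J (G q) \<bullet> \<partial> G q u = 0" for u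
      unfolding dG[OF q] G_def J_csmult csmult_inner_csmult
      using horizontal_derivative_orthogonal(2)[OF frame, of "h q"] by (simp add: Z_def inner_commute[of "J (affine_lift e P (h q))"])
    have lin: "linear (\<partial> G q)"
      by (rule linear_directional_derivative[of ?B]) (use \<open>smooth_on ?B G\<close> q in auto)
    have "u = 0" if "\<partial> G q u = 0" for u
    proof -
      have "norm (?\<eta> (h q) (\<partial> h q u)) = 0" using arg_cong[OF that[unfolded dG[OF q]], of norm] by (simp add: norm_csmult cn)
      then have "\<partial> h q u = 0" using horizontal_derivative_zeroD[OF frame] by simp
      then show ?thesis
        using inj[of q] q r(2) linear_injective_0[OF linear_directional_derivative[OF hB q]] by blast
    qed
    then show "inj (\<partial> G q)" using linear_injective_0[OF lin] by blast
  qed simp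
  moreover have "hopf (G q) = hopf (affine_lift e P (h q))" for q
    by (simp add: G_def Z_def hopf_csmult cn)
  ultimately show thesis using that r by blast
qed

section \<open>Change of charts\<close>

context
  fixes M :: "'m topology" and \<A> :: "('a::euclidean_space, 'm) atlas"
  assumes M: "smooth_manifold M \<A>"
begin

lemma chart:
  assumes "(E, y) \<in> \<A>"
  shows "open E" "openin M (y ` E)" "homeomorphic_map (top_of_set E) (subtopology M (y ` E)) y"
  using M assms unfolding smooth_manifold_def by auto

lemma transition_smooth:
  "(E, y) \<in> \<A> \<Longrightarrow> (E', y') \<in> \<A> \<Longrightarrow> smooth_on (E' \<inter> y' -` (y ` E)) (inv_into E y \<circ> y')"
  using M unfolding smooth_manifold_def by blast

lemma chart_inj: "(E, y) \<in> \<A> \<Longrightarrow> inj_on y E"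
  using homeomorphic_imp_injective_map[OF chart(3)] by simp

lemma chart_continuous: "(E, y) \<in> \<A> \<Longrightarrow> continuous_map (top_of_set E) M y"
  using homeomorphic_imp_continuous_map[OF chart(3)] continuous_map_in_subtopology by blast

lemma chart_image_open:
  assumes "(E, y) \<in> \<A>" "open U" "U \<subseteq> E" shows "openin M (y ` U)"
proof -
  have "openin (top_of_set E) U" using assms by (simp add: openin_open_eq chart(1))
  then have "openin (subtopology M (y ` E)) (y ` U)"
    using homeomorphic_imp_open_map[OF chart(3)[OF assms(1)]] by (simp add: open_map_def)
  then show ?thesis using openin_trans_full chart(2)[OF assms(1)] by blast
qed

lemma chart_preimage_open:
  assumes "(E, y) \<in> \<A>" "openin M V" shows "open (E \<inter> y -` V)"
proof -
  have "openin (top_of_set E) {x \<in> topspace (top_of_set E). y x \<in> V}"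
    by (rule openin_continuous_map_preimage[OF chart_continuous[OF assms(1)] assms(2)])
  moreover have "{x \<in> topspace (top_of_set E). y x \<in> V} = E \<inter> y -` V" by auto
  ultimately show ?thesis using chart(1)[OF assms(1)] by (simp add: openin_open_eq)
qed

lemma transition_inverse:
  assumes "(E, y) \<in> \<A>" "(E', y') \<in> \<A>" "p \<in> E'" "y' p \<in> y ` E"
  shows "inv_into E y (y' p) \<in> E" "y (inv_into E y (y' p)) = y' p"
    "inv_into E' y' (y (inv_into E y (y' p))) = p"
  using assms chart_inj by (auto simp: inv_into_into f_inv_into_f)

text \<open>The transition map has a differentiable inverse, the transition map in the other direction.\<close>

lemma transition_derivative_inj:
  assumes 1: "(E, y) \<in> \<A>" "(E', y') \<in> \<A>" and p: "p \<in> E'" "y' p \<in> y ` E"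
  shows "inj (\<partial> (inv_into E y \<circ> y') p)"
proof -
  let ?\<tau> = "inv_into E y \<circ> y'" and ?\<sigma> = "inv_into E' y' \<circ> y"
  let ?S = "E' \<inter> y' -` (y ` E)" and ?T = "E \<inter> y -` (y' ` E')"
  have S: "open ?S" by (rule chart_preimage_open[OF 1(2) chart(2)[OF 1(1)]])
  have pS: "p \<in> ?S" using p by simp
  have "?\<tau> p \<in> ?T" using transition_inverse[OF 1 p] p by auto
  then have d: "?\<sigma> differentiable (at (?\<tau> p))" "?\<tau> differentiable (at p)"
    using smooth_on_differentiable[OF transition_smooth[OF 1(2,1)]]
      smooth_on_differentiable[OF transition_smooth[OF 1] pS] by blast+
  have "\<partial> (\<lambda>x. ?\<sigma> (?\<tau> x)) p = \<partial> (\<lambda>x. x) p"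
    by (rule directional_derivative_cong[OF S pS]) (use transition_inverse[OF 1] in auto)
  then have "\<partial> ?\<sigma> (?\<tau> p) (\<partial> ?\<tau> p u) = u" for u using derivative_chain[OF d, of u] by simp
  then show ?thesis by (metis injI)
qed

end

lemma legendrian_in_other_chart:
  fixes M :: "'m topology" and \<A> :: "('a::euclidean_space, 'm) atlas" and G :: "'a \<Rightarrow> complex^'n"
  assumes M: "smooth_manifold M \<A>" and E: "(E, y) \<in> \<A>" "U \<subseteq> E" and leg: "legendrian_on U G"
    and H: "\<And>q. q \<in> U \<Longrightarrow> H (y q) = G q" and E': "(E', y') \<in> \<A>"
  shows "legendrian_on (E' \<inter> y' -` (y ` U)) (H \<circ> y')"
proof -
  let ?\<tau> = "inv_into E y \<circ> y'" and ?S = "E' \<inter> y' -` (y ` U)"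
  note U = legendrian_open[OF leg] and Gs = legendrian_smooth[OF leg]
  have S: "open ?S" by (rule chart_preimage_open[OF M E' chart_image_open[OF M E(1) U E(2)]])
  have \<tau>U: "?\<tau> p \<in> U" and HG: "(H \<circ> y') p = G (?\<tau> p)" if p: "p \<in> ?S" for p
  proof -
    obtain q where q: "q \<in> U" "y' p = y q" using p by auto
    then have "?\<tau> p = q" using chart_inj[OF M E(1)] E(2) by (auto simp: inv_into_f_f)
    then show "?\<tau> p \<in> U" "(H \<circ> y') p = G (?\<tau> p)" using q H[of q] by auto
  qed
  have \<tau>s: "smooth_on ?S ?\<tau>"
    by (rule smooth_on_subset[OF transition_smooth[OF M E(1) E']]) (use E(2) in auto)
  have "smooth_on ?S (\<lambda>p. G (?\<tau> p))"
    by (rule smooth_on_compose[OF Gs U \<tau>s S \<tau>U])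
  then have sm: "smooth_on ?S (H \<circ> y')" by (rule smooth_on_cong[OF _ S]) (rule HG[symmetric])
  have d: "\<partial> (H \<circ> y') p u = \<partial> G (?\<tau> p) (\<partial> ?\<tau> p u)" if p: "p \<in> ?S" for p u
  proof -
    have "\<partial> (H \<circ> y') p = \<partial> (\<lambda>p. G (?\<tau> p)) p" by (rule directional_derivative_cong[OF S p HG])
    then show ?thesis
      using derivative_chain[OF smooth_on_differentiable[OF Gs \<tau>U[OF p]] smooth_on_differentiable[OF \<tau>s p], of u]
      by simp
  qed
  show ?thesis
    unfolding legendrian_on_def
  proof (intro conjI ballI allI S sm)
    fix p assume p: "p \<in> ?S"
    show "norm ((H \<circ> y') p) = 1" unfolding HG[OF p] by (rule legendrian_norm[OF leg \<tau>U[OF p]])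
    show "J ((H \<circ> y') p) \<bullet> \<partial> (H \<circ> y') p u = 0" for u
      unfolding HG[OF p] d[OF p] by (rule legendrian_orthogonal_J[OF leg \<tau>U[OF p]])
    have "inj (\<partial> ?\<tau> p)" by (rule transition_derivative_inj[OF M E(1) E']) (use p E(2) in auto)
    moreover have "\<partial> (H \<circ> y') p = \<partial> G (?\<tau> p) \<circ> \<partial> ?\<tau> p" by (simp add: fun_eq_iff d[OF p])
    ultimately show "inj (\<partial> (H \<circ> y') p)" using inj_compose legendrian_inj[OF leg \<tau>U[OF p]] by metis
  qed
qed

text \<open>A Legendrian map in one parametrization gives a horizontal lift in the sense of the definition,
  which quantifies over all charts of the manifold and of projective space.\<close>

theorem legendrian_horizontal_lift:
  fixes M :: "'m topology" and \<A> :: "(real^'k, 'm) atlas" and G :: "real^'k \<Rightarrow> complex^'n"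
  assumes M: "smooth_manifold M \<A>" and E: "(E, y) \<in> \<A>" "U \<subseteq> E" and leg: "legendrian_on U G"
    and H: "\<And>q. q \<in> U \<Longrightarrow> H (y q) = G q" and f: "\<And>q. q \<in> U \<Longrightarrow> f (y q) = hopf (G q)"
  shows "horizontal_lift \<A> f (y ` U) H"
proof -
  have leg': "legendrian_on (E' \<inter> y' -` (y ` U)) (H \<circ> y')" if "(E', y') \<in> \<A>" for E' y'
    by (rule legendrian_in_other_chart[OF M E leg H that])
  have fH: "norm (H p) = 1 \<and> hopf (H p) = f p" if "p \<in> y ` U" for p
    using that H f legendrian_norm[OF leg] by auto
  have "induced_metric e P h q u v = \<partial> (H \<circ> y') q u \<bullet> \<partial> (H \<circ> y') q v"
    if rep: "coord_rep \<A> f D y' e P h" and q: "q \<in> D \<inter> y' -` (y ` U)" for D y' e P h q u v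
  proof -
    let ?D = "D \<inter> y' -` (y ` U)"
    obtain E' where E': "D \<subseteq> E'" "(E', y') \<in> \<A>" "open D" "affine_frame e P"
      and fh: "\<And>q. q \<in> D \<Longrightarrow> f (y' q) = hopf (affine_lift e P (h q))"
      using rep unfolding coord_rep_def by blast
    have "?D = D \<inter> (E' \<inter> y' -` (y ` U))" using E' by auto
    then have "open ?D" using open_Int[OF E'(3) legendrian_open[OF leg'[OF E'(2)]]] by (simp only:)
    then have leg'': "legendrian_on ?D (H \<circ> y')"
      using legendrian_on_subset[OF leg'[OF E'(2)]] E'(1) by blast
    have "hopf ((H \<circ> y') q) = hopf (affine_lift e P (h q))" if "q \<in> ?D" for q
      using fH[of "y' q"] fh[of q] that by simp
    from legendrian_lift_affine_coordinates[OF leg'' E'(4) this]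
    obtain c where "smooth_on ?D h" "smooth_on ?D c"
      "\<And>q. q \<in> ?D \<Longrightarrow> cmod (c q) = 1 \<and> (H \<circ> y') q = c q *s affine_lift e P (h q)" by blast
    then interpret legendrian_chart ?D "H \<circ> y'" e P h c
      using leg'' E'(4) by unfold_locales auto
    show ?thesis by (rule induced_metric_eq[OF q])
  qed
  note iso = this
  show ?thesis
    unfolding horizontal_lift_def
  proof (intro conjI)
    show "\<forall>p\<in>y ` U. norm (H p) = 1 \<and> hopf (H p) = f p" using fH by blast
    show "\<forall>(E', y')\<in>\<A>. smooth_on (E' \<inter> y' -` (y ` U)) (H \<circ> y') \<and>
      (\<forall>q\<in>E' \<inter> y' -` (y ` U). inj (\<partial> (H \<circ> y') q) \<and> (\<forall>u. J (H (y' q)) \<bullet> \<partial> (H \<circ> y') q u = 0))"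
    proof
      fix x assume x: "x \<in> \<A>"
      obtain E' y' where eq: "x = (E', y')" by (cases x)
      show "case x of (E', y') \<Rightarrow> smooth_on (E' \<inter> y' -` (y ` U)) (H \<circ> y') \<and>
        (\<forall>q\<in>E' \<inter> y' -` (y ` U). inj (\<partial> (H \<circ> y') q) \<and> (\<forall>u. J (H (y' q)) \<bullet> \<partial> (H \<circ> y') q u = 0))"
        using leg'[of E' y'] x unfolding eq prod.case legendrian_on_def comp_apply by blast
    qed
    show "\<forall>D y' e P h. coord_rep \<A> f D y' e P h \<longrightarrow> (\<forall>q\<in>D \<inter> y' -` (y ` U). \<forall>u v.
        induced_metric e P h q u v = \<partial> (H \<circ> y') q u \<bullet> \<partial> (H \<circ> y') q v)"
      using iso by blast
  qed
qed

section \<open>Minimality and Legendrian surfaces in the 5-sphere\<close>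

text \<open>The second fundamental form of \<open>G\<close> at \<open>q\<close> is traceless for the induced metric, expressed in a
  frame: \<open>C\<close> gives the components of tangent vectors with respect to a frame that is orthonormal up
  to the scale \<open>s\<close>, and \<open>S\<close> is the second fundamental form in terms of these components.\<close>

definition traceless_at :: "(real^'k \<Rightarrow> complex^'n) \<Rightarrow> real^'k \<Rightarrow> bool" where
  "traceless_at G q \<longleftrightarrow> (\<exists>(C :: real^'k \<Rightarrow> real^'k) (S :: real^'k \<Rightarrow> real^'k \<Rightarrow> real^'k) s.
    linear C \<and> inj C \<and> s \<noteq> 0 \<and>
    (\<forall>u v. \<partial> G q u \<bullet> \<partial> G q v = s * (C u \<bullet> C v)) \<and>
    (\<forall>u. linear (S u) \<and> trace (matrix (S u)) = 0) \<and>
    (\<forall>u v x. \<partial> (\<lambda>p. \<partial> G p v) q u \<bullet> J (\<partial> G q x) = s * (S (C u) (C v) \<bullet> C x)))"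

text \<open>Conjugation by \<open>C\<close> takes the tensor to \<open>S\<close>, and the trace is invariant.\<close>

lemma (in legendrian_chart) minimalI:
  assumes C: "\<And>q. q \<in> D \<Longrightarrow> traceless_at G q"
  shows "minimal_on e P D h"
  unfolding minimal_on_def
proof (intro ballI allI)
  fix q u assume q: "q \<in> D"
  obtain C :: "real^'k \<Rightarrow> real^'k" and S s where C: "linear C" "inj C" "s \<noteq> 0"
    "\<forall>u v. \<partial> G q u \<bullet> \<partial> G q v = s * (C u \<bullet> C v)"
    "\<forall>u. linear (S u) \<and> trace (matrix (S u)) = 0"
    "\<forall>u v x. \<partial> (\<lambda>p. \<partial> G p v) q u \<bullet> J (\<partial> G q x) = s * (S (C u) (C v) \<bullet> C x)"
    using C[OF q] unfolding traceless_at_def by blast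
  have S: "linear (S u)" for u using C(5) by blast
  have surj: "surj C" using linear_injective_imp_surjective[OF C(1,2)] by simp
  define A where "A v = tensor_A e P h (\<lambda>_. u) (\<lambda>_. v) q" for v
  have CA: "C (A v) = S (C u) (C v)" for v
  proof -
    have "s * (C (A v) \<bullet> C x) = s * (S (C u) (C v) \<bullet> C x)" for x
      using tensor_A_lift[OF q smooth_on_const[OF legendrian_open[OF leg]], of "\<lambda>_. u" v x] C(4,6)
      by (simp add: A_def)
    then have scaled: "C (A v) \<bullet> C x = S (C u) (C v) \<bullet> C x" for x using C(3) by simp
    have "C (A v) \<bullet> x = S (C u) (C v) \<bullet> x" for x
    proof -
      obtain y where "x = C y" using surj by (metis surjE)
      then show ?thesis using scaled by simp
    qed
    then show ?thesis using vector_eq_rdot by blast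
  qed
  obtain K where K: "linear K" "K \<circ> C = id" using linear_injective_left_inverse[OF C(1,2)] by blast
  have KC: "K (C x) = x" for x using fun_cong[OF K(2), of x] by simp
  have A: "A = K \<circ> (S (C u) \<circ> C)"
    by (simp add: fun_eq_iff CA[symmetric] KC)
  have lin: "linear (S (C u) \<circ> C)" by (rule linear_compose[OF C(1) S])
  have "matrix A = matrix K ** (matrix (S (C u)) ** matrix C)"
    unfolding A using matrix_compose[OF lin K(1)] matrix_compose[OF C(1) S] by simp
  then have "trace (matrix A) = trace (matrix (S (C u)) ** (matrix C ** matrix K))"
    by (metis trace_mul_sym matrix_mul_assoc)
  moreover have "C (K x) = x" for x
  proof -
    obtain y where "x = C y" using surj by (metis surjE)
    then show ?thesis by (simp add: KC)
  qed
  then have "C \<circ> K = id" by (simp add: fun_eq_iff)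
  then have "matrix C ** matrix K = mat 1" using matrix_compose[OF K(1) C(1)] by (simp add: matrix_id_mat_1)
  ultimately show "trace (matrix (\<lambda>v. tensor_A e P h (\<lambda>_. u) (\<lambda>_. v) q)) = 0"
    using C(5) by (simp add: A_def[abs_def])
qed

text \<open>With the first unit vector, this gives the standard affine chart \<open>(1, w\<^sub>1, w\<^sub>2)\<close> of the
  projective plane.\<close>

definition standard_frame_matrix :: "complex^2^3" where
  "standard_frame_matrix = (\<chi> i j. if (i = 2 \<and> j = 1) \<or> (i = 3 \<and> j = 2) then 1 else 0)"

lemma standard_frame_nth:
  "(c *s axis 1 1 + standard_frame_matrix *v w) $ 1 = c"
  "(c *s axis 1 1 + standard_frame_matrix *v w) $ 2 = w $ 1"
  "(c *s axis 1 1 + standard_frame_matrix *v w) $ 3 = w $ 2"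
  by (simp_all add: standard_frame_matrix_def matrix_vector_mult_def sum_2 axis_def)

lemma affine_frame_standard: "affine_frame (axis 1 1) standard_frame_matrix"
  unfolding affine_frame_def
proof (rule bijI)
  let ?B = "\<lambda>(c, w). c *s axis 1 1 + standard_frame_matrix *v w"
  show "inj ?B"
  proof (rule injI)
    fix p q assume eq: "?B p = ?B q"
    obtain c w d x where pq: "p = (c, w)" "q = (d, x)" by (metis surj_pair)
    have "?B p $ i = ?B q $ i" for i by (simp add: eq)
    from this[of 1] this[of 2] this[of 3] show "p = q"
      unfolding pq prod.case standard_frame_nth by (simp add: vec_eq_iff forall_2)
  qed
  show "surj ?B"
  proof (rule surjI)
    fix v :: "complex^3"
    show "?B (v $ 1, vector [v $ 2, v $ 3]) = v"
      unfolding vec_eq_iff forall_3 prod.case standard_frame_nth by simp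
  qed
qed

lemma smooth_manifold_open_set: "open \<Theta> \<Longrightarrow> smooth_manifold (top_of_set \<Theta>) {(\<Theta>, id)}"
  for \<Theta> :: "'a::euclidean_space set"
proof -
  assume \<Theta>: "open \<Theta>"
  have s: "smooth_on \<Theta> (inv_into \<Theta> id \<circ> id)"
    by (rule smooth_on_cong[OF smooth_on_ident[OF \<Theta>] \<Theta>]) (metis comp_apply id_apply inj_on_id inv_into_f_f)
  obtain B :: "'a set set" where B: "countable B" "\<And>C. C \<in> B \<Longrightarrow> open C"
    "\<And>S. open S \<Longrightarrow> \<exists>U. U \<subseteq> B \<and> S = \<Union>U" using univ_second_countable by blast
  have "second_countable (euclidean :: 'a topology)"
    unfolding second_countable_def
  proof (intro exI[of _ B] conjI ballI allI impI B(1))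
    show "openin euclidean V" if "V \<in> B" for V using B(2)[OF that] by simp
    fix U :: "'a set" and x assume "openin euclidean U \<and> x \<in> U"
    then show "\<exists>V\<in>B. x \<in> V \<and> V \<subseteq> U" using B(3)[of U] by auto
  qed
  then have "second_countable (top_of_set \<Theta>)" "Hausdorff_space (top_of_set \<Theta>)"
    by (simp_all add: second_countable_subtopology Hausdorff_space_subtopology Hausdorff_space_euclidean)
  then show ?thesis
    unfolding smooth_manifold_def using \<Theta> s by (simp add: subtopology_subtopology)
qed

text \<open>Where the first homogeneous coordinate does not vanish, one affine chart covers the surface.\<close>

theorem special_lagrangian_of_legendrian:
  fixes \<phi> :: "real^2 \<Rightarrow> complex^3"
  assumes leg: "legendrian_on \<Theta> \<phi>" and nz: "\<And>q. q \<in> \<Theta> \<Longrightarrow> \<phi> q $ 1 \<noteq> 0"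
    and C: "\<And>q. q \<in> \<Theta> \<Longrightarrow> traceless_at \<phi> q"
  shows "special_lagrangian (top_of_set \<Theta>) {(\<Theta>, id)} (hopf \<circ> \<phi>)"
    and "horizontal_lift {(\<Theta>, id)} (hopf \<circ> \<phi>) \<Theta> \<phi>"
proof -
  note \<Theta> = legendrian_open[OF leg]
  let ?P = standard_frame_matrix and ?e = "axis 1 1 :: complex^3"
  define h :: "real^2 \<Rightarrow> complex^2" where "h q = vector [\<phi> q $ 2 / \<phi> q $ 1, \<phi> q $ 3 / \<phi> q $ 1]" for q
  have eq: "hopf (\<phi> q) = hopf (affine_lift ?e ?P (h q))" if q: "q \<in> \<Theta>" for q
  proof -
    let ?c = "inverse (\<phi> q $ 1)"
    have 1: "?e + ?P *v h q = ?c *s \<phi> q"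
      using standard_frame_nth[of 1 "h q"] nz[OF q]
      by (simp add: vec_eq_iff forall_3 h_def divide_inverse mult.commute)
    have n: "norm (\<phi> q) = 1" using legendrian_norm[OF leg q] .
    have "affine_lift ?e ?P (h q) = (inverse (cmod ?c) *\<^sub>R ?c) *s \<phi> q"
      by (simp only: affine_lift_def sgn_div_norm 1 norm_csmult n mult_1_right csmult_scaleR)
    moreover have "cmod (inverse (cmod ?c) *\<^sub>R ?c) = 1" using nz[OF q] by (simp add: norm_inverse)
    ultimately show ?thesis using hopf_csmult by metis
  qed
  from legendrian_lift_affine_coordinates[OF leg affine_frame_standard eq]
  obtain c where c: "smooth_on \<Theta> h" "smooth_on \<Theta> c"
    "\<And>q. q \<in> \<Theta> \<Longrightarrow> cmod (c q) = 1 \<and> \<phi> q = c q *s affine_lift ?e ?P (h q)" by blast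
  interpret legendrian_chart \<Theta> \<phi> ?e ?P h c
    by unfold_locales (use leg affine_frame_standard c in auto)
  have rep: "coord_rep {(\<Theta>, id)} (hopf \<circ> \<phi>) \<Theta> id ?e ?P h"
    unfolding coord_rep_def using \<Theta> affine_frame_standard eq by auto
  have "(hopf \<circ> \<phi>) ` \<Theta> \<subseteq> complex_projective_space"
    unfolding complex_projective_space_def using legendrian_norm[OF leg] by auto
  then show "special_lagrangian (top_of_set \<Theta>) {(\<Theta>, id)} (hopf \<circ> \<phi>)"
    unfolding special_lagrangian_def
  proof (intro conjI ballI)
    fix p assume "p \<in> topspace (top_of_set \<Theta>)"
    then have "p \<in> id ` \<Theta>" by simp
    then show "\<exists>D y e P h. coord_rep {(\<Theta>, id)} (hopf \<circ> \<phi>) D y e P h \<and> p \<in> y ` D \<and>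
        smooth_on D h \<and> (\<forall>q\<in>D. inj (\<partial> h q)) \<and> lagrangian_on e P D h \<and> minimal_on e P D h"
      using rep h inj_dh lagrangian minimalI[OF C] by blast
  qed simp
  have "horizontal_lift {(\<Theta>, id)} (hopf \<circ> \<phi>) (id ` \<Theta>) \<phi>"
    by (rule legendrian_horizontal_lift[OF smooth_manifold_open_set[OF \<Theta>] _ _ leg]) auto
  then show "horizontal_lift {(\<Theta>, id)} (hopf \<circ> \<phi>) \<Theta> \<phi>" by simp
qed

section \<open>Unitary bases\<close>

lemma exhaust_5: fixes x :: 5 shows "x = 1 \<or> x = 2 \<or> x = 3 \<or> x = 4 \<or> x = 5"
proof (induct x)
  case (of_int z)
  then have "z = 0 \<or> z = 1 \<or> z = 2 \<or> z = 3 \<or> z = 4" by fastforce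
  then show ?case by auto
qed

lemma UNIV_5: "UNIV = {1, 2, 3, 4, 5 :: 5}"
  using exhaust_5 by auto

lemma sum_5: "sum f (UNIV :: 5 set) = f 1 + f 2 + f 3 + f 4 + f 5"
  unfolding UNIV_5 by (simp add: ac_simps)

lemma forall_5: "(\<forall>i::5. P i) \<longleftrightarrow> P 1 \<and> P 2 \<and> P 3 \<and> P 4 \<and> P 5"
  by (metis exhaust_5)

text \<open>The matrix that takes a vector to its coefficients in a unitary basis \<open>b\<close>.\<close>

definition hermitian_coefficients :: "('n::finite \<Rightarrow> complex^'n) \<Rightarrow> complex^'n^'n" where
  "hermitian_coefficients b = (\<chi> i j. cnj (b i $ j))"

lemma hermitian_coefficients_nth:
  "(hermitian_coefficients b *v x) $ i = Complex (x \<bullet> b i) (x \<bullet> J (b i))"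
  by (simp add: hermitian_coefficients_def matrix_vector_mult_def complex_eq_iff inner_vec_def
      inner_complex_def algebra_simps)

lemma
  assumes orth: "\<And>i j. b i \<bullet> b j = (if i = j then 1 else 0)" and J: "\<And>i j. b i \<bullet> J (b j) = 0"
  shows unitary_hermitian_coefficients: "unitary_matrix (hermitian_coefficients b)"
    and hermitian_basis_expansion: "x = (\<Sum>i\<in>UNIV. (x \<bullet> b i) *\<^sub>R b i + (x \<bullet> J (b i)) *\<^sub>R J (b i))"
proof -
  let ?Q = "hermitian_coefficients b"
  define Q' where "Q' = (\<chi> i j. cnj (?Q $ j $ i))"
  have col: "Q' $ k $ j = b j $ k" for k j by (simp add: Q'_def hermitian_coefficients_def)
  have "(?Q ** Q') $ i $ j = mat 1 $ i $ j" for i j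
  proof -
    have "(?Q ** Q') $ i $ j = (?Q *v b j) $ i"
      by (simp add: matrix_matrix_mult_def matrix_vector_mult_def col)
    then show ?thesis using orth[of j i] J[of j i]
      by (simp add: hermitian_coefficients_nth mat_def complex_eq_iff)
  qed
  then have 1: "?Q ** Q' = mat 1" by (simp add: vec_eq_iff)
  then have 2: "Q' ** ?Q = mat 1" by (simp add: matrix_left_right_inverse)
  show "unitary_matrix ?Q" using 1 2 by (simp add: unitary_matrix_def Let_def Q'_def)
  have "x = Q' *v (?Q *v x)" by (simp add: matrix_vector_mul_assoc 2)
  also have "\<dots> = (\<Sum>i\<in>UNIV. (?Q *v x) $ i *s b i)"
    by (simp add: vec_eq_iff matrix_vector_mult_def[of Q'] col mult.commute)
  finally show "x = (\<Sum>i\<in>UNIV. (x \<bullet> b i) *\<^sub>R b i + (x \<bullet> J (b i)) *\<^sub>R J (b i))"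
    by (simp add: hermitian_coefficients_nth csmult_eq[of "Complex _ _"])
qed

section \<open>Codazzi equations of an adapted frame\<close>

text \<open>The components of the tensor \<open>A\<close> in an adapted frame, divided by \<open>r\<close>.\<close>

definition sff :: "4 \<Rightarrow> 4 \<Rightarrow> 4 \<Rightarrow> real" where
  "sff i j k = (if i = 1 \<and> j = 1 \<and> k = 1 then 1
     else if i = 1 \<and> j = 2 \<and> k = 2 \<or> i = 2 \<and> j = 1 \<and> k = 2 \<or> i = 2 \<and> j = 2 \<and> k = 1 then -1 else 0)"

text \<open>The hypotheses of the theorem, expressed for a Legendrian lift. Integrability of the span of the
  first two vector fields enters as the symmetry, on that span, of the shape operators of \<open>E 3\<close> and \<open>E 4\<close>.\<close>

locale adapted_legendrian =
  fixes B :: "(real^4) set" and G :: "real^4 \<Rightarrow> complex^5" and X :: "4 \<Rightarrow> real^4 \<Rightarrow> real^4"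
    and r :: "real^4 \<Rightarrow> real" and E :: "4 \<Rightarrow> real^4 \<Rightarrow> complex^5"
  defines "E \<equiv> (\<lambda>i p. \<partial> G p (X i p))"
  assumes leg: "legendrian_on B G" and conv: "convex B"
    and X: "\<And>i. smooth_on B (X i)" and r: "\<And>q. q \<in> B \<Longrightarrow> r q > 0"
    and E_E: "\<And>q i j. q \<in> B \<Longrightarrow> E i q \<bullet> E j q = (if i = j then 1 else 0)"
    and frame_sff: "\<And>q i j k. q \<in> B \<Longrightarrow> \<partial> (E j) q (X i q) \<bullet> J (E k q) = r q * sff i j k"
    and integrable: "\<And>q a. q \<in> B \<Longrightarrow> a \<in> {3, 4} \<Longrightarrow> \<partial> (E a) q (X 2 q) \<bullet> E 1 q = \<partial> (E a) q (X 1 q) \<bullet> E 2 q"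
begin

lemma B_open: "open B" by (rule legendrian_open[OF leg])

lemma E_smooth: "smooth_on B (E i)"
  unfolding E_def by (rule smooth_on_directional_derivative_along[OF B_open legendrian_smooth[OF leg] X])

lemma G_smooth: "smooth_on B G" by (rule legendrian_smooth[OF leg])

lemma J_smooth: "smooth_on B (\<lambda>p. J (f p))" if "smooth_on B f" for f :: "_ \<Rightarrow> complex^5"
  by (rule smooth_on_J[OF B_open that])

lemma J_derivative: "smooth_on B f \<Longrightarrow> q \<in> B \<Longrightarrow> \<partial> (\<lambda>p. J (f p)) q u = J (\<partial> f q u)"
  for f :: "_ \<Rightarrow> complex^5"
  by (rule derivative_J_eq[OF smooth_on_differentiable])

context
  fixes q assumes q: "q \<in> B"
begin

lemma G_G: "G q \<bullet> G q = 1" using legendrian_norm[OF leg q] by (simp add: norm_eq_1)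

lemma G_E: "G q \<bullet> E i q = 0" "E i q \<bullet> G q = 0"
  using legendrian_orthogonal[OF leg q] by (simp_all add: E_def inner_commute)

lemma JG_dG: "\<partial> G q u \<bullet> J (G q) = 0"
  using legendrian_orthogonal_J[OF leg q] by (simp add: inner_commute)

lemma E_JG: "E i q \<bullet> J (G q) = 0" "G q \<bullet> J (E i q) = 0" "J (E i q) \<bullet> G q = 0"
  using JG_dG[of "X i q"] J_inner[of "G q" "E i q"] J_inner[of "E i q" "G q"]
  by (simp_all add: E_def inner_commute)

lemma dG_JE: "\<partial> G q u \<bullet> J (E i q) = 0"
  using legendrian_lagrangian[OF leg q] by (simp add: E_def)

lemma E_JE: "E i q \<bullet> J (E j q) = 0"
  using dG_JE[of "X i q"] by (simp add: E_def)

lemma frame_coordinates: "u = (\<Sum>k\<in>UNIV. (\<partial> G q u \<bullet> E k q) *\<^sub>R X k q)"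
proof -
  define T where "T c = (\<Sum>k\<in>UNIV. (c $ k) *\<^sub>R X k q)" for c :: "real^4"
  have T: "linear T" by (rule linearI) (simp_all add: T_def scaleR_add_left sum.distrib scaleR_sum_right)
  note lin = legendrian_linear[OF leg q]
  have GT: "\<partial> G q (T c) \<bullet> E k q = c $ k" for c k
  proof -
    have "\<partial> G q (T c) = (\<Sum>k\<in>UNIV. (c $ k) *\<^sub>R E k q)"
      by (simp add: T_def E_def linear_sum[OF lin] linear_cmul[OF lin])
    then show ?thesis by (simp add: inner_sum_left E_E[OF q] if_distrib cong: if_cong)
  qed
  have "c = 0" if "T c = 0" for c
    using GT[of c] that linear_0[OF lin] by (simp add: vec_eq_iff)
  then have "inj T" using linear_injective_0[OF T] by blast
  then have "surj T" using linear_injective_imp_surjective[OF T] by simp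
  then obtain c where "u = T c" by (metis surjE)
  then show ?thesis using GT[of c] by (simp add: T_def)
qed

lemma dG_expansion: "\<partial> G q u = (\<Sum>k\<in>UNIV. (\<partial> G q u \<bullet> E k q) *\<^sub>R E k q)"
  using arg_cong[OF frame_coordinates[of u], of "\<partial> G q"]
  by (simp add: E_def linear_sum[OF legendrian_linear[OF leg q]] linear_cmul[OF legendrian_linear[OF leg q]])

lemma frame_derivative_expansion:
  assumes "smooth_on B f" shows "\<partial> f q u = (\<Sum>k\<in>UNIV. (\<partial> G q u \<bullet> E k q) *\<^sub>R \<partial> f q (X k q))"
  using arg_cong[OF frame_coordinates[of u], of "\<partial> f q"] linear_directional_derivative[OF assms q]
  by (simp add: linear_sum linear_cmul)

text \<open>The vectors of the frame and \<open>G\<close> are orthonormal for the Hermitian product, and there are five of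
  them.\<close>

lemma frame_expansion:
  "x = (x \<bullet> G q) *\<^sub>R G q + (x \<bullet> J (G q)) *\<^sub>R J (G q)
     + (\<Sum>k\<in>UNIV. (x \<bullet> E k q) *\<^sub>R E k q + (x \<bullet> J (E k q)) *\<^sub>R J (E k q))"
proof -
  define b :: "5 \<Rightarrow> complex^5"
    where "b i = (if i = 1 then E 1 q else if i = 2 then E 2 q else if i = 3 then E 3 q
      else if i = 4 then E 4 q else G q)" for i
  have b: "b 1 = E 1 q" "b 2 = E 2 q" "b 3 = E 3 q" "b 4 = E 4 q" "b 5 = G q" by (simp_all add: b_def)
  have "\<forall>i j. b i \<bullet> b j = (if i = j then 1 else 0)" "\<forall>i j. b i \<bullet> J (b j) = 0"
    unfolding forall_5 b by (simp_all add: E_E[OF q] G_G G_E E_JG E_JE inner_J_self)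
  then have "x = (\<Sum>i\<in>UNIV. (x \<bullet> b i) *\<^sub>R b i + (x \<bullet> J (b i)) *\<^sub>R J (b i))"
    by (intro hermitian_basis_expansion) blast+
  from this[unfolded sum_5 b] show ?thesis unfolding sum_4 by (simp only: add.assoc add.commute add.left_commute)
qed

lemma dE_G: "\<partial> (E i) q u \<bullet> G q = - (\<partial> G q u \<bullet> E i q)"
  using constant_inner_derivative[OF B_open q E_smooth G_smooth, of i 0]
    legendrian_orthogonal[OF leg] by (simp add: E_def inner_commute)

lemma dE_JG: "\<partial> (E i) q u \<bullet> J (G q) = 0"
proof -
  have "\<partial> (E i) q u \<bullet> J (G q) = - (E i q \<bullet> J (\<partial> G q u))"
    using constant_inner_derivative[OF B_open q E_smooth J_smooth[OF G_smooth], of i 0 u]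
      legendrian_orthogonal_J[OF leg] by (simp add: E_def inner_commute J_derivative[OF G_smooth q])
  then show ?thesis using legendrian_lagrangian[OF leg q] by (simp add: E_def)
qed

lemma dE_E: "\<partial> (E i) q u \<bullet> E j q = - (\<partial> (E j) q u \<bullet> E i q)"
  using constant_inner_derivative[OF B_open q E_smooth[of i] E_smooth[of j] E_E, where u=u]
  by (simp add: inner_commute)

lemma dE_JE: "\<partial> (E j) q u \<bullet> J (E k q) = r q * (\<Sum>i\<in>UNIV. (\<partial> G q u \<bullet> E i q) * sff i j k)"
  using arg_cong[OF frame_derivative_expansion[OF E_smooth, of j u], of "\<lambda>x. x \<bullet> J (E k q)"]
  by (simp add: inner_sum_left frame_sff[OF q] sum_distrib_left mult_ac)

end

lemma dE34_JE: "q \<in> B \<Longrightarrow> a \<in> {3, 4} \<Longrightarrow> \<partial> (E a) q u \<bullet> J (E k q) = 0"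
  by (auto simp: dE_JE sff_def)

text \<open>Differentiate the equation \<open>\<partial> (E a) p u \<bullet> J (E k p) = 0\<close> in the direction \<open>v\<close> and use the symmetry
  of second derivatives. The equation is algebraic in the components of the tensor.\<close>

lemma codazzi:
  assumes q: "q \<in> B" and a: "a \<in> {3, 4}"
  shows "(\<Sum>j\<in>UNIV. (\<partial> (E a) q u \<bullet> E j q) * (\<partial> (E k) q v \<bullet> J (E j q)))
       = (\<Sum>j\<in>UNIV. (\<partial> (E a) q v \<bullet> E j q) * (\<partial> (E k) q u \<bullet> J (E j q)))"
proof -
  have pair: "\<partial> (E a) q u \<bullet> J (\<partial> (E k) q v) = - (\<Sum>j\<in>UNIV. (\<partial> (E a) q u \<bullet> E j q) * (\<partial> (E k) q v \<bullet> J (E j q)))" for u v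
  proof -
    have J: "x \<bullet> J (\<partial> (E k) q v) = - (\<partial> (E k) q v \<bullet> J x)" for x
      using J_inner[of x "\<partial> (E k) q v"] by (simp add: inner_commute)
    have "\<partial> (E a) q u = (\<partial> (E a) q u \<bullet> G q) *\<^sub>R G q + (\<Sum>j\<in>UNIV. (\<partial> (E a) q u \<bullet> E j q) *\<^sub>R E j q)"
      using frame_expansion[OF q, of "\<partial> (E a) q u"] by (simp only: dE34_JE[OF q a] dE_JG[OF q]) simp
    from arg_cong[OF this, of "\<lambda>x. x \<bullet> J (\<partial> (E k) q v)"]
    show ?thesis by (simp add: inner_add_left inner_sum_left J[of "G q"] J[of "E _ q"] dE_JG[OF q] sum_negf)
  qed
  have "\<partial> (E a) q u \<bullet> J (\<partial> (E k) q v) = - (\<partial> (\<lambda>p. \<partial> (E a) p u) q v \<bullet> J (E k q))" for u v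
    using constant_inner_derivative[OF B_open q smooth_on_directional_derivative[OF E_smooth, of a u]
      J_smooth[OF E_smooth, of k], of 0 v] dE34_JE[OF _ a]
    by (simp add: J_derivative[OF E_smooth q])
  then have "\<partial> (E a) q u \<bullet> J (\<partial> (E k) q v) = \<partial> (E a) q v \<bullet> J (\<partial> (E k) q u)"
    using second_derivative_symmetric[OF B_open q E_smooth, of a u v] by simp
  then show ?thesis by (simp add: pair)
qed

text \<open>The factor \<open>\<lambda>\<^sub>a\<close> by which the shape operator of \<open>E a\<close> acts on the span of \<open>X 1\<close> and \<open>X 2\<close>.\<close>

definition curv :: "4 \<Rightarrow> real^4 \<Rightarrow> real" where "curv a p = \<partial> (E a) p (X 1 p) \<bullet> E 1 p"

text \<open>Write \<open>?a j m\<close> for the components of the derivative of \<open>E a\<close>. The Codazzi equations for the pairs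
  \<open>(X 1, X 3)\<close> and \<open>(X 1, X 4)\<close> show that the columns \<open>m = 3, 4\<close> vanish. For \<open>(X 1, X 2)\<close> they give
  \<open>?a 1 2 = - ?a 2 1\<close> and \<open>?a 2 2 = ?a 1 1\<close>; integrability adds \<open>?a 1 2 = ?a 2 1\<close>.\<close>

lemma umbilical:
  assumes q: "q \<in> B" and a: "a \<in> {3, 4}" and i: "i \<in> {1, 2}"
  shows "\<partial> (E a) q u \<bullet> E i q = curv a q * (\<partial> G q u \<bullet> E i q)"
proof -
  let ?a = "\<lambda>j m. \<partial> (E a) q (X m q) \<bullet> E j q"
  have dX: "\<partial> G q (X m q) \<bullet> E k q = (if m = k then 1 else 0)" for m k
    using E_E[OF q, of m k] by (simp add: E_def)
  have r0: "r q \<noteq> 0" using r[OF q] by simp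
  have s: "\<partial> (E k) q (X m q) \<bullet> J (E j q) = r q * sff m k j" for k m j by (rule frame_sff[OF q])
  have c: "(\<Sum>j\<in>UNIV. ?a j l * sff m k j) = (\<Sum>j\<in>UNIV. ?a j m * sff l k j)" for k l m
  proof -
    have "r q * (\<Sum>j\<in>UNIV. ?a j l * sff m k j) = r q * (\<Sum>j\<in>UNIV. ?a j m * sff l k j)"
      using codazzi[OF q a, of "X l q" k "X m q"] unfolding s by (simp add: sum_distrib_left mult_ac)
    then show ?thesis using r0 by simp
  qed
  have a1: "?a 1 3 = 0" "?a 2 3 = 0" "?a 1 4 = 0" "?a 2 4 = 0"
    using c[of 3 1 1] c[of 3 1 2] c[of 4 1 1] c[of 4 1 2] by (simp_all add: sum_4 sff_def)
  have a2: "?a 1 2 = - ?a 2 1" "?a 2 2 = ?a 1 1"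
    using c[of 2 1 1] c[of 2 1 2] by (simp_all add: sum_4 sff_def)
  have a3: "?a 1 2 = ?a 2 1" by (rule integrable[OF q a])
  have "\<partial> (E a) q u \<bullet> E j q = (\<Sum>m\<in>UNIV. (\<partial> G q u \<bullet> E m q) * ?a j m)" for j
    using arg_cong[OF frame_derivative_expansion[OF q E_smooth, of a u], of "\<lambda>x. x \<bullet> E j q"]
    by (simp add: inner_sum_left)
  from this[of i] show ?thesis
    using i a1 a2 a3 by (auto simp: sum_4 curv_def)
qed

end

section \<open>The constant real plane\<close>

context adapted_legendrian
begin

lemma curv_smooth: "smooth_on B (curv a)"
  unfolding curv_def[abs_def]
  by (intro smooth_on_inner B_open E_smooth smooth_on_directional_derivative_along X)

text \<open>A vector in the real span of \<open>G, E 3, E 4\<close> whose orthogonal complement in that span is the plane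
  that turns out to be constant.\<close>

definition normal :: "real^4 \<Rightarrow> complex^5" where
  "normal p = G p + curv 3 p *\<^sub>R E 3 p + curv 4 p *\<^sub>R E 4 p"

text \<open>Membership in the real span of \<open>G, E 3, E 4\<close>, in the form in which it is checked. The next
  predicate is membership in the plane.\<close>

definition in_V :: "real^4 \<Rightarrow> complex^5 \<Rightarrow> bool" where
  "in_V q x \<longleftrightarrow> x \<bullet> E 1 q = 0 \<and> x \<bullet> E 2 q = 0 \<and> (\<forall>k. x \<bullet> J (E k q) = 0) \<and> x \<bullet> J (G q) = 0"

definition in_V0 :: "real^4 \<Rightarrow> complex^5 \<Rightarrow> bool" where
  "in_V0 q x \<longleftrightarrow> in_V q x \<and> x \<bullet> normal q = 0"

lemma in_V_add: "in_V q x \<Longrightarrow> in_V q y \<Longrightarrow> in_V q (x + y)"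
  and in_V_scale: "in_V q x \<Longrightarrow> in_V q (c *\<^sub>R x)"
  and in_V_diff: "in_V q x \<Longrightarrow> in_V q y \<Longrightarrow> in_V q (x - y)"
  by (simp_all add: in_V_def inner_add_left inner_diff_left)

lemma in_V0_add: "in_V0 q x \<Longrightarrow> in_V0 q y \<Longrightarrow> in_V0 q (x + y)"
  and in_V0_scale: "in_V0 q x \<Longrightarrow> in_V0 q (c *\<^sub>R x)"
  by (simp_all add: in_V0_def in_V_add in_V_scale inner_add_left)

lemma V_expansion:
  assumes q: "q \<in> B" and x: "in_V q x"
  shows "x = (x \<bullet> G q) *\<^sub>R G q + (x \<bullet> E 3 q) *\<^sub>R E 3 q + (x \<bullet> E 4 q) *\<^sub>R E 4 q"
proof -
  have z: "x \<bullet> E 1 q = 0" "x \<bullet> E 2 q = 0" "x \<bullet> J (E k q) = 0" "x \<bullet> J (G q) = 0" for k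
    using x by (auto simp: in_V_def)
  show ?thesis using frame_expansion[OF q, of x] by (simp add: z sum_4 add.assoc)
qed

lemma in_V_basis: assumes "q \<in> B" "a \<in> {3, 4}" shows "in_V q (G q)" "in_V q (E a q)"
  using assms(2) by (auto simp: in_V_def G_E[OF assms(1)] E_JG[OF assms(1)] E_JE[OF assms(1)]
    E_E[OF assms(1)] inner_J_self)

text \<open>For \<open>a = 3, 4\<close> these vectors form a basis of the plane. In the model it is the plane of the
  two real coordinates.\<close>

definition spine :: "4 \<Rightarrow> real^4 \<Rightarrow> complex^5" where
  "spine a p = E a p - curv a p *\<^sub>R G p"

lemma spine_smooth: "smooth_on B (spine a)"
  unfolding spine_def[abs_def] by (intro smooth_on_diff smooth_on_scaleR B_open E_smooth G_smooth curv_smooth)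

lemma spine_in_V0: assumes q: "q \<in> B" and a: "a \<in> {3, 4}" shows "in_V0 q (spine a q)"
  unfolding in_V0_def
proof
  show "in_V q (spine a q)" unfolding spine_def by (intro in_V_diff in_V_scale in_V_basis[OF q a])
  show "spine a q \<bullet> normal q = 0"
    using a by (auto simp: spine_def normal_def inner_diff_left inner_add_right G_E[OF q] G_G[OF q] E_E[OF q])
qed

lemma spine_derivative:
  assumes q: "q \<in> B"
  shows "\<partial> (spine a) q u = \<partial> (E a) q u - (curv a q *\<^sub>R \<partial> G q u + \<partial> (curv a) q u *\<^sub>R G q)"
  unfolding spine_def[abs_def]
  by (rule fun_cong[OF directional_derivative_eq[OF has_derivative_diff[OF smooth_on_has_derivative[OF E_smooth q]
    has_derivative_scaleR[OF smooth_on_has_derivative[OF curv_smooth q] smooth_on_has_derivative[OF G_smooth q]]]]])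

text \<open>The multiple of \<open>G\<close> in the definition is chosen to cancel the components along \<open>E 1\<close> and \<open>E 2\<close>.\<close>

lemma spine_derivative_in_V:
  assumes q: "q \<in> B" and a: "a \<in> {3, 4}" shows "in_V q (\<partial> (spine a) q u)"
  using umbilical[OF q a, of 1 u] umbilical[OF q a, of 2 u]
  by (simp add: in_V_def spine_derivative[OF q] inner_diff_left inner_add_left dE34_JE[OF q a] dE_JG[OF q]
      dG_JE[OF q] G_E[OF q] E_JG[OF q] JG_dG[OF q] inner_J_self)

text \<open>Differentiate the equation \<open>\<partial> (spine a) p u \<bullet> E i p = 0\<close> for \<open>i = 1, 2\<close>. By the symmetry of second
  derivatives, \<open>(\<partial> (spine a) q u \<bullet> normal q) * (\<partial> G q w \<bullet> E i q)\<close> is symmetric in \<open>u\<close> and \<open>w\<close>. Since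
  there are two directions \<open>X 1\<close> and \<open>X 2\<close> to choose from, the first factor must vanish.\<close>

lemma spine_derivative_in_V0:
  assumes q: "q \<in> B" and a: "a \<in> {3, 4}" shows "in_V0 q (\<partial> (spine a) q u)"
proof -
  let ?f = "\<lambda>u. \<partial> (spine a) q u"
  have key: "?f u \<bullet> \<partial> (E i) q w = - ((?f u \<bullet> normal q) * (\<partial> G q w \<bullet> E i q))" if i: "i \<in> {1, 2}" for i u w
  proof -
    have G: "G q \<bullet> \<partial> (E i) q w = - (\<partial> G q w \<bullet> E i q)" using dE_G[OF q, of i w] by (simp add: inner_commute)
    have E: "E b q \<bullet> \<partial> (E i) q w = - (curv b q * (\<partial> G q w \<bullet> E i q))" if "b \<in> {3, 4}" for b
      using dE_E[OF q, of i w b] umbilical[OF q that i, of w] by (simp add: inner_commute)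
    have "?f u \<bullet> \<partial> (E i) q w = (?f u \<bullet> G q) * (G q \<bullet> \<partial> (E i) q w)
        + (?f u \<bullet> E 3 q) * (E 3 q \<bullet> \<partial> (E i) q w) + (?f u \<bullet> E 4 q) * (E 4 q \<bullet> \<partial> (E i) q w)"
      using arg_cong[OF V_expansion[OF q spine_derivative_in_V[OF q a]], of "\<lambda>x. x \<bullet> \<partial> (E i) q w" u]
      by (simp add: inner_add_left)
    then show ?thesis by (simp add: G E normal_def inner_add_right algebra_simps)
  qed
  have sym: "(?f u \<bullet> normal q) * (\<partial> G q w \<bullet> E i q) = (?f w \<bullet> normal q) * (\<partial> G q u \<bullet> E i q)"
    if i: "i \<in> {1, 2}" for i u w
  proof -
    have "\<partial> (\<lambda>p. \<partial> (spine a) p u) q w \<bullet> E i q = - (?f u \<bullet> \<partial> (E i) q w)" for u w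
      by (rule constant_inner_derivative[OF B_open q smooth_on_directional_derivative[OF spine_smooth] E_smooth, of _ _ _ 0])
        (use spine_derivative_in_V[OF _ a] i in \<open>auto simp: in_V_def\<close>)
    then have "\<partial> (\<lambda>p. \<partial> (spine a) p u) q w \<bullet> E i q = (?f u \<bullet> normal q) * (\<partial> G q w \<bullet> E i q)" for u w
      by (simp add: key[OF i])
    from this[of u w] this[of w u] show ?thesis
      using second_derivative_symmetric[OF B_open q spine_smooth, of a u w] by simp
  qed
  have dX: "\<partial> G q (X m q) \<bullet> E k q = (if m = k then 1 else 0)" for m k
    using E_E[OF q, of m k] by (simp add: E_def)
  have "?f (X 1 q) \<bullet> normal q = 0" using sym[of 2 "X 1 q" "X 2 q"] by (simp add: dX)
  then have "?f u \<bullet> normal q = 0" using sym[of 1 u "X 1 q"] by (simp add: dX)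
  then show ?thesis using spine_derivative_in_V[OF q a] by (simp add: in_V0_def)
qed

definition section_of_V0 :: "(real^4 \<Rightarrow> complex^5) \<Rightarrow> bool" where
  "section_of_V0 s \<longleftrightarrow> smooth_on B s \<and> (\<forall>q\<in>B. in_V0 q (s q) \<and> (\<forall>u. in_V0 q (\<partial> s q u)))"

lemma section_of_V0_add:
  assumes "section_of_V0 s" "section_of_V0 t" shows "section_of_V0 (\<lambda>p. s p + t p)"
proof -
  have s: "smooth_on B s" "smooth_on B t" using assms by (auto simp: section_of_V0_def)
  have "\<partial> (\<lambda>p. s p + t p) q u = \<partial> s q u + \<partial> t q u" if "q \<in> B" for q u
    by (rule fun_cong[OF directional_derivative_eq[OF has_derivative_add[OF smooth_on_has_derivative[OF s(1) that]
      smooth_on_has_derivative[OF s(2) that]]]])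
  then show ?thesis using assms smooth_on_add[OF B_open s] by (simp add: section_of_V0_def in_V0_add)
qed

lemma section_of_V0_scale:
  assumes c: "smooth_on B c" and "section_of_V0 s" shows "section_of_V0 (\<lambda>p. c p *\<^sub>R s p)"
proof -
  have s: "smooth_on B s" using assms by (auto simp: section_of_V0_def)
  have "\<partial> (\<lambda>p. c p *\<^sub>R s p) q u = c q *\<^sub>R \<partial> s q u + \<partial> c q u *\<^sub>R s q" if "q \<in> B" for q u
    by (rule fun_cong[OF directional_derivative_eq[OF has_derivative_scaleR[OF smooth_on_has_derivative[OF c that]
      smooth_on_has_derivative[OF s that]]]])
  then show ?thesis
    using assms smooth_on_scaleR[OF B_open c s] by (simp add: section_of_V0_def in_V0_add in_V0_scale)
qed

lemma spine_section: "a \<in> {3, 4} \<Longrightarrow> section_of_V0 (spine a)"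
  using spine_smooth spine_in_V0 spine_derivative_in_V0 by (simp add: section_of_V0_def)

lemma spine_spans_V0:
  assumes q: "q \<in> B" and x: "in_V0 q x"
  shows "x = (x \<bullet> E 3 q) *\<^sub>R spine 3 q + (x \<bullet> E 4 q) *\<^sub>R spine 4 q"
proof -
  have g: "x \<bullet> G q = - (curv 3 q * (x \<bullet> E 3 q)) - curv 4 q * (x \<bullet> E 4 q)"
    using x by (simp add: in_V0_def normal_def inner_add_right)
  have "in_V q x" using x by (simp add: in_V0_def)
  from V_expansion[OF q this] show ?thesis
    unfolding g spine_def by (simp add: algebra_simps)
qed

text \<open>The orthonormalization of the two basis vectors. Its steps preserve the property that values and
  derivatives lie in the plane.\<close>

lemma orthonormal_sections:
  obtains e f where "section_of_V0 e" "section_of_V0 f"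
    "\<And>q. q \<in> B \<Longrightarrow> e q \<bullet> e q = 1" "\<And>q. q \<in> B \<Longrightarrow> f q \<bullet> f q = 1" "\<And>q. q \<in> B \<Longrightarrow> e q \<bullet> f q = 0"
    "\<And>q x. q \<in> B \<Longrightarrow> in_V0 q x \<Longrightarrow> x = (x \<bullet> e q) *\<^sub>R e q + (x \<bullet> f q) *\<^sub>R f q"
proof -
  define e where "e p = inverse (norm (spine 3 p)) *\<^sub>R spine 3 p" for p
  define k where "k p = spine 4 p \<bullet> e p" for p
  define g where "g p = spine 4 p + (- k p) *\<^sub>R e p" for p
  define f where "f p = inverse (norm (g p)) *\<^sub>R g p" for p
  have s3: "spine 3 p \<noteq> 0" if "p \<in> B" for p
  proof -
    have "spine 3 p \<bullet> E 3 p = 1" by (simp add: spine_def inner_diff_left E_E[OF that] G_E[OF that])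
    then show ?thesis by auto
  qed
  have g0: "g p \<noteq> 0" if "p \<in> B" for p
  proof -
    have "g p \<bullet> E 4 p = 1"
      by (simp add: g_def e_def spine_def inner_diff_left inner_add_left E_E[OF that] G_E[OF that])
    then show ?thesis by auto
  qed
  have e: "section_of_V0 e"
    unfolding e_def[abs_def]
    by (intro section_of_V0_scale spine_section smooth_on_inverse smooth_on_norm B_open spine_smooth) (auto simp: s3)
  then have es: "smooth_on B e" by (simp add: section_of_V0_def)
  have g: "section_of_V0 g"
    unfolding g_def[abs_def] k_def
    by (intro section_of_V0_add section_of_V0_scale spine_section e smooth_on_minus smooth_on_inner B_open spine_smooth es) auto
  then have gs: "smooth_on B g" by (simp add: section_of_V0_def)
  have f: "section_of_V0 f"
    unfolding f_def[abs_def]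
    by (intro section_of_V0_scale g smooth_on_inverse smooth_on_norm B_open gs) (auto simp: g0)
  have ee: "e p \<bullet> e p = 1" if "p \<in> B" for p
    using s3[OF that] by (simp add: e_def dot_square_norm power2_eq_square)
  have ff: "f p \<bullet> f p = 1" if "p \<in> B" for p
    using g0[OF that] by (simp add: f_def dot_square_norm power2_eq_square)
  have ge: "e p \<bullet> g p = 0" if "p \<in> B" for p
    using ee[OF that] by (simp add: g_def k_def inner_diff_right inner_commute)
  then have ef: "e p \<bullet> f p = 0" if "p \<in> B" for p using that by (simp add: f_def)
  have span: "x = (x \<bullet> e q) *\<^sub>R e q + (x \<bullet> f q) *\<^sub>R f q" if q: "q \<in> B" and x: "in_V0 q x" for q x
  proof -
    have "spine 3 q = norm (spine 3 q) *\<^sub>R e q" using s3[OF q] by (simp add: e_def)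
    then obtain n where n: "spine 3 q = n *\<^sub>R e q" by blast
    have m: "spine 4 q = norm (g q) *\<^sub>R f q + k q *\<^sub>R e q" using g0[OF q] by (simp add: f_def g_def)
    have "x = (x \<bullet> E 3 q) *\<^sub>R (n *\<^sub>R e q) + (x \<bullet> E 4 q) *\<^sub>R (norm (g q) *\<^sub>R f q + k q *\<^sub>R e q)"
      by (rule spine_spans_V0[OF q x, unfolded n m])
    also have "\<dots> = ((x \<bullet> E 3 q) * n + (x \<bullet> E 4 q) * k q) *\<^sub>R e q + ((x \<bullet> E 4 q) * norm (g q)) *\<^sub>R f q"
      by (simp add: algebra_simps)
    finally obtain \<alpha> \<beta> where "x = \<alpha> *\<^sub>R e q + \<beta> *\<^sub>R f q" by blast
    then show ?thesis
      using ee[OF q] ff[OF q] ef[OF q] by (simp add: inner_add_left inner_commute[of "f q" "e q"])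
  qed
  show thesis by (rule that[OF e f ee ff ef span])
qed

text \<open>An orthonormal basis \<open>e, f\<close> of the plane with derivatives in the plane only rotates, so the
  orthogonal projection to the plane has derivative zero.\<close>

lemma constant_plane:
  assumes q0: "q0 \<in> B"
  obtains e4 e5 where "e4 \<bullet> e4 = 1" "e5 \<bullet> e5 = 1" "e4 \<bullet> e5 = 0"
    "\<And>q. q \<in> B \<Longrightarrow> in_V0 q e4" "\<And>q. q \<in> B \<Longrightarrow> in_V0 q e5"
    "\<And>q x. q \<in> B \<Longrightarrow> in_V0 q x \<Longrightarrow> x = (x \<bullet> e4) *\<^sub>R e4 + (x \<bullet> e5) *\<^sub>R e5"
proof -
  obtain e f where e: "section_of_V0 e" and f: "section_of_V0 f"
    and ee: "\<And>q. q \<in> B \<Longrightarrow> e q \<bullet> e q = 1" and ff: "\<And>q. q \<in> B \<Longrightarrow> f q \<bullet> f q = 1"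
    and ef: "\<And>q. q \<in> B \<Longrightarrow> e q \<bullet> f q = 0"
    and span: "\<And>q x. q \<in> B \<Longrightarrow> in_V0 q x \<Longrightarrow> x = (x \<bullet> e q) *\<^sub>R e q + (x \<bullet> f q) *\<^sub>R f q"
    using orthonormal_sections by blast
  have es: "smooth_on B e" and fs: "smooth_on B f" using e f by (auto simp: section_of_V0_def)
  have eV: "in_V0 q (e q)" "in_V0 q (f q)" if "q \<in> B" for q using e f that by (auto simp: section_of_V0_def)
  define P where "P y q = (y \<bullet> e q) *\<^sub>R e q + (y \<bullet> f q) *\<^sub>R f q" for y q
  have "(P y has_derivative (\<lambda>u. 0)) (at q within B)" if q: "q \<in> B" for y q
  proof -
    note de = smooth_on_has_derivative[OF es q] and df = smooth_on_has_derivative[OF fs q]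
    have ed: "\<partial> e q u = (\<partial> e q u \<bullet> f q) *\<^sub>R f q" and fd: "\<partial> f q u = - (\<partial> e q u \<bullet> f q) *\<^sub>R e q" for u
    proof -
      have "\<partial> e q u \<bullet> e q = 0" "\<partial> f q u \<bullet> f q = 0"
        using constant_inner_derivative[OF B_open q es es ee, of u] constant_inner_derivative[OF B_open q fs fs ff, of u]
        by (simp_all add: inner_commute)
      moreover have "\<partial> f q u \<bullet> e q = - (\<partial> e q u \<bullet> f q)"
        using constant_inner_derivative[OF B_open q es fs ef, of u] by (simp add: inner_commute)
      moreover have "in_V0 q (\<partial> e q u)" "in_V0 q (\<partial> f q u)" using e f q by (auto simp: section_of_V0_def)
      ultimately show "\<partial> e q u = (\<partial> e q u \<bullet> f q) *\<^sub>R f q" "\<partial> f q u = - (\<partial> e q u \<bullet> f q) *\<^sub>R e q"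
        using span[OF q, of "\<partial> e q u"] span[OF q, of "\<partial> f q u"] by auto
    qed
    have "(P y has_derivative (\<lambda>u. ((y \<bullet> e q) *\<^sub>R \<partial> e q u + (y \<bullet> \<partial> e q u) *\<^sub>R e q)
        + ((y \<bullet> f q) *\<^sub>R \<partial> f q u + (y \<bullet> \<partial> f q u) *\<^sub>R f q))) (at q)"
      unfolding P_def[abs_def]
      by (intro has_derivative_add has_derivative_scaleR has_derivative_inner_right de df)
    moreover have "((y \<bullet> e q) *\<^sub>R \<partial> e q u + (y \<bullet> \<partial> e q u) *\<^sub>R e q) + ((y \<bullet> f q) *\<^sub>R \<partial> f q u + (y \<bullet> \<partial> f q u) *\<^sub>R f q) = 0" for u
    proof -
      obtain c where "\<partial> e q u = c *\<^sub>R f q" "\<partial> f q u = (- c) *\<^sub>R e q" using ed[of u] fd[of u] by metis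
      then show ?thesis by (simp add: algebra_simps)
    qed
    ultimately show ?thesis by (simp add: has_derivative_at_withinI)
  qed
  from has_derivative_zero_constant[OF conv this]
  have P: "P y q = P y q0" if "q \<in> B" for y q using q0 that by metis
  show thesis
  proof (rule that[of "e q0" "f q0"])
    show "e q0 \<bullet> e q0 = 1" "f q0 \<bullet> f q0 = 1" "e q0 \<bullet> f q0 = 0" using ee ff ef q0 by auto
    fix q assume q: "q \<in> B"
    have PV: "in_V0 q (P y q)" for y unfolding P_def by (intro in_V0_add in_V0_scale eV q)
    have "P (e q0) q0 = e q0" "P (f q0) q0 = f q0"
      using ee[OF q0] ff[OF q0] ef[OF q0] by (simp_all add: P_def inner_commute)
    then show "in_V0 q (e q0)" "in_V0 q (f q0)" using PV[of "e q0"] PV[of "f q0"] P[OF q] by metis+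
    show "x = (x \<bullet> e q0) *\<^sub>R e q0 + (x \<bullet> f q0) *\<^sub>R f q0" if "in_V0 q x" for x
      using span[OF q that] P[OF q, of x] by (simp add: P_def)
  qed
qed

end

section \<open>Splitting of the lift\<close>

context adapted_legendrian
begin

text \<open>The real span of \<open>G, E 3, E 4\<close> is totally real, as these vectors belong to a unitary basis.\<close>

lemma in_V_J: assumes q: "q \<in> B" and "in_V q x" "in_V q y" shows "x \<bullet> J y = 0"
proof -
  have y: "G q \<bullet> J y = 0" "E k q \<bullet> J y = 0" for k
    using assms(3) J_inner[of y "G q"] J_inner[of y "E k q"]
    by (simp_all add: in_V_def inner_commute)
  show ?thesis
    using arg_cong[OF V_expansion[OF q assms(2)], of "\<lambda>x. x \<bullet> J y"] by (simp add: inner_add_left y)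
qed

text \<open>The component \<open>H\<close> of \<open>G\<close> orthogonal to the plane lies in \<open>V\<close>, and the complement of the plane in
  \<open>V\<close> is a line. Up to the components along \<open>E 1\<close> and \<open>E 2\<close>, the derivative of \<open>H\<close> lies in this line
  as well, so for the unit vector \<open>\<phi>\<close> only these components remain. A tangent vector with no
  components along \<open>E 1\<close>, \<open>E 2\<close> and the plane is mapped into the line, which is not tangent to the
  sphere; this is the last conclusion.\<close>

theorem splitting:
  assumes q0: "q0 \<in> B"
  obtains e4 e5 \<phi> \<rho> where
    "e4 \<bullet> e4 = 1" "e5 \<bullet> e5 = 1" "e4 \<bullet> e5 = 0" "e4 \<bullet> J e5 = 0" "smooth_on B \<phi>" "smooth_on B \<rho>"
    "\<And>q. q \<in> B \<Longrightarrow> G q = \<rho> q *\<^sub>R \<phi> q + (G q \<bullet> e4) *\<^sub>R e4 + (G q \<bullet> e5) *\<^sub>R e5"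
    "\<And>q. q \<in> B \<Longrightarrow> \<rho> q > 0 \<and> (\<rho> q)\<^sup>2 = 1 - (G q \<bullet> e4)\<^sup>2 - (G q \<bullet> e5)\<^sup>2"
    "\<And>q. q \<in> B \<Longrightarrow> \<phi> q \<bullet> \<phi> q = 1 \<and> \<phi> q \<bullet> e4 = 0 \<and> \<phi> q \<bullet> e5 = 0 \<and> \<phi> q \<bullet> J e4 = 0 \<and> \<phi> q \<bullet> J e5 = 0"
    "\<And>q i. q \<in> B \<Longrightarrow> i \<in> {1, 2} \<Longrightarrow> \<phi> q \<bullet> E i q = 0 \<and> \<phi> q \<bullet> J (E i q) = 0 \<and>
       E i q \<bullet> e4 = 0 \<and> E i q \<bullet> e5 = 0 \<and> E i q \<bullet> J e4 = 0 \<and> E i q \<bullet> J e5 = 0"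
    "\<And>q u. q \<in> B \<Longrightarrow> \<partial> \<phi> q u = inverse (\<rho> q) *\<^sub>R ((\<partial> G q u \<bullet> E 1 q) *\<^sub>R E 1 q + (\<partial> G q u \<bullet> E 2 q) *\<^sub>R E 2 q)"
    "\<And>q u. q \<in> B \<Longrightarrow> \<partial> G q u \<bullet> E 1 q = 0 \<Longrightarrow> \<partial> G q u \<bullet> E 2 q = 0 \<Longrightarrow>
       \<partial> G q u \<bullet> e4 = 0 \<Longrightarrow> \<partial> G q u \<bullet> e5 = 0 \<Longrightarrow> u = 0"
proof -
  obtain e4 e5 where e: "e4 \<bullet> e4 = 1" "e5 \<bullet> e5 = 1" "e4 \<bullet> e5 = 0"
    and e0: "\<And>q. q \<in> B \<Longrightarrow> in_V0 q e4" "\<And>q. q \<in> B \<Longrightarrow> in_V0 q e5"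
    and span: "\<And>q x. q \<in> B \<Longrightarrow> in_V0 q x \<Longrightarrow> x = (x \<bullet> e4) *\<^sub>R e4 + (x \<bullet> e5) *\<^sub>R e5"
    using constant_plane[OF q0] by blast
  have eV: "in_V q e4" "in_V q e5" if "q \<in> B" for q using e0[OF that] by (auto simp: in_V0_def)
  have ee: "e5 \<bullet> e4 = 0" using e(3) by (simp add: inner_commute)
  define H where "H q = G q - (G q \<bullet> e4) *\<^sub>R e4 - (G q \<bullet> e5) *\<^sub>R e5" for q
  define \<rho> where "\<rho> q = norm (H q)" for q
  define \<phi> where "\<phi> q = inverse (\<rho> q) *\<^sub>R H q" for q
  \<comment> \<open>any index in \<open>{3, 4}\<close> serves for the side condition on \<open>a\<close>\<close>
  have HV: "in_V q (H q)" if "q \<in> B" for q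
    unfolding H_def by (intro in_V_diff in_V_scale eV that in_V_basis(1)[of _ 3]) simp
  have He: "H q \<bullet> e4 = 0" "H q \<bullet> e5 = 0" for q
    by (simp_all add: H_def inner_diff_left e ee)
  have HG: "H q \<bullet> G q = 1 - (G q \<bullet> e4)\<^sup>2 - (G q \<bullet> e5)\<^sup>2" if "q \<in> B" for q
    by (simp add: H_def inner_diff_left inner_diff_right G_G[OF that] power2_eq_square inner_commute)
  have HH: "H q \<bullet> H q = H q \<bullet> G q" for q
    using He[of q] by (subst (2) H_def) (simp add: inner_diff_right)
  have H0: "H q \<noteq> 0" if q: "q \<in> B" for q
  proof
    assume "H q = 0"
    then have "G q = (G q \<bullet> e4) *\<^sub>R e4 + (G q \<bullet> e5) *\<^sub>R e5" by (simp add: H_def algebra_simps)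
    from arg_cong[OF this, of "\<lambda>x. x \<bullet> normal q"]
    have "G q \<bullet> normal q = 0" using e0[OF q] by (simp add: in_V0_def inner_add_left)
    then show False by (simp add: normal_def inner_add_right G_G[OF q] G_E[OF q])
  qed
  have \<rho>0: "\<rho> q > 0" if "q \<in> B" for q using H0[OF that] by (simp add: \<rho>_def)
  have \<rho>2: "(\<rho> q)\<^sup>2 = H q \<bullet> G q" for q by (simp add: \<rho>_def power2_norm_eq_inner HH)
  have Hs: "smooth_on B H"
    unfolding H_def[abs_def]
    by (intro smooth_on_diff smooth_on_scaleR smooth_on_inner smooth_on_const B_open G_smooth)
  have \<rho>s: "smooth_on B \<rho>" unfolding \<rho>_def[abs_def] by (rule smooth_on_norm[OF B_open Hs H0])
  have \<rho>is: "smooth_on B (\<lambda>q. inverse (\<rho> q))" by (rule smooth_on_inverse[OF B_open \<rho>s]) (use \<rho>0 in force)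
  have \<phi>s: "smooth_on B \<phi>" unfolding \<phi>_def[abs_def] by (rule smooth_on_scaleR[OF B_open \<rho>is Hs])
  have \<phi>V: "in_V q (\<phi> q)" if "q \<in> B" for q unfolding \<phi>_def by (intro in_V_scale HV that)
  have \<phi>\<phi>: "\<phi> q \<bullet> \<phi> q = 1" if "q \<in> B" for q
  proof -
    have "H q \<bullet> H q = \<rho> q * \<rho> q" using \<rho>2[of q] HH[of q] by (simp add: power2_eq_square)
    then show ?thesis using \<rho>0[OF that] by (simp add: \<phi>_def field_simps)
  qed
  have parallel: "\<exists>c. x = c *\<^sub>R H q \<and> c * (H q \<bullet> G q) = x \<bullet> G q"
    if q: "q \<in> B" and x: "in_V q x" "x \<bullet> e4 = 0" "x \<bullet> e5 = 0" for q x
  proof -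
    have n: "y = (y \<bullet> G q) *\<^sub>R normal q" if y: "in_V q y" "y \<bullet> e4 = 0" "y \<bullet> e5 = 0" for y
    proof -
      have "y \<bullet> spine a q = 0" if a: "a \<in> {3, 4}" for a
        by (subst span[OF q spine_in_V0[OF q a]]) (simp add: inner_add_right y)
      then have "y \<bullet> E 3 q = curv 3 q * (y \<bullet> G q)" "y \<bullet> E 4 q = curv 4 q * (y \<bullet> G q)"
        by (simp_all add: spine_def inner_diff_right)
      then have "y = (y \<bullet> G q) *\<^sub>R G q + (curv 3 q * (y \<bullet> G q)) *\<^sub>R E 3 q + (curv 4 q * (y \<bullet> G q)) *\<^sub>R E 4 q"
        using V_expansion[OF q y(1)] by simp
      also have "\<dots> = (y \<bullet> G q) *\<^sub>R normal q" by (simp add: normal_def scaleR_add_right mult.commute)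
      finally show ?thesis .
    qed
    have HG0: "H q \<bullet> G q \<noteq> 0" using \<rho>2[of q] \<rho>0[OF q] by auto
    \<comment> \<open>both vectors are multiples of \<open>normal q\<close>\<close>
    define c where "c = (x \<bullet> G q) / (H q \<bullet> G q)"
    have "c *\<^sub>R H q = (c * (H q \<bullet> G q)) *\<^sub>R normal q" using n[OF HV[OF q] He] by (metis scaleR_scaleR)
    also have "\<dots> = x" using n[OF x] HG0 by (simp add: c_def)
    finally show ?thesis using HG0 by (intro exI[of _ c]) (simp add: c_def)
  qed
  have E12: "E i q \<bullet> y = 0" "E i q \<bullet> J y = 0" "y \<bullet> E i q = 0" "y \<bullet> J (E i q) = 0"
    if q: "q \<in> B" and y: "in_V q y" and i: "i \<in> {1, 2}" for q y i
    using y i J_inner[of y "E i q"] by (auto simp: in_V_def inner_commute)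
  have d\<phi>: "\<partial> \<phi> q u = inverse (\<rho> q) *\<^sub>R ((\<partial> G q u \<bullet> E 1 q) *\<^sub>R E 1 q + (\<partial> G q u \<bullet> E 2 q) *\<^sub>R E 2 q)"
    if q: "q \<in> B" for q u
  proof -
    define t where "t = (\<partial> G q u \<bullet> E 1 q) *\<^sub>R E 1 q + (\<partial> G q u \<bullet> E 2 q) *\<^sub>R E 2 q"
    have te: "t \<bullet> e4 = 0" "t \<bullet> e5 = 0" "t \<bullet> \<phi> q = 0"
      by (simp_all add: t_def inner_add_left E12[OF q eV(1)[OF q]] E12[OF q eV(2)[OF q]] E12[OF q \<phi>V[OF q]])
    have dH: "\<partial> H q u = \<partial> G q u - (\<partial> G q u \<bullet> e4) *\<^sub>R e4 - (\<partial> G q u \<bullet> e5) *\<^sub>R e5"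
    proof -
      have "(H has_derivative (\<lambda>u. \<partial> G q u - (\<partial> G q u \<bullet> e4) *\<^sub>R e4 - (\<partial> G q u \<bullet> e5) *\<^sub>R e5)) (at q)"
        unfolding H_def[abs_def] using smooth_on_has_derivative[OF G_smooth q]
        by (auto intro!: derivative_eq_intros)
      then show ?thesis by (simp add: directional_derivative_eq)
    qed
    have "\<partial> H q u - t = (\<partial> G q u \<bullet> E 3 q) *\<^sub>R E 3 q + (\<partial> G q u \<bullet> E 4 q) *\<^sub>R E 4 q
        - (\<partial> G q u \<bullet> e4) *\<^sub>R e4 - (\<partial> G q u \<bullet> e5) *\<^sub>R e5"
      using dG_expansion[OF q, of u] unfolding dH t_def sum_4 by (simp add: algebra_simps)
    moreover have "in_V q \<dots>"
      by (intro in_V_diff in_V_add in_V_scale in_V_basis(2) eV q) simp_all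
    ultimately have "in_V q (\<partial> H q u - t)" by simp
    moreover have "(\<partial> H q u - t) \<bullet> e4 = 0" "(\<partial> H q u - t) \<bullet> e5 = 0"
      by (simp_all add: inner_diff_left te dH e ee)
    ultimately obtain c where "\<partial> H q u - t = c *\<^sub>R H q" using parallel[OF q] by blast
    then have c: "\<partial> H q u = t + c *\<^sub>R H q" by (simp add: algebra_simps)
    have "(\<phi> has_derivative (\<lambda>u. inverse (\<rho> q) *\<^sub>R \<partial> H q u + \<partial> (\<lambda>q. inverse (\<rho> q)) q u *\<^sub>R H q)) (at q)"
      unfolding \<phi>_def[abs_def]
      by (rule has_derivative_scaleR[OF smooth_on_has_derivative[OF \<rho>is q] smooth_on_has_derivative[OF Hs q]])
    then have "\<partial> \<phi> q u = inverse (\<rho> q) *\<^sub>R \<partial> H q u + \<partial> (\<lambda>q. inverse (\<rho> q)) q u *\<^sub>R H q"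
      by (simp add: directional_derivative_eq)
    moreover have "H q = \<rho> q *\<^sub>R \<phi> q" using \<rho>0[OF q] by (simp add: \<phi>_def)
    ultimately obtain k where k: "\<partial> \<phi> q u = inverse (\<rho> q) *\<^sub>R t + k *\<^sub>R \<phi> q"
      unfolding c by (metis (no_types, lifting) add.assoc scaleR_add_left scaleR_add_right scaleR_scaleR)
    have "\<partial> \<phi> q u \<bullet> \<phi> q = 0"
      using constant_inner_derivative[OF B_open q \<phi>s \<phi>s \<phi>\<phi>, of u] by (simp add: inner_commute)
    then have "k = 0" by (simp add: k inner_add_left te \<phi>\<phi>[OF q])
    then show ?thesis using k by (simp add: t_def)
  qed
  show thesis
  proof (rule that[of e4 e5 \<phi> \<rho>])
    show "e4 \<bullet> e4 = 1" "e5 \<bullet> e5 = 1" "e4 \<bullet> e5 = 0" "smooth_on B \<phi>" "smooth_on B \<rho>" by fact+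
    show "e4 \<bullet> J e5 = 0" by (rule in_V_J[OF q0 eV[OF q0]])
    fix q assume q: "q \<in> B"
    show "G q = \<rho> q *\<^sub>R \<phi> q + (G q \<bullet> e4) *\<^sub>R e4 + (G q \<bullet> e5) *\<^sub>R e5"
      using \<rho>0[OF q] by (simp add: \<phi>_def H_def)
    show "\<rho> q > 0 \<and> (\<rho> q)\<^sup>2 = 1 - (G q \<bullet> e4)\<^sup>2 - (G q \<bullet> e5)\<^sup>2"
      using \<rho>0[OF q] \<rho>2 HG[OF q] by simp
    show "\<phi> q \<bullet> \<phi> q = 1 \<and> \<phi> q \<bullet> e4 = 0 \<and> \<phi> q \<bullet> e5 = 0 \<and> \<phi> q \<bullet> J e4 = 0 \<and> \<phi> q \<bullet> J e5 = 0"
      using \<phi>\<phi>[OF q] in_V_J[OF q \<phi>V[OF q] eV(1)[OF q]] in_V_J[OF q \<phi>V[OF q] eV(2)[OF q]]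
      by (simp add: \<phi>_def He)
    show "\<phi> q \<bullet> E i q = 0 \<and> \<phi> q \<bullet> J (E i q) = 0 \<and>
       E i q \<bullet> e4 = 0 \<and> E i q \<bullet> e5 = 0 \<and> E i q \<bullet> J e4 = 0 \<and> E i q \<bullet> J e5 = 0" if "i \<in> {1, 2}" for i
      using E12[OF q \<phi>V[OF q] that] E12[OF q eV(1)[OF q] that] E12[OF q eV(2)[OF q] that] by simp
    show "\<partial> \<phi> q u = inverse (\<rho> q) *\<^sub>R ((\<partial> G q u \<bullet> E 1 q) *\<^sub>R E 1 q + (\<partial> G q u \<bullet> E 2 q) *\<^sub>R E 2 q)" for u
      by (rule d\<phi>[OF q])
    show "u = 0" if u: "\<partial> G q u \<bullet> E 1 q = 0" "\<partial> G q u \<bullet> E 2 q = 0" "\<partial> G q u \<bullet> e4 = 0" "\<partial> G q u \<bullet> e5 = 0" for u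
    proof -
      have "in_V q (\<partial> G q u)" using u dG_JE[OF q] JG_dG[OF q] by (simp add: in_V_def)
      then obtain c where c: "\<partial> G q u = c *\<^sub>R H q" "c * (H q \<bullet> G q) = \<partial> G q u \<bullet> G q"
        using parallel[OF q _ u(3,4)] by blast
      have "\<partial> G q u \<bullet> G q = 0" using legendrian_orthogonal[OF leg q] by (simp add: inner_commute)
      then have "c = 0" using c(2) \<rho>2[of q] \<rho>0[OF q] by auto
      then have "\<partial> G q u = 0" using c(1) by simp
      then show ?thesis
        using legendrian_inj[OF leg q] linear_injective_0[OF legendrian_linear[OF leg q]] by blast
    qed
  qed
qed

end

section \<open>Coordinates in which the lift is a product\<close>

locale split_legendrian = adapted_legendrian B G X r E
  for B :: "(real^4) set" and G :: "real^4 \<Rightarrow> complex^5" and X r E +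
  fixes q0 :: "real^4" and e4 e5 :: "complex^5" and \<phi> :: "real^4 \<Rightarrow> complex^5" and \<rho> :: "real^4 \<Rightarrow> real"
  assumes q0: "q0 \<in> B"
    and ee: "e4 \<bullet> e4 = 1" "e5 \<bullet> e5 = 1" "e4 \<bullet> e5 = 0" "e4 \<bullet> J e5 = 0"
    and \<phi>_smooth: "smooth_on B \<phi>" and \<rho>_smooth: "smooth_on B \<rho>"
    and G_split: "\<And>q. q \<in> B \<Longrightarrow> G q = \<rho> q *\<^sub>R \<phi> q + (G q \<bullet> e4) *\<^sub>R e4 + (G q \<bullet> e5) *\<^sub>R e5"
    and \<rho>: "\<And>q. q \<in> B \<Longrightarrow> \<rho> q > 0 \<and> (\<rho> q)\<^sup>2 = 1 - (G q \<bullet> e4)\<^sup>2 - (G q \<bullet> e5)\<^sup>2"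
    and \<phi>_e: "\<And>q. q \<in> B \<Longrightarrow> \<phi> q \<bullet> \<phi> q = 1 \<and> \<phi> q \<bullet> e4 = 0 \<and> \<phi> q \<bullet> e5 = 0 \<and> \<phi> q \<bullet> J e4 = 0 \<and> \<phi> q \<bullet> J e5 = 0"
    and E_e: "\<And>q i. q \<in> B \<Longrightarrow> i \<in> {1, 2} \<Longrightarrow> \<phi> q \<bullet> E i q = 0 \<and> \<phi> q \<bullet> J (E i q) = 0 \<and>
       E i q \<bullet> e4 = 0 \<and> E i q \<bullet> e5 = 0 \<and> E i q \<bullet> J e4 = 0 \<and> E i q \<bullet> J e5 = 0"
    and d\<phi>: "\<And>q u. q \<in> B \<Longrightarrow>
       \<partial> \<phi> q u = inverse (\<rho> q) *\<^sub>R ((\<partial> G q u \<bullet> E 1 q) *\<^sub>R E 1 q + (\<partial> G q u \<bullet> E 2 q) *\<^sub>R E 2 q)"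
    and separating: "\<And>q u. q \<in> B \<Longrightarrow> \<partial> G q u \<bullet> E 1 q = 0 \<Longrightarrow> \<partial> G q u \<bullet> E 2 q = 0 \<Longrightarrow>
       \<partial> G q u \<bullet> e4 = 0 \<Longrightarrow> \<partial> G q u \<bullet> e5 = 0 \<Longrightarrow> u = 0"
begin

lemma ee': "e5 \<bullet> e4 = 0" "e5 \<bullet> J e4 = 0"
  using ee(3,4) J_inner[of e4 e5] by (simp_all add: inner_commute)

definition basis :: "5 \<Rightarrow> complex^5" where
  "basis i = (if i = 1 then \<phi> q0 else if i = 2 then E 1 q0 else if i = 3 then E 2 q0 else if i = 4 then e4 else e5)"

lemma basis_nth: "basis 1 = \<phi> q0" "basis 2 = E 1 q0" "basis 3 = E 2 q0" "basis 4 = e4" "basis 5 = e5"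
  by (simp_all add: basis_def)

lemma basis_orthonormal: "basis i \<bullet> basis j = (if i = j then 1 else 0)" "basis i \<bullet> J (basis j) = 0"
proof -
  have s: "e4 \<bullet> v = 0" "e5 \<bullet> v = 0" "e4 \<bullet> J v = 0" "e5 \<bullet> J v = 0"
    if "v \<bullet> e4 = 0" "v \<bullet> e5 = 0" "v \<bullet> J e4 = 0" "v \<bullet> J e5 = 0" for v
    using that J_inner[of v e4] J_inner[of v e5] by (simp_all add: inner_commute)
  note p = \<phi>_e[OF q0] and E1 = E_e[OF q0, of 1, simplified] and E2 = E_e[OF q0, of 2, simplified]
  have t: "E 1 q0 \<bullet> \<phi> q0 = 0" "E 2 q0 \<bullet> \<phi> q0 = 0" "E 1 q0 \<bullet> J (\<phi> q0) = 0" "E 2 q0 \<bullet> J (\<phi> q0) = 0"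
    using E1 E2 J_inner[of "\<phi> q0" "E 1 q0"] J_inner[of "\<phi> q0" "E 2 q0"] by (simp_all add: inner_commute)
  have "\<forall>i j. basis i \<bullet> basis j = (if i = j then 1 else 0)" "\<forall>i j. basis i \<bullet> J (basis j) = 0"
    unfolding forall_5 basis_nth
    using p E1 E2 t ee ee' s[of "\<phi> q0"] s[of "E 1 q0"] s[of "E 2 q0"] E_E[OF q0] E_JE[OF q0]
    by (simp_all add: inner_J_self)
  then show "basis i \<bullet> basis j = (if i = j then 1 else 0)" "basis i \<bullet> J (basis j) = 0" by blast+
qed

definition Q :: "complex^5^5" where "Q = hermitian_coefficients basis"

lemma unitary_Q: "unitary_matrix Q"
  unfolding Q_def using unitary_hermitian_coefficients[of basis] basis_orthonormal by blast

lemma Q_nth: "(Q *v x) $ i = Complex (x \<bullet> basis i) (x \<bullet> J (basis i))"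
  unfolding Q_def by (rule hermitian_coefficients_nth)

text \<open>The coordinates of the complement of \<open>e4\<close> and \<open>e5\<close>.\<close>

definition R :: "complex^5 \<Rightarrow> complex^3" where
  "R x = (\<chi> i. if i = 1 then (Q *v x) $ 1 else if i = 2 then (Q *v x) $ 2 else (Q *v x) $ 3)"

lemma R_nth: "R x $ 1 = (Q *v x) $ 1" "R x $ 2 = (Q *v x) $ 2" "R x $ 3 = (Q *v x) $ 3"
  by (simp_all add: R_def)

lemma linear_R: "linear R"
  by (rule linearI) (simp_all add: vec_eq_iff forall_3 R_nth Q_nth inner_add_left complex_eq_iff)

lemma bounded_linear_R: "bounded_linear R" using linear_R by (simp add: linear_conv_bounded_linear)

lemma R_J: "R (J x) = J (R x)"
  by (simp add: vec_eq_iff forall_3 R_nth Q_nth J_inner J_J complex_eq_iff)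

text \<open>Orthogonality to \<open>e4\<close> and \<open>e5\<close> for the Hermitian product.\<close>

definition spherical :: "complex^5 \<Rightarrow> bool" where
  "spherical y \<longleftrightarrow> y \<bullet> e4 = 0 \<and> y \<bullet> e5 = 0 \<and> y \<bullet> J e4 = 0 \<and> y \<bullet> J e5 = 0"

lemma spherical_J: "spherical y \<Longrightarrow> spherical (J y)"
  by (simp add: spherical_def J_inner J_J)

lemma spherical_add: "spherical x \<Longrightarrow> spherical y \<Longrightarrow> spherical (x + y)"
  and spherical_scale: "spherical x \<Longrightarrow> spherical (c *\<^sub>R x)"
  by (simp_all add: spherical_def inner_add_left)

lemma R_inner: assumes "spherical y" shows "R x \<bullet> R y = x \<bullet> y"
proof -
  have "x \<bullet> y = (\<Sum>i\<in>UNIV. (x \<bullet> basis i) * (y \<bullet> basis i) + (x \<bullet> J (basis i)) * (y \<bullet> J (basis i)))"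
    by (subst hermitian_basis_expansion[of basis y, OF basis_orthonormal])
      (simp add: inner_sum_right inner_add_right mult.commute)
  then show ?thesis
    using assms by (simp add: sum_5 basis_nth spherical_def inner_vec_def[of "R x"] sum_3 R_nth Q_nth inner_complex_def basis_nth)
qed

text \<open>Coordinates near \<open>q0\<close>. The last two are the components of \<open>G\<close> in the constant plane. The first two
  are two real components of \<open>\<phi>\<close>, chosen such that their differentials at \<open>q0\<close> are independent on the
  image of \<open>d\<phi>\<close>.\<close>

definition \<Phi> :: "real^4 \<Rightarrow> real^4" where
  "\<Phi> q = (\<chi> i. if i = 1 then \<phi> q \<bullet> E 1 q0 else if i = 2 then \<phi> q \<bullet> E 2 q0 else if i = 3 then G q \<bullet> e4 else G q \<bullet> e5)"

lemma \<Phi>_nth: "\<Phi> q $ 1 = \<phi> q \<bullet> E 1 q0" "\<Phi> q $ 2 = \<phi> q \<bullet> E 2 q0" "\<Phi> q $ 3 = G q \<bullet> e4" "\<Phi> q $ 4 = G q \<bullet> e5"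
  by (simp_all add: \<Phi>_def)

lemma \<Phi>_smooth: "smooth_on B \<Phi>"
proof -
  have "smooth_on B (\<lambda>q. if i = 1 then \<phi> q \<bullet> E 1 q0 else if i = 2 then \<phi> q \<bullet> E 2 q0
      else if i = 3 then G q \<bullet> e4 else G q \<bullet> e5)" for i :: 4
    using exhaust_4[of i]
    by (elim disjE) (simp_all add: smooth_on_inner smooth_on_const B_open \<phi>_smooth G_smooth)
  then show ?thesis unfolding \<Phi>_def[abs_def] by (rule smooth_on_vec_lambda[OF B_open])
qed

lemma \<Phi>_derivative:
  assumes q: "q \<in> B"
  shows "\<partial> \<Phi> q u $ 1 = \<partial> \<phi> q u \<bullet> E 1 q0" "\<partial> \<Phi> q u $ 2 = \<partial> \<phi> q u \<bullet> E 2 q0"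
    "\<partial> \<Phi> q u $ 3 = \<partial> G q u \<bullet> e4" "\<partial> \<Phi> q u $ 4 = \<partial> G q u \<bullet> e5"
  unfolding derivative_vec_nth[OF smooth_on_differentiable[OF \<Phi>_smooth q]] \<Phi>_nth
  by (simp_all add: directional_derivative_inner_right smooth_on_differentiable[OF \<phi>_smooth q]
      smooth_on_differentiable[OF G_smooth q])

lemma inj_d\<Phi>: "inj (\<partial> \<Phi> q0)"
proof -
  have "u = 0" if "\<partial> \<Phi> q0 u = 0" for u
  proof (rule separating[OF q0])
    have z: "\<partial> \<Phi> q0 u $ i = 0" for i using that by simp
    have r0: "\<rho> q0 \<noteq> 0" using \<rho>[OF q0] by simp
    show "\<partial> G q0 u \<bullet> E 1 q0 = 0" "\<partial> G q0 u \<bullet> E 2 q0 = 0"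
      using z[of 1] z[of 2] r0 unfolding \<Phi>_derivative[OF q0] d\<phi>[OF q0]
      by (simp_all add: inner_add_left E_E[OF q0])
    show "\<partial> G q0 u \<bullet> e4 = 0" "\<partial> G q0 u \<bullet> e5 = 0"
      using z[of 3] z[of 4] unfolding \<Phi>_derivative[OF q0] by simp_all
  qed
  then show ?thesis using linear_injective_0[OF linear_directional_derivative[OF \<Phi>_smooth q0]] by blast
qed

text \<open>The part of \<open>u\<close> in the span of \<open>X 1\<close> and \<open>X 2\<close> has the same image under \<open>d\<phi>\<close>, and its last two
  coordinates vanish. If the first two vanish as well, then so does this part.\<close>

lemma d\<phi>_vanishes:
  assumes q: "q \<in> B" and inj: "inj (\<partial> \<Phi> q)" and u: "\<partial> \<Phi> q u $ 1 = 0" "\<partial> \<Phi> q u $ 2 = 0"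
  shows "\<partial> \<phi> q u = 0"
proof -
  \<comment> \<open>the part of \<open>u\<close> in the span of \<open>X 1\<close> and \<open>X 2\<close>\<close>
  define t where "t = (\<partial> G q u \<bullet> E 1 q) *\<^sub>R X 1 q + (\<partial> G q u \<bullet> E 2 q) *\<^sub>R X 2 q"
  note lin = legendrian_linear[OF leg q]
  have Gt: "\<partial> G q t = (\<partial> G q u \<bullet> E 1 q) *\<^sub>R E 1 q + (\<partial> G q u \<bullet> E 2 q) *\<^sub>R E 2 q"
    by (simp add: t_def linear_add[OF lin] linear_cmul[OF lin] E_def)
  have G12: "\<partial> G q t \<bullet> E 1 q = \<partial> G q u \<bullet> E 1 q" "\<partial> G q t \<bullet> E 2 q = \<partial> G q u \<bullet> E 2 q"
    by (simp_all add: Gt inner_add_left E_E[OF q])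
  then have "\<partial> \<phi> q t = \<partial> \<phi> q u" by (simp add: d\<phi>[OF q])
  then have "\<partial> \<Phi> q t $ 1 = 0" "\<partial> \<Phi> q t $ 2 = 0" using u by (simp_all add: \<Phi>_derivative[OF q])
  moreover have "\<partial> \<Phi> q t $ 3 = 0" "\<partial> \<Phi> q t $ 4 = 0"
    using E_e[OF q, of 1] E_e[OF q, of 2] by (simp_all add: \<Phi>_derivative[OF q] Gt inner_add_left)
  ultimately have "\<partial> \<Phi> q t = 0" by (simp add: vec_eq_iff forall_4)
  then have "t = 0" using inj linear_injective_0[OF linear_directional_derivative[OF \<Phi>_smooth q]] by blast
  then have "\<partial> G q u \<bullet> E 1 q = 0" "\<partial> G q u \<bullet> E 2 q = 0" using G12 linear_0[OF lin] by auto
  then show ?thesis by (simp add: d\<phi>[OF q])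
qed

definition cube :: "real \<Rightarrow> (real^4) set" where
  "cube \<epsilon> = {x. \<forall>i. \<bar>x $ i - \<Phi> q0 $ i\<bar> < \<epsilon>}"

lemma open_cube: "open (cube \<epsilon>)"
proof -
  have "cube \<epsilon> = (\<Inter>i\<in>UNIV. {x. \<bar>x $ i - \<Phi> q0 $ i\<bar> < \<epsilon>})" by (auto simp: cube_def)
  moreover have "open {x :: real^4. \<bar>x $ i - \<Phi> q0 $ i\<bar> < \<epsilon>}" for i
    by (intro open_Collect_less continuous_intros)
  ultimately show ?thesis by (simp add: open_INT)
qed

lemma small_cube:
  assumes "open V" "\<Phi> q0 \<in> V" obtains \<epsilon> where "\<epsilon> > 0" "cube \<epsilon> \<subseteq> V"
proof -
  obtain \<delta> where \<delta>: "\<delta> > 0" "ball (\<Phi> q0) \<delta> \<subseteq> V" using assms open_contains_ball by blast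
  \<comment> \<open>the norm is at most the sum of the four components\<close>
  have "cube (\<delta> / 5) \<subseteq> ball (\<Phi> q0) \<delta>"
  proof
    fix x assume "x \<in> cube (\<delta> / 5)"
    then have b: "\<bar>(x - \<Phi> q0) $ i\<bar> < \<delta> / 5" for i by (simp add: cube_def)
    have "norm (x - \<Phi> q0) \<le> (\<Sum>i\<in>UNIV. \<bar>(x - \<Phi> q0) $ i\<bar>)" by (rule norm_le_l1_cart)
    also have "\<dots> < \<delta>" using b[of 1] b[of 2] b[of 3] b[of 4] \<delta>(1) unfolding sum_4 by linarith
    finally show "x \<in> ball (\<Phi> q0) \<delta>" by (simp add: dist_norm norm_minus_commute)
  qed
  then show thesis using that[of "\<delta> / 5"] \<delta> by auto
qed

end

text \<open>A cube in the range of the coordinates, with the local inverse \<open>\<Psi>\<close>. The last condition makes the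
  first homogeneous coordinate of the surface non-zero.\<close>

locale split_legendrian_chart = split_legendrian B G X r E q0 e4 e5 \<phi> \<rho>
  for B G X r E q0 e4 e5 \<phi> \<rho> +
  fixes U V :: "(real^4) set" and \<Psi> :: "real^4 \<Rightarrow> real^4" and \<epsilon> :: real
  assumes U: "open U" "U \<subseteq> B" and V: "open V" and hom: "homeomorphism U V \<Phi> \<Psi>"
    and \<Psi>_smooth: "smooth_on V \<Psi>" and bij: "\<And>q. q \<in> U \<Longrightarrow> bij (\<partial> \<Phi> q)"
    and \<epsilon>: "\<epsilon> > 0" "cube \<epsilon> \<subseteq> V"
    and near: "\<And>x. x \<in> cube \<epsilon> \<Longrightarrow> \<phi> (\<Psi> x) \<bullet> \<phi> q0 > 0"
begin

lemma \<Psi>: "x \<in> cube \<epsilon> \<Longrightarrow> \<Psi> x \<in> U \<and> \<Psi> x \<in> B \<and> \<Phi> (\<Psi> x) = x"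
proof -
  assume "x \<in> cube \<epsilon>"
  then have "x \<in> V" using \<epsilon>(2) by blast
  then have "\<Psi> x \<in> U" "\<Phi> (\<Psi> x) = x" using hom by (auto simp: homeomorphism_def)
  then show ?thesis using U(2) by blast
qed

lemma \<Psi>_cube_smooth: "smooth_on (cube \<epsilon>) \<Psi>" by (rule smooth_on_subset[OF \<Psi>_smooth \<epsilon>(2)])

lemma d\<Phi>_d\<Psi>: assumes x: "x \<in> cube \<epsilon>" shows "\<partial> \<Phi> (\<Psi> x) (\<partial> \<Psi> x w) = w"
proof -
  have "\<partial> (\<lambda>x. \<Phi> (\<Psi> x)) x = \<partial> (\<lambda>x. x) x"
    by (rule directional_derivative_cong[OF open_cube x]) (use \<Psi> in auto)
  then show ?thesis
    using derivative_chain[OF smooth_on_differentiable[OF \<Phi>_smooth, of "\<Psi> x"] smooth_on_differentiable[OF \<Psi>_cube_smooth x], of w]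
      \<Psi>[OF x] by simp
qed

lemma \<phi>_depends_on_two:
  assumes x: "x \<in> cube \<epsilon>" and y: "y \<in> cube \<epsilon>" and eq: "x $ 1 = y $ 1" "x $ 2 = y $ 2"
  shows "\<phi> (\<Psi> x) = \<phi> (\<Psi> y)"
proof -
  define l where "l s = x + s *\<^sub>R (y - x)" for s
  have conv: "convex (cube \<epsilon>)"
  proof -
    have "cube \<epsilon> = (\<Inter>i\<in>UNIV. {x. x $ i < \<Phi> q0 $ i + \<epsilon>} \<inter> {x. x $ i > \<Phi> q0 $ i - \<epsilon>})"
      by (auto simp: cube_def abs_less_iff algebra_simps)
    moreover have "convex {x :: real^4. x $ i < a}" "convex {x :: real^4. x $ i > a}" for i a
      using convex_halfspace_lt[of "axis i 1 :: real^4" a] convex_halfspace_gt[of a "axis i 1 :: real^4"]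
      by (simp_all add: inner_axis inner_commute)
    ultimately show ?thesis by (simp add: convex_INT convex_Int)
  qed
  have lc: "l s \<in> cube \<epsilon>" if "s \<in> {0..1}" for s
  proof -
    have "l s = (1 - s) *\<^sub>R x + s *\<^sub>R y" by (simp add: l_def algebra_simps)
    then show ?thesis using conv x y that by (simp add: convex_alt)
  qed
  have "((\<lambda>s. \<phi> (\<Psi> (l s))) has_derivative (\<lambda>h. 0)) (at s within {0..1})" if s: "s \<in> {0..1}" for s
  proof -
    note c = lc[OF s] and p = \<Psi>[OF lc[OF s]]
    have "(l has_derivative (\<lambda>h. h *\<^sub>R (y - x))) (at s)" unfolding l_def[abs_def] by (auto intro!: derivative_eq_intros)
    from has_derivative_compose[OF has_derivative_compose[OF this smooth_on_has_derivative[OF \<Psi>_cube_smooth c]]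
        smooth_on_has_derivative[OF \<phi>_smooth]] p
    have "((\<lambda>s. \<phi> (\<Psi> (l s))) has_derivative (\<lambda>h. \<partial> \<phi> (\<Psi> (l s)) (\<partial> \<Psi> (l s) (h *\<^sub>R (y - x))))) (at s)" by simp
    moreover have "\<partial> \<phi> (\<Psi> (l s)) (\<partial> \<Psi> (l s) (h *\<^sub>R (y - x))) = 0" for h
      by (rule d\<phi>_vanishes) (use p bij[of "\<Psi> (l s)"] eq in \<open>auto simp: d\<Phi>_d\<Psi>[OF c] bij_is_inj\<close>)
    ultimately show ?thesis by (simp add: has_derivative_at_withinI)
  qed
  from has_derivative_zero_unique[OF _ this, of 0 1] show ?thesis by (simp add: l_def)
qed

section \<open>The Legendrian surface\<close>

definition slice :: "real^2 \<Rightarrow> real^4" where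
  "slice w = (\<chi> i. if i = 1 then w $ 1 else if i = 2 then w $ 2 else \<Phi> q0 $ i)"

lemma slice_nth: "slice w $ 1 = w $ 1" "slice w $ 2 = w $ 2" "slice w $ 3 = \<Phi> q0 $ 3" "slice w $ 4 = \<Phi> q0 $ 4"
  by (simp_all add: slice_def)

definition \<Theta> :: "(real^2) set" where
  "\<Theta> = {w. \<bar>w $ 1 - \<Phi> q0 $ 1\<bar> < \<epsilon> \<and> \<bar>w $ 2 - \<Phi> q0 $ 2\<bar> < \<epsilon>}"

lemma open_\<Theta>: "open \<Theta>"
  unfolding \<Theta>_def by (intro open_Collect_conj open_Collect_less continuous_intros)

lemma slice_cube: "w \<in> \<Theta> \<Longrightarrow> slice w \<in> cube \<epsilon>"
  using \<epsilon>(1) by (simp add: cube_def forall_4 slice_nth \<Theta>_def)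

lemma slice_derivative:
  "(slice has_derivative (\<lambda>u. \<chi> i. if i = 1 then u $ 1 else if i = 2 then u $ 2 else 0)) (at w)"
proof -
  define L :: "real^2 \<Rightarrow> real^4" where "L u = (\<chi> i. if i = 1 then u $ 1 else if i = 2 then u $ 2 else 0)" for u
  have "linear L" by (rule linearI) (simp_all add: L_def vec_eq_iff)
  then have "(L has_derivative L) (at w)"
    by (simp add: bounded_linear_imp_has_derivative linear_conv_bounded_linear[symmetric])
  then have "((\<lambda>w. L w + slice 0) has_derivative L) (at w)" by (auto intro!: derivative_eq_intros)
  moreover have "slice = (\<lambda>w. L w + slice 0)" by (simp add: fun_eq_iff vec_eq_iff slice_def L_def)
  ultimately show ?thesis by (simp add: L_def[abs_def])
qed

lemma slice_smooth: "smooth_on \<Theta> slice"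
  by (rule smooth_onI[OF open_\<Theta> slice_derivative]) (rule smooth_on_const[OF open_\<Theta>])

definition \<kappa> :: "real^2 \<Rightarrow> real^4" where "\<kappa> w = \<Psi> (slice w)"

lemma \<kappa>_smooth: "smooth_on \<Theta> \<kappa>"
  unfolding \<kappa>_def[abs_def]
  by (rule smooth_on_compose[OF \<Psi>_cube_smooth open_cube slice_smooth open_\<Theta> slice_cube])

lemma \<kappa>: "w \<in> \<Theta> \<Longrightarrow> \<kappa> w \<in> U \<and> \<kappa> w \<in> B \<and> \<Phi> (\<kappa> w) = slice w"
  unfolding \<kappa>_def by (rule \<Psi>[OF slice_cube])

lemma d\<Phi>_d\<kappa>:
  assumes w: "w \<in> \<Theta>"
  shows "\<partial> \<Phi> (\<kappa> w) (\<partial> \<kappa> w u) $ 1 = u $ 1" "\<partial> \<Phi> (\<kappa> w) (\<partial> \<kappa> w u) $ 2 = u $ 2"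
proof -
  have "\<partial> \<kappa> w u = \<partial> \<Psi> (slice w) (\<chi> i. if i = 1 then u $ 1 else if i = 2 then u $ 2 else 0)"
    unfolding \<kappa>_def[abs_def]
    using derivative_chain[OF smooth_on_differentiable[OF \<Psi>_cube_smooth slice_cube[OF w]] differentiableI[OF slice_derivative], of u]
    by (simp add: directional_derivative_eq[OF slice_derivative])
  then have "\<partial> \<Phi> (\<kappa> w) (\<partial> \<kappa> w u) = (\<chi> i. if i = 1 then u $ 1 else if i = 2 then u $ 2 else 0)"
    using d\<Phi>_d\<Psi>[OF slice_cube[OF w]] by (simp add: \<kappa>_def)
  then show "\<partial> \<Phi> (\<kappa> w) (\<partial> \<kappa> w u) $ 1 = u $ 1" "\<partial> \<Phi> (\<kappa> w) (\<partial> \<kappa> w u) $ 2 = u $ 2" by simp_all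
qed

text \<open>The components of the image of \<open>u\<close> under the slice, in the frame of the vectors \<open>E i\<close>.\<close>

definition c :: "4 \<Rightarrow> real^2 \<Rightarrow> real^2 \<Rightarrow> real" where
  "c i w u = \<partial> G (\<kappa> w) (\<partial> \<kappa> w u) \<bullet> E i (\<kappa> w)"

text \<open>The Legendrian surface, parametrized by the first two coordinates.\<close>

definition \<phi>\<^sub>3 :: "real^2 \<Rightarrow> complex^3" where "\<phi>\<^sub>3 w = R (\<phi> (\<kappa> w))"

lemma \<phi>\<kappa>_smooth: "smooth_on \<Theta> (\<lambda>w. \<phi> (\<kappa> w))"
  by (rule smooth_on_compose[OF \<phi>_smooth B_open \<kappa>_smooth open_\<Theta>]) (use \<kappa> in blast)

lemma \<phi>\<^sub>3_smooth: "smooth_on \<Theta> \<phi>\<^sub>3"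
  unfolding \<phi>\<^sub>3_def[abs_def] by (rule smooth_on_linear[OF bounded_linear_R open_\<Theta> \<phi>\<kappa>_smooth])

lemma R_derivative: "f differentiable (at w) \<Longrightarrow> \<partial> (\<lambda>w. R (f w)) w u = R (\<partial> f w u)"
  by (rule fun_cong[OF directional_derivative_eq[OF bounded_linear.has_derivative[OF bounded_linear_R has_derivative_directional]]])

lemma d\<phi>\<^sub>3: "w \<in> \<Theta> \<Longrightarrow> \<partial> \<phi>\<^sub>3 w u = R (\<partial> (\<lambda>w. \<phi> (\<kappa> w)) w u)"
  unfolding \<phi>\<^sub>3_def[abs_def] by (rule R_derivative[OF smooth_on_differentiable[OF \<phi>\<kappa>_smooth]])

lemma d\<phi>\<kappa>_chain: "w \<in> \<Theta> \<Longrightarrow> \<partial> (\<lambda>w. \<phi> (\<kappa> w)) w u = \<partial> \<phi> (\<kappa> w) (\<partial> \<kappa> w u)"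
  using derivative_chain[OF smooth_on_differentiable[OF \<phi>_smooth] smooth_on_differentiable[OF \<kappa>_smooth]] \<kappa> by blast

lemma d\<phi>\<kappa>: "w \<in> \<Theta> \<Longrightarrow> \<partial> (\<lambda>w. \<phi> (\<kappa> w)) w u
    = inverse (\<rho> (\<kappa> w)) *\<^sub>R (c 1 w u *\<^sub>R E 1 (\<kappa> w) + c 2 w u *\<^sub>R E 2 (\<kappa> w))"
  using d\<phi>[of "\<kappa> w"] \<kappa> by (simp add: d\<phi>\<kappa>_chain c_def)

lemma spherical_\<phi>\<kappa>: "w \<in> \<Theta> \<Longrightarrow> spherical (\<phi> (\<kappa> w))"
  using \<phi>_e \<kappa> by (simp add: spherical_def)

lemma spherical_E: "w \<in> \<Theta> \<Longrightarrow> i \<in> {1, 2} \<Longrightarrow> spherical (E i (\<kappa> w))"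
  using E_e \<kappa> by (simp add: spherical_def)

lemma spherical_d\<phi>\<kappa>: "w \<in> \<Theta> \<Longrightarrow> spherical (\<partial> (\<lambda>w. \<phi> (\<kappa> w)) w u)"
  unfolding d\<phi>\<kappa> by (intro spherical_scale spherical_add spherical_E) simp_all

lemma coordinates_determine:
  assumes w: "w \<in> \<Theta>" and u: "c 1 w u = 0" "c 2 w u = 0" shows "u = 0"
proof -
  have B: "\<kappa> w \<in> B" using \<kappa>[OF w] by blast
  have "\<partial> \<phi> (\<kappa> w) (\<partial> \<kappa> w u) = 0" using u by (simp add: d\<phi>[OF B] c_def)
  then have "\<partial> \<Phi> (\<kappa> w) (\<partial> \<kappa> w u) $ 1 = 0" "\<partial> \<Phi> (\<kappa> w) (\<partial> \<kappa> w u) $ 2 = 0" by (simp_all add: \<Phi>_derivative[OF B])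
  then show ?thesis by (simp add: d\<Phi>_d\<kappa>[OF w] vec_eq_iff forall_2)
qed

lemma inner_d\<phi>\<^sub>3:
  assumes w: "w \<in> \<Theta>"
  shows "\<partial> \<phi>\<^sub>3 w u \<bullet> \<partial> \<phi>\<^sub>3 w v = (inverse (\<rho> (\<kappa> w)))\<^sup>2 * (c 1 w u * c 1 w v + c 2 w u * c 2 w v)"
proof -
  have B: "\<kappa> w \<in> B" using \<kappa>[OF w] by blast
  have "\<partial> \<phi>\<^sub>3 w u \<bullet> \<partial> \<phi>\<^sub>3 w v = \<partial> (\<lambda>w. \<phi> (\<kappa> w)) w u \<bullet> \<partial> (\<lambda>w. \<phi> (\<kappa> w)) w v"
    unfolding d\<phi>\<^sub>3[OF w] by (rule R_inner[OF spherical_d\<phi>\<kappa>[OF w]])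
  then show ?thesis
    unfolding d\<phi>\<kappa>[OF w] by (simp add: inner_add_left inner_add_right E_E[OF B] power2_eq_square algebra_simps)
qed

theorem legendrian_\<phi>\<^sub>3: "legendrian_on \<Theta> \<phi>\<^sub>3"
  unfolding legendrian_on_def
proof (intro conjI ballI allI open_\<Theta> \<phi>\<^sub>3_smooth)
  fix w assume w: "w \<in> \<Theta>"
  have B: "\<kappa> w \<in> B" using \<kappa>[OF w] by blast
  show "norm (\<phi>\<^sub>3 w) = 1"
    using \<phi>_e[OF B] by (simp add: norm_eq_1 \<phi>\<^sub>3_def R_inner[OF spherical_\<phi>\<kappa>[OF w]])
  show "J (\<phi>\<^sub>3 w) \<bullet> \<partial> \<phi>\<^sub>3 w u = 0" for u
  proof -
    have "J (\<phi>\<^sub>3 w) \<bullet> \<partial> \<phi>\<^sub>3 w u = J (\<phi> (\<kappa> w)) \<bullet> \<partial> (\<lambda>w. \<phi> (\<kappa> w)) w u"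
      unfolding d\<phi>\<^sub>3[OF w] \<phi>\<^sub>3_def R_J[symmetric] by (rule R_inner[OF spherical_d\<phi>\<kappa>[OF w]])
    also have "\<dots> = 0"
      using E_e[OF B, of 1] E_e[OF B, of 2] unfolding d\<phi>\<kappa>[OF w] by (simp add: inner_add_right J_inner)
    finally show ?thesis .
  qed
  have "u = 0" if "\<partial> \<phi>\<^sub>3 w u = 0" for u
  proof -
    have "(inverse (\<rho> (\<kappa> w)))\<^sup>2 * (c 1 w u * c 1 w u + c 2 w u * c 2 w u) = 0"
      using inner_d\<phi>\<^sub>3[OF w, of u u] that by simp
    then have "c 1 w u = 0" "c 2 w u = 0" using \<rho>[OF B] by (simp_all add: sum_squares_eq_zero_iff)
    then show ?thesis by (rule coordinates_determine[OF w])
  qed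
  then show "inj (\<partial> \<phi>\<^sub>3 w)"
    using linear_injective_0[OF linear_directional_derivative[OF \<phi>\<^sub>3_smooth w]] by blast
qed

lemma \<phi>\<^sub>3_nonzero: assumes w: "w \<in> \<Theta>" shows "\<phi>\<^sub>3 w $ 1 \<noteq> 0"
proof -
  have "Re (\<phi>\<^sub>3 w $ 1) = \<phi> (\<kappa> w) \<bullet> \<phi> q0" by (simp add: \<phi>\<^sub>3_def R_nth Q_nth basis_nth)
  then show ?thesis using near[OF slice_cube[OF w]] by (auto simp: \<kappa>_def)
qed

text \<open>Along the surface, \<open>d\<phi>\<close> is a combination of \<open>E 1\<close> and \<open>E 2\<close>. Differentiating these vectors brings
  in the components of \<open>A\<close>, while the derivatives of the coefficients give tangential terms.\<close>

lemma second_d\<phi>\<^sub>3: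
  assumes w: "w \<in> \<Theta>"
  shows "\<partial> (\<lambda>p. \<partial> \<phi>\<^sub>3 p v) w u \<bullet> J (\<partial> \<phi>\<^sub>3 w x) = (inverse (\<rho> (\<kappa> w)))\<^sup>2 * (r (\<kappa> w) *
    ((c 1 w u * c 1 w v - c 2 w u * c 2 w v) * c 1 w x - (c 1 w u * c 2 w v + c 2 w u * c 1 w v) * c 2 w x))"
proof -
  have B: "\<kappa> w \<in> B" using \<kappa>[OF w] by blast
  define \<alpha> where "\<alpha> i p = inverse (\<rho> (\<kappa> p)) * c i p v" for i p
  have Gd: "smooth_on \<Theta> (\<lambda>w. \<partial> G (\<kappa> w) (\<partial> \<kappa> w v))"
  proof -
    have "smooth_on \<Theta> (\<lambda>w. \<partial> (\<lambda>w. G (\<kappa> w)) w v)"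
      by (rule smooth_on_directional_derivative[OF smooth_on_compose[OF G_smooth B_open \<kappa>_smooth open_\<Theta>]]) (use \<kappa> in blast)
    then show ?thesis
      by (rule smooth_on_cong[OF _ open_\<Theta>])
        (use derivative_chain[OF smooth_on_differentiable[OF G_smooth] smooth_on_differentiable[OF \<kappa>_smooth]] \<kappa> in blast)
  qed
  have E\<kappa>: "smooth_on \<Theta> (\<lambda>w. E i (\<kappa> w))" for i
    by (rule smooth_on_compose[OF E_smooth B_open \<kappa>_smooth open_\<Theta>]) (use \<kappa> in blast)
  have \<rho>\<kappa>: "smooth_on \<Theta> (\<lambda>w. inverse (\<rho> (\<kappa> w)))"
  proof (rule smooth_on_inverse[OF open_\<Theta>])
    show "smooth_on \<Theta> (\<lambda>w. \<rho> (\<kappa> w))"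
      by (rule smooth_on_compose[OF \<rho>_smooth B_open \<kappa>_smooth open_\<Theta>]) (use \<kappa> in blast)
    show "\<rho> (\<kappa> w) \<noteq> 0" if "w \<in> \<Theta>" for w using \<rho>[of "\<kappa> w"] \<kappa>[OF that] by auto
  qed
  have \<alpha>: "smooth_on \<Theta> (\<alpha> i)" for i
    unfolding \<alpha>_def[abs_def] c_def by (intro smooth_on_mult smooth_on_inner open_\<Theta> \<rho>\<kappa> Gd E\<kappa>)
  define S where "S = (\<lambda>p. \<partial> (\<lambda>w. \<phi> (\<kappa> w)) p v)"
  have S: "S p = \<alpha> 1 p *\<^sub>R E 1 (\<kappa> p) + \<alpha> 2 p *\<^sub>R E 2 (\<kappa> p)" if "p \<in> \<Theta>" for p
    by (simp add: S_def d\<phi>\<kappa>[OF that] \<alpha>_def scaleR_add_right)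
  have Ssm: "smooth_on \<Theta> S" unfolding S_def by (rule smooth_on_directional_derivative[OF \<phi>\<kappa>_smooth])
  have "\<partial> (\<lambda>p. \<partial> \<phi>\<^sub>3 p v) w = \<partial> (\<lambda>p. R (S p)) w"
    by (rule directional_derivative_cong[OF open_\<Theta> w]) (simp add: d\<phi>\<^sub>3 S_def)
  then have dd: "\<partial> (\<lambda>p. \<partial> \<phi>\<^sub>3 p v) w u = R (\<partial> S w u)"
    using R_derivative[OF smooth_on_differentiable[OF Ssm w], of u] by simp
  have dS: "\<partial> S w u = (\<alpha> 1 w *\<^sub>R \<partial> (\<lambda>w. E 1 (\<kappa> w)) w u + \<partial> (\<alpha> 1) w u *\<^sub>R E 1 (\<kappa> w))
      + (\<alpha> 2 w *\<^sub>R \<partial> (\<lambda>w. E 2 (\<kappa> w)) w u + \<partial> (\<alpha> 2) w u *\<^sub>R E 2 (\<kappa> w))"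
  proof -
    have "\<partial> S w = \<partial> (\<lambda>p. \<alpha> 1 p *\<^sub>R E 1 (\<kappa> p) + \<alpha> 2 p *\<^sub>R E 2 (\<kappa> p)) w"
      by (rule directional_derivative_cong[OF open_\<Theta> w S])
    moreover have "((\<lambda>p. \<alpha> 1 p *\<^sub>R E 1 (\<kappa> p) + \<alpha> 2 p *\<^sub>R E 2 (\<kappa> p)) has_derivative
      (\<lambda>u. (\<alpha> 1 w *\<^sub>R \<partial> (\<lambda>w. E 1 (\<kappa> w)) w u + \<partial> (\<alpha> 1) w u *\<^sub>R E 1 (\<kappa> w))
      + (\<alpha> 2 w *\<^sub>R \<partial> (\<lambda>w. E 2 (\<kappa> w)) w u + \<partial> (\<alpha> 2) w u *\<^sub>R E 2 (\<kappa> w)))) (at w)"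
      by (intro has_derivative_add has_derivative_scaleR smooth_on_has_derivative[OF \<alpha> w] smooth_on_has_derivative[OF E\<kappa> w])
    ultimately show ?thesis by (simp add: directional_derivative_eq)
  qed
  have dE: "\<partial> (\<lambda>w. E i (\<kappa> w)) w u = \<partial> (E i) (\<kappa> w) (\<partial> \<kappa> w u)" for i
    by (rule derivative_chain[OF smooth_on_differentiable[OF E_smooth B] smooth_on_differentiable[OF \<kappa>_smooth w]])
  have dEJ: "\<partial> (E j) (\<kappa> w) (\<partial> \<kappa> w u) \<bullet> J (E k (\<kappa> w)) = r (\<kappa> w) * (c 1 w u * sff 1 j k + c 2 w u * sff 2 j k)" for j k
    using dE_JE[OF B, of j "\<partial> \<kappa> w u" k] by (simp add: sum_4 c_def sff_def)
  have "\<partial> S w u \<bullet> J (E k (\<kappa> w)) = r (\<kappa> w) * (\<alpha> 1 w * (c 1 w u * sff 1 1 k + c 2 w u * sff 2 1 k)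
      + \<alpha> 2 w * (c 1 w u * sff 1 2 k + c 2 w u * sff 2 2 k))" for k
    by (simp add: dS dE dEJ inner_add_left E_JE[OF B] algebra_simps)
  from this[of 1] this[of 2]
  have k: "\<partial> S w u \<bullet> J (E 1 (\<kappa> w)) = r (\<kappa> w) * (\<alpha> 1 w * c 1 w u - \<alpha> 2 w * c 2 w u)"
    "\<partial> S w u \<bullet> J (E 2 (\<kappa> w)) = - (r (\<kappa> w) * (\<alpha> 1 w * c 2 w u + \<alpha> 2 w * c 1 w u))"
    by (simp_all add: sff_def algebra_simps)
  have "\<partial> (\<lambda>p. \<partial> \<phi>\<^sub>3 p v) w u \<bullet> J (\<partial> \<phi>\<^sub>3 w x) = \<partial> S w u \<bullet> J (\<partial> (\<lambda>w. \<phi> (\<kappa> w)) w x)"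
    unfolding dd d\<phi>\<^sub>3[OF w] R_J[symmetric] by (rule R_inner[OF spherical_J[OF spherical_d\<phi>\<kappa>[OF w]]])
  also have "\<dots> = inverse (\<rho> (\<kappa> w)) * (c 1 w x * (\<partial> S w u \<bullet> J (E 1 (\<kappa> w))) + c 2 w x * (\<partial> S w u \<bullet> J (E 2 (\<kappa> w))))"
    unfolding d\<phi>\<kappa>[OF w] J_scaleR J_add by (simp add: inner_add_right)
  finally show ?thesis by (simp add: k \<alpha>_def power2_eq_square algebra_simps)
qed

theorem traceless_\<phi>\<^sub>3: assumes w: "w \<in> \<Theta>" shows "traceless_at \<phi>\<^sub>3 w"
proof -
  have B: "\<kappa> w \<in> B" using \<kappa>[OF w] by blast
  define C :: "real^2 \<Rightarrow> real^2" where "C u = (\<chi> i. if i = 1 then c 1 w u else c 2 w u)" for u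
  define S :: "real^2 \<Rightarrow> real^2 \<Rightarrow> real^2" where
    "S \<xi> \<eta> = (\<chi> i. if i = 1 then r (\<kappa> w) * (\<xi> $ 1 * \<eta> $ 1 - \<xi> $ 2 * \<eta> $ 2)
      else - (r (\<kappa> w) * (\<xi> $ 1 * \<eta> $ 2 + \<xi> $ 2 * \<eta> $ 1)))" for \<xi> \<eta>
  have Cn: "C u $ 1 = c 1 w u" "C u $ 2 = c 2 w u" for u by (simp_all add: C_def)
  have Sn: "S \<xi> \<eta> $ 1 = r (\<kappa> w) * (\<xi> $ 1 * \<eta> $ 1 - \<xi> $ 2 * \<eta> $ 2)"
    "S \<xi> \<eta> $ 2 = - (r (\<kappa> w) * (\<xi> $ 1 * \<eta> $ 2 + \<xi> $ 2 * \<eta> $ 1))" for \<xi> \<eta> by (simp_all add: S_def)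
  note l1 = legendrian_linear[OF leg B] and l2 = linear_directional_derivative[OF \<kappa>_smooth w]
  have "linear C"
    by (rule linearI) (simp_all add: vec_eq_iff forall_2 Cn c_def linear_add[OF l1] linear_add[OF l2]
      linear_cmul[OF l1] linear_cmul[OF l2] inner_add_left)
  moreover have "inj C"
  proof -
    have "u = 0" if "C u = 0" for u
      by (rule coordinates_determine[OF w]) (simp_all add: Cn[symmetric] that)
    then show ?thesis using linear_injective_0[OF \<open>linear C\<close>] by blast
  qed
  moreover have "(inverse (\<rho> (\<kappa> w)))\<^sup>2 \<noteq> 0" using \<rho>[OF B] by simp
  moreover have "linear (S \<xi>)" for \<xi>
    by (rule linearI) (simp_all add: vec_eq_iff forall_2 Sn algebra_simps)
  moreover have "trace (matrix (S \<xi>)) = 0" for \<xi>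
    by (simp add: trace_def matrix_def sum_2 Sn axis_def)
  moreover have "\<partial> \<phi>\<^sub>3 w u \<bullet> \<partial> \<phi>\<^sub>3 w v = (inverse (\<rho> (\<kappa> w)))\<^sup>2 * (C u \<bullet> C v)" for u v
    by (simp add: inner_d\<phi>\<^sub>3[OF w] inner_vec_def[of "C u"] sum_2 Cn)
  moreover have "\<partial> (\<lambda>p. \<partial> \<phi>\<^sub>3 p v) w u \<bullet> J (\<partial> \<phi>\<^sub>3 w x) = (inverse (\<rho> (\<kappa> w)))\<^sup>2 * (S (C u) (C v) \<bullet> C x)" for u v x
    unfolding second_d\<phi>\<^sub>3[OF w] inner_vec_def[of "S _ _"] sum_2 Sn Cn by (simp add: algebra_simps)
  ultimately show ?thesis
    unfolding traceless_at_def by (intro exI[of _ C] exI[of _ S] exI[of _ "(inverse (\<rho> (\<kappa> w)))\<^sup>2"]) simp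
qed

section \<open>Polar coordinates\<close>

definition polar :: "real \<times> real \<times> real \<times> real \<Rightarrow> real^4" where
  "polar x = (\<chi> i. if i = 1 then fst (snd (snd x)) else if i = 2 then snd (snd (snd x))
     else if i = 3 then sin (fst (snd x)) * cos (fst x) else sin (fst (snd x)) * sin (fst x))"

lemma polar_nth: "polar x $ 1 = fst (snd (snd x))" "polar x $ 2 = snd (snd (snd x))"
  "polar x $ 3 = sin (fst (snd x)) * cos (fst x)" "polar x $ 4 = sin (fst (snd x)) * sin (fst x)"
  by (simp_all add: polar_def)

definition \<Omega> :: "(real \<times> real \<times> real \<times> real) set" where
  "\<Omega> = {x. cos (fst (snd x)) > 0 \<and> polar x \<in> cube \<epsilon>}"

lemma polar_component_smooth:
  assumes S: "open S"
  shows "smooth_on S (\<lambda>x. polar x $ i)"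
proof -
  have l: "smooth_on S (\<lambda>x. fst x)" "smooth_on S (\<lambda>x. fst (snd x))" "smooth_on S (\<lambda>x. fst (snd (snd x)))"
    "smooth_on S (\<lambda>x. snd (snd (snd x)))"
    using smooth_on_linear[OF bounded_linear_fst S smooth_on_ident[OF S]]
      smooth_on_linear[OF bounded_linear_compose[OF bounded_linear_fst bounded_linear_snd] S smooth_on_ident[OF S]]
      smooth_on_linear[OF bounded_linear_compose[OF bounded_linear_fst bounded_linear_compose[OF bounded_linear_snd bounded_linear_snd]] S smooth_on_ident[OF S]]
      smooth_on_linear[OF bounded_linear_compose[OF bounded_linear_snd bounded_linear_compose[OF bounded_linear_snd bounded_linear_snd]] S smooth_on_ident[OF S]]
    by simp_all
  show ?thesis
    using exhaust_4[of i]
    by (elim disjE) (simp_all add: polar_nth l smooth_on_mult smooth_on_sin smooth_on_cos S)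
qed

lemma polar_smooth: "open S \<Longrightarrow> smooth_on S polar"
  using smooth_on_vec_lambda[of S "\<lambda>i x. polar x $ i"] polar_component_smooth[of S] by simp

lemma open_\<Omega>: "open \<Omega>"
proof -
  have "open (polar -` cube \<epsilon>)"
    using smooth_on_imp_continuous_on[OF polar_smooth[OF open_UNIV]] open_cube
    by (simp add: continuous_on_open_vimage)
  moreover have "open {x :: real \<times> real \<times> real \<times> real. cos (fst (snd x)) > 0}"
    by (intro open_Collect_less continuous_intros)
  moreover have "\<Omega> = {x. cos (fst (snd x)) > 0} \<inter> polar -` cube \<epsilon>" by (auto simp: \<Omega>_def)
  ultimately show ?thesis by auto
qed

definition \<psi> :: "real \<times> real \<times> real \<times> real \<Rightarrow> real^4" where "\<psi> x = \<Psi> (polar x)"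

lemma \<psi>_smooth: "smooth_on \<Omega> \<psi>"
  unfolding \<psi>_def[abs_def]
  by (rule smooth_on_compose[OF \<Psi>_cube_smooth open_cube polar_smooth[OF open_\<Omega>] open_\<Omega>]) (simp add: \<Omega>_def)

lemma \<psi>: "x \<in> \<Omega> \<Longrightarrow> \<psi> x \<in> U \<and> \<psi> x \<in> B \<and> \<Phi> (\<psi> x) = polar x"
  unfolding \<psi>_def by (rule \<Psi>) (simp add: \<Omega>_def)

text \<open>A point of the constant plane with \<open>a\<^sup>2 + b\<^sup>2 < 1\<close> has polar coordinates with \<open>cos s > 0\<close>.\<close>

lemma \<psi>_image: "\<psi> ` \<Omega> = \<Psi> ` cube \<epsilon>"
proof
  show "\<psi> ` \<Omega> \<subseteq> \<Psi> ` cube \<epsilon>" by (auto simp: \<psi>_def \<Omega>_def)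
  show "\<Psi> ` cube \<epsilon> \<subseteq> \<psi> ` \<Omega>"
  proof
    fix q assume "q \<in> \<Psi> ` cube \<epsilon>"
    then obtain x where x: "x \<in> cube \<epsilon>" "q = \<Psi> x" by blast
    have B: "q \<in> B" and \<Phi>: "\<Phi> q = x" using \<Psi>[OF x(1)] x(2) by auto
    have "(x $ 3)\<^sup>2 + (x $ 4)\<^sup>2 < 1"
      using \<rho>[OF B] \<Phi>_nth(3,4)[of q] unfolding \<Phi> by (smt (verit) zero_less_power)
    moreover obtain m t where mt: "x $ 3 = m * cos t" "x $ 4 = m * sin t" using polar_Ex by blast
    moreover have "(m * cos t)\<^sup>2 + (m * sin t)\<^sup>2 = m\<^sup>2 * ((cos t)\<^sup>2 + (sin t)\<^sup>2)"
      by (simp only: power_mult_distrib distrib_left)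
    ultimately have "m\<^sup>2 < 1" by simp
    then have m: "\<bar>m\<bar> < 1" by (simp add: abs_square_less_1)
    \<comment> \<open>the sign of the radius \<open>m\<close> is unknown, so the parameter \<open>s\<close> may be negative\<close>
    define y where "y = (t, arcsin m, x $ 1, x $ 2)"
    have s: "sin (arcsin m) = m" using m by (intro sin_arcsin) auto
    have "cos (arcsin m) > 0" using m by (simp add: cos_arcsin abs_square_less_1)
    moreover have "polar y = x" by (simp add: vec_eq_iff forall_4 polar_nth y_def s mt)
    ultimately show "q \<in> \<psi> ` \<Omega>" using x by (intro image_eqI[of _ _ y]) (auto simp: \<psi>_def \<Omega>_def y_def)
  qed
qed

lemma inj_d\<psi>:
  assumes x: "x \<in> \<Omega>" and s: "sin (fst (snd x)) \<noteq> 0" shows "inj (\<partial> \<psi> x)"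
proof -
  obtain t s u v where xe: "x = (t, s, u, v)" by (metis surj_pair)
  have d: "\<psi> differentiable (at x)" by (rule smooth_on_differentiable[OF \<psi>_smooth x])
  have "h = 0" if h: "\<partial> \<psi> x h = 0" for h
  proof -
    obtain dt ds du dv where he: "h = (dt, ds, du, dv)" by (metis surj_pair)
    have "\<partial> (\<lambda>x. \<Phi> (\<psi> x)) x = \<partial> polar x"
      by (rule directional_derivative_cong[OF open_\<Omega> x]) (use \<psi> in blast)
    then have "\<partial> polar x h = \<partial> \<Phi> (\<psi> x) (\<partial> \<psi> x h)"
      using derivative_chain[of \<Phi> \<psi> x h] smooth_on_differentiable[OF \<Phi>_smooth, of "\<psi> x"] \<psi>[OF x] d by simp
    then have z: "\<partial> polar x h $ i = 0" for i
      using h linear_0[OF linear_directional_derivative[OF \<Phi>_smooth, of "\<psi> x"]] \<psi>[OF x] by simp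
    have pd: "\<partial> polar x h $ i = \<partial> (\<lambda>x. polar x $ i) x h" for i
      by (rule derivative_vec_nth[OF smooth_on_differentiable[OF polar_smooth[OF open_UNIV]]]) simp
    have "((\<lambda>x :: real \<times> real \<times> real \<times> real. fst (snd (snd x))) has_derivative (\<lambda>h. fst (snd (snd h)))) (at x)"
      "((\<lambda>x :: real \<times> real \<times> real \<times> real. snd (snd (snd x))) has_derivative (\<lambda>h. snd (snd (snd h)))) (at x)"
      "((\<lambda>x :: real \<times> real \<times> real \<times> real. sin (fst (snd x)) * cos (fst x)) has_derivative
         (\<lambda>h. cos (fst (snd x)) * fst (snd h) * cos (fst x) - sin (fst (snd x)) * (sin (fst x) * fst h))) (at x)"
      "((\<lambda>x :: real \<times> real \<times> real \<times> real. sin (fst (snd x)) * sin (fst x)) has_derivative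
         (\<lambda>h. cos (fst (snd x)) * fst (snd h) * sin (fst x) + sin (fst (snd x)) * (cos (fst x) * fst h))) (at x)"
      by (auto intro!: derivative_eq_intros simp: fun_eq_iff algebra_simps)
    note this[THEN directional_derivative_eq]
    with z[of 1] z[of 2] z[of 3] z[of 4]
    have e: "du = 0" "dv = 0" "cos s * ds * cos t = sin s * (sin t * dt)" "cos s * ds * sin t + sin s * (cos t * dt) = 0"
      unfolding pd polar_nth by (simp_all add: xe he)
    have "cos s * ds = cos s * ds * ((cos t)\<^sup>2 + (sin t)\<^sup>2)" by simp
    also have "\<dots> = (cos s * ds * cos t) * cos t + (cos s * ds * sin t) * sin t" by (simp only: power2_eq_square distrib_left mult.assoc)
    also have "cos s * ds * sin t = - (sin s * (cos t * dt))" using e(4) by simp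
    finally have "cos s * ds = 0" unfolding e(3) by (simp add: mult_ac)
    then have ds: "ds = 0" using x by (simp add: \<Omega>_def xe)
    have "sin s * (sin t * dt) = 0" "sin s * (cos t * dt) = 0" using e(3,4) ds by simp_all
    then have "dt = 0" using s by (auto simp: xe) (metis sin_zero_abs_cos_one abs_zero zero_neq_one)
    then show "h = 0" using e ds by (simp add: he zero_prod_def)
  qed
  then show ?thesis using linear_injective_0[OF linear_directional_derivative[OF \<psi>_smooth x]] by blast
qed

lemma model_equation:
  assumes x: "(t, s, u, v) \<in> \<Omega>"
  shows "vector [u, v] \<in> \<Theta>" and "Q *v G (\<psi> (t, s, u, v)) = model_F \<phi>\<^sub>3 t s u v"
proof -
  let ?q = "\<psi> (t, s, u, v)" and ?w = "vector [u, v] :: real^2"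
  have B: "?q \<in> B" and \<Phi>: "\<Phi> ?q = polar (t, s, u, v)" using \<psi>[OF x] by auto
  have c: "cos s > 0" and pc: "polar (t, s, u, v) \<in> cube \<epsilon>" using x by (auto simp: \<Omega>_def)
  show w: "?w \<in> \<Theta>" using pc by (simp add: cube_def forall_4 polar_nth \<Theta>_def)
  have a: "G ?q \<bullet> e4 = sin s * cos t" "G ?q \<bullet> e5 = sin s * sin t"
    using \<Phi>_nth(3,4)[of ?q] unfolding \<Phi> polar_nth by simp_all
  have "(sin s * cos t)\<^sup>2 + (sin s * sin t)\<^sup>2 = (sin s)\<^sup>2 * ((cos t)\<^sup>2 + (sin t)\<^sup>2)"
    by (simp only: power_mult_distrib distrib_left)
  then have "(sin s * cos t)\<^sup>2 + (sin s * sin t)\<^sup>2 = (sin s)\<^sup>2" by simp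
  then have "(\<rho> ?q)\<^sup>2 = (cos s)\<^sup>2" using \<rho>[OF B] by (simp add: a cos_squared_eq)
  then have \<rho>c: "\<rho> ?q = cos s" using \<rho>[OF B] c power2_eq_imp_eq[of "\<rho> ?q" "cos s"] by simp
  have "\<phi> ?q = \<phi> (\<kappa> ?w)"
    unfolding \<psi>_def \<kappa>_def by (rule \<phi>_depends_on_two[OF pc slice_cube[OF w]]) (simp_all add: polar_nth slice_nth)
  then have G: "G ?q = cos s *\<^sub>R \<phi> (\<kappa> ?w) + (sin s * cos t) *\<^sub>R e4 + (sin s * sin t) *\<^sub>R e5"
    using G_split[OF B] by (simp add: \<rho>c a)
  have ortho: "e4 \<bullet> basis i = 0" "e4 \<bullet> J (basis i) = 0" "e5 \<bullet> basis i = 0" "e5 \<bullet> J (basis i) = 0"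
    if "i \<in> {1, 2, 3}" for i
    using that basis_orthonormal(1)[of 4 i] basis_orthonormal(2)[of 4 i]
      basis_orthonormal(1)[of 5 i] basis_orthonormal(2)[of 5 i] by (auto simp: basis_nth)
  have p: "\<phi> (\<kappa> ?w) \<bullet> e4 = 0" "\<phi> (\<kappa> ?w) \<bullet> e5 = 0" "\<phi> (\<kappa> ?w) \<bullet> J e4 = 0" "\<phi> (\<kappa> ?w) \<bullet> J e5 = 0"
    using spherical_\<phi>\<kappa>[OF w] by (simp_all add: spherical_def)
  show "Q *v G ?q = model_F \<phi>\<^sub>3 t s u v"
    unfolding vec_eq_iff forall_5 model_F_nth \<phi>\<^sub>3_def R_nth Q_nth G
    using ortho[of 1] ortho[of 2] ortho[of 3] p
    by (simp add: inner_add_left basis_nth(4,5) ee ee' inner_J_self complex_eq_iff)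
qed

end

section \<open>From the adapted frame to the model\<close>

text \<open>On an integral surface, \<open>N\<close> is normal to the restriction of \<open>G\<close>, whose second fundamental form in
  the direction \<open>N\<close> is symmetric.\<close>

lemma integrable_span_derivative_symmetric:
  fixes G N :: "'a::euclidean_space \<Rightarrow> 'b::euclidean_space"
  assumes int: "integrable_span D X Y" and B: "open B" "B \<subseteq> D" "q \<in> B"
    and G: "smooth_on B G" and N: "smooth_on B N"
    and orth: "\<And>p. p \<in> B \<Longrightarrow> \<partial> G p (X p) \<bullet> N p = 0" "\<And>p. p \<in> B \<Longrightarrow> \<partial> G p (Y p) \<bullet> N p = 0"
  shows "\<partial> N q (Y q) \<bullet> \<partial> G q (X q) = \<partial> N q (X q) \<bullet> \<partial> G q (Y q)"
proof -
  have "q \<in> D" using B by blast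
  from bspec[OF int[unfolded integrable_span_def] this]
  obtain W and \<sigma> :: "real^2 \<Rightarrow> 'a" where W: "open W" "smooth_on W \<sigma>" "q \<in> \<sigma> ` W"
    and tangent: "\<forall>w\<in>W. inj (\<partial> \<sigma> w) \<and> range (\<partial> \<sigma> w) = span {X (\<sigma> w), Y (\<sigma> w)}"
    by auto
  have range: "range (\<partial> \<sigma> w) = span {X (\<sigma> w), Y (\<sigma> w)}" if "w \<in> W" for w
    using tangent that by blast
  define S where "S = \<sigma> -` B \<inter> W"
  have S: "open S"
    unfolding S_def using W(1) B(1) smooth_on_imp_continuous_on[OF W(2)] by (simp add: continuous_on_open_vimage)
  have \<sigma>: "smooth_on S \<sigma>" by (rule smooth_on_subset[OF W(2)]) (simp add: S_def)
  have \<sigma>B: "\<sigma> w \<in> B" if "w \<in> S" for w using that by (simp add: S_def)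
  obtain w0 where w0: "w0 \<in> S" "\<sigma> w0 = q" using W(3) B(3) by (auto simp: S_def)
  define g where "g w = G (\<sigma> w)" for w
  define n where "n w = N (\<sigma> w)" for w
  have g: "smooth_on S g" and n: "smooth_on S n"
    unfolding g_def[abs_def] n_def[abs_def]
    by (rule smooth_on_compose[OF G B(1) \<sigma> S \<sigma>B], assumption, rule smooth_on_compose[OF N B(1) \<sigma> S \<sigma>B], assumption)
  have dg: "\<partial> g w u = \<partial> G (\<sigma> w) (\<partial> \<sigma> w u)" and dn: "\<partial> n w u = \<partial> N (\<sigma> w) (\<partial> \<sigma> w u)" if "w \<in> S" for w u
    unfolding g_def[abs_def] n_def[abs_def]
    using derivative_chain[OF smooth_on_differentiable[OF G \<sigma>B[OF that]] smooth_on_differentiable[OF \<sigma> that]]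
      derivative_chain[OF smooth_on_differentiable[OF N \<sigma>B[OF that]] smooth_on_differentiable[OF \<sigma> that]] by simp_all
  have perp: "\<partial> g w u \<bullet> n w = 0" if w: "w \<in> S" for w u
  proof -
    have "\<partial> \<sigma> w u \<in> span {X (\<sigma> w), Y (\<sigma> w)}" using range[of w] w by (auto simp: S_def)
    then obtain a where "\<partial> \<sigma> w u - a *\<^sub>R X (\<sigma> w) \<in> span {Y (\<sigma> w)}"
      unfolding span_breakdown_eq by blast
    then obtain b where "\<partial> \<sigma> w u - a *\<^sub>R X (\<sigma> w) = b *\<^sub>R Y (\<sigma> w)" unfolding span_singleton by blast
    then have ab: "\<partial> \<sigma> w u = a *\<^sub>R X (\<sigma> w) + b *\<^sub>R Y (\<sigma> w)" by (simp add: diff_eq_eq add.commute)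
    have lin: "linear (\<partial> G (\<sigma> w))" by (rule linear_directional_derivative[OF G \<sigma>B[OF w]])
    show ?thesis
      unfolding dg[OF w] ab n_def using orth[OF \<sigma>B[OF w]]
      by (simp add: linear_add[OF lin] linear_cmul[OF lin] inner_add_left)
  qed
  have "\<partial> (\<lambda>w. \<partial> g w u) w0 v \<bullet> n w0 = - (\<partial> g w0 u \<bullet> \<partial> n w0 v)" for u v
    by (rule constant_inner_derivative[OF S w0(1) smooth_on_directional_derivative[OF g] n perp])
  then have sym: "\<partial> g w0 u \<bullet> \<partial> n w0 v = \<partial> g w0 v \<bullet> \<partial> n w0 u" for u v
    using second_derivative_symmetric[OF S w0(1) g, of u v] by (metis neg_equal_iff_equal)
  have "X q \<in> range (\<partial> \<sigma> w0)" "Y q \<in> range (\<partial> \<sigma> w0)"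
    using range[of w0] w0 by (auto simp: S_def span_base)
  then obtain u v where "\<partial> \<sigma> w0 u = X q" "\<partial> \<sigma> w0 v = Y q" by (metis rangeE)
  then show ?thesis using sym[of u v] by (simp add: dg[OF w0(1)] dn[OF w0(1)] w0(2) inner_commute)
qed

theorem adapted_legendrian_model:
  assumes ad: "adapted_legendrian B G X r" and q0: "q0 \<in> B"
  obtains U \<Theta> \<phi> Q \<Omega> \<psi> where "open U" "U \<subseteq> B" "q0 \<in> U" "legendrian_on \<Theta> \<phi>"
    "\<And>w. w \<in> \<Theta> \<Longrightarrow> \<phi> w $ 1 \<noteq> 0" "\<And>w. w \<in> \<Theta> \<Longrightarrow> traceless_at \<phi> w"
    "unitary_matrix Q" "open \<Omega>" "smooth_on \<Omega> \<psi>" "\<psi> ` \<Omega> = U"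
    "\<And>t s u v. (t, s, u, v) \<in> \<Omega> \<Longrightarrow> vector [u, v] \<in> \<Theta>"
    "\<And>t s u v. (t, s, u, v) \<in> \<Omega> \<Longrightarrow> sin s \<noteq> 0 \<Longrightarrow> inj (\<partial> \<psi> (t, s, u, v))"
    "\<And>t s u v. (t, s, u, v) \<in> \<Omega> \<Longrightarrow> Q *v G (\<psi> (t, s, u, v)) = model_F \<phi> t s u v"
proof -
  interpret adapted_legendrian B G X r "\<lambda>i p. \<partial> G p (X i p)" by (rule ad)
  obtain e4 e5 \<phi> \<rho> where split: "split_legendrian B G X r q0 e4 e5 \<phi> \<rho>"
  proof (rule splitting[OF q0])
    fix e4 e5 \<phi> \<rho>
    assume "e4 \<bullet> e4 = 1" "e5 \<bullet> e5 = 1" "e4 \<bullet> e5 = 0" "e4 \<bullet> J e5 = 0" "smooth_on B \<phi>" "smooth_on B \<rho>"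
      "\<And>q. q \<in> B \<Longrightarrow> G q = \<rho> q *\<^sub>R \<phi> q + (G q \<bullet> e4) *\<^sub>R e4 + (G q \<bullet> e5) *\<^sub>R e5"
      "\<And>q. q \<in> B \<Longrightarrow> \<rho> q > 0 \<and> (\<rho> q)\<^sup>2 = 1 - (G q \<bullet> e4)\<^sup>2 - (G q \<bullet> e5)\<^sup>2"
      "\<And>q. q \<in> B \<Longrightarrow> \<phi> q \<bullet> \<phi> q = 1 \<and> \<phi> q \<bullet> e4 = 0 \<and> \<phi> q \<bullet> e5 = 0 \<and> \<phi> q \<bullet> J e4 = 0 \<and> \<phi> q \<bullet> J e5 = 0"
      "\<And>q i. q \<in> B \<Longrightarrow> i \<in> {1, 2} \<Longrightarrow> \<phi> q \<bullet> \<partial> G q (X i q) = 0 \<and> \<phi> q \<bullet> J (\<partial> G q (X i q)) = 0 \<and>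
         \<partial> G q (X i q) \<bullet> e4 = 0 \<and> \<partial> G q (X i q) \<bullet> e5 = 0 \<and> \<partial> G q (X i q) \<bullet> J e4 = 0 \<and> \<partial> G q (X i q) \<bullet> J e5 = 0"
      "\<And>q u. q \<in> B \<Longrightarrow> \<partial> \<phi> q u = inverse (\<rho> q) *\<^sub>R ((\<partial> G q u \<bullet> \<partial> G q (X 1 q)) *\<^sub>R \<partial> G q (X 1 q)
         + (\<partial> G q u \<bullet> \<partial> G q (X 2 q)) *\<^sub>R \<partial> G q (X 2 q))"
      "\<And>q u. q \<in> B \<Longrightarrow> \<partial> G q u \<bullet> \<partial> G q (X 1 q) = 0 \<Longrightarrow> \<partial> G q u \<bullet> \<partial> G q (X 2 q) = 0 \<Longrightarrow>
         \<partial> G q u \<bullet> e4 = 0 \<Longrightarrow> \<partial> G q u \<bullet> e5 = 0 \<Longrightarrow> u = 0"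
    then have "split_legendrian B G X r q0 e4 e5 \<phi> \<rho>"
      by (intro split_legendrian.intro split_legendrian_axioms.intro ad q0)
    then show thesis by (rule that)
  qed
  interpret split_legendrian B G X r "\<lambda>i p. \<partial> G p (X i p)" q0 e4 e5 \<phi> \<rho> by (rule split)
  obtain U V \<Psi> where U: "open U" "U \<subseteq> B" "q0 \<in> U" and V: "open V" and hom: "homeomorphism U V \<Phi> \<Psi>"
    and \<Psi>s: "smooth_on V \<Psi>" and bij: "\<And>x. x \<in> U \<Longrightarrow> bij (\<partial> \<Phi> x)"
    using smooth_inverse_function[OF B_open q0 \<Phi>_smooth inj_d\<Phi>] by blast
  define f where "f x = \<phi> (\<Psi> x) \<bullet> \<phi> q0" for x
  have \<Psi>V: "\<Psi> x \<in> B" if "x \<in> V" for x using hom that U(2) unfolding homeomorphism_def by blast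
  have "smooth_on V f"
    unfolding f_def[abs_def] by (intro smooth_on_inner smooth_on_const V smooth_on_compose[OF \<phi>_smooth B_open \<Psi>s V \<Psi>V])
  then have "open (f -` {0<..} \<inter> V)"
    using continuous_on_open_vimage[OF V, of f] smooth_on_imp_continuous_on open_greaterThan by blast
  moreover have q0\<Psi>: "\<Psi> (\<Phi> q0) = q0" "\<Phi> q0 \<in> V" using hom U(3) unfolding homeomorphism_def by blast+
  then have "\<Phi> q0 \<in> f -` {0<..} \<inter> V" using \<phi>_e[OF q0] by (simp add: f_def)
  ultimately obtain \<epsilon> where \<epsilon>: "\<epsilon> > 0" "cube \<epsilon> \<subseteq> f -` {0<..} \<inter> V" by (rule small_cube)
  interpret split_legendrian_chart B G X r "\<lambda>i p. \<partial> G p (X i p)" q0 e4 e5 \<phi> \<rho> U V \<Psi> \<epsilon>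
    by unfold_locales (use U V hom \<Psi>s bij \<epsilon> in \<open>auto simp: f_def\<close>)
  have "\<Psi> ` cube \<epsilon> = \<Phi> -` cube \<epsilon> \<inter> U"
  proof (intro set_eqI iffI)
    fix q assume "q \<in> \<Psi> ` cube \<epsilon>"
    then show "q \<in> \<Phi> -` cube \<epsilon> \<inter> U" using \<Psi> by auto
  next
    fix q assume q: "q \<in> \<Phi> -` cube \<epsilon> \<inter> U"
    then have "\<Psi> (\<Phi> q) = q" using hom by (simp add: homeomorphism_def)
    then show "q \<in> \<Psi> ` cube \<epsilon>" using q by (metis IntD1 image_eqI vimageE)
  qed
  moreover have "open (\<Phi> -` cube \<epsilon> \<inter> U)"
  proof -
    have "continuous_on U \<Phi>" using hom by (simp add: homeomorphism_def)
    then show ?thesis using continuous_on_open_vimage[OF U(1), of \<Phi>] open_cube by simp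
  qed
  ultimately have "open (\<Psi> ` cube \<epsilon>)" by simp
  moreover have "q0 \<in> \<Psi> ` cube \<epsilon>" by (rule image_eqI[of _ _ "\<Phi> q0"]) (simp_all add: q0\<Psi> cube_def \<epsilon>(1))
  moreover have "\<Psi> ` cube \<epsilon> \<subseteq> B" using \<Psi> by blast
  ultimately show thesis
    using that[of "\<Psi> ` cube \<epsilon>" \<Theta> \<phi>\<^sub>3 Q \<Omega> \<psi>] legendrian_\<phi>\<^sub>3 \<phi>\<^sub>3_nonzero traceless_\<phi>\<^sub>3 unitary_Q open_\<Omega>
      \<psi>_smooth \<psi>_image model_equation inj_d\<psi> by simp
qed

text \<open>Translation of the hypotheses on the frame to the lift.\<close>

lemma adapted_frame_legendrian:
  fixes h :: "real^4 \<Rightarrow> complex^4" and G :: "real^4 \<Rightarrow> complex^5"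
  assumes chart: "legendrian_chart B G e P h c" and conv: "convex B" and D: "B \<subseteq> D"
    and ad: "adapted_frame e P D h X r" and int: "integrable_span D (X 1) (X 2)"
  shows "adapted_legendrian B G X r"
proof -
  interpret legendrian_chart B G e P h c by (rule chart)
  have X: "smooth_on B (X i)" for i using ad D smooth_on_subset unfolding adapted_frame_def by blast
  let ?E = "\<lambda>i p. \<partial> G p (X i p)"
  have a: "r q > 0 \<and> (\<forall>i j. induced_metric e P h q (X i q) (X j q) = (if i = j then 1 else 0)) \<and>
        tensor_A e P h (X 1) (X 1) q = r q *\<^sub>R X 1 q \<and>
        tensor_A e P h (X 1) (X 2) q = - r q *\<^sub>R X 2 q \<and>
        tensor_A e P h (X 2) (X 1) q = - r q *\<^sub>R X 2 q \<and>
        tensor_A e P h (X 2) (X 2) q = - r q *\<^sub>R X 1 q \<and>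
        (\<forall>i j. i \<in> {3, 4} \<or> j \<in> {3, 4} \<longrightarrow> tensor_A e P h (X i) (X j) q = 0)" if "q \<in> B" for q
    using ad that D unfolding adapted_frame_def by blast
  have E: "?E i q \<bullet> ?E j q = (if i = j then 1 else 0)" if q: "q \<in> B" for q i j
    using a[OF q] induced_metric_eq[OF q, of "X i q" "X j q"] by simp
  have Es: "smooth_on B (?E i)" for i
    by (rule smooth_on_directional_derivative_along[OF legendrian_open[OF leg] legendrian_smooth[OF leg] X])
  show ?thesis
  proof (unfold_locales, fact leg, fact conv, fact X)
    fix q assume q: "q \<in> B"
    note lin = legendrian_linear[OF leg q]
    show "r q > 0" using a[OF q] by blast
    show "?E i q \<bullet> ?E j q = (if i = j then 1 else 0)" for i j by (rule E[OF q])
    show "\<partial> (?E j) q (X i q) \<bullet> J (?E k q) = r q * sff i j k" for i j k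
    proof -
      have t: "\<partial> (?E j) q (X i q) \<bullet> J (?E k q) = \<partial> G q (tensor_A e P h (X i) (X j) q) \<bullet> ?E k q"
        using tensor_A_lift[OF q X, of "X i" j "X k q"] by simp
      consider "i \<in> {3, 4} \<or> j \<in> {3, 4}" | "i = 1" "j = 1" | "i = 1" "j = 2" | "i = 2" "j = 1" | "i = 2" "j = 2"
        using exhaust_4[of i] exhaust_4[of j] by blast
      then show ?thesis
      proof cases
        case 1
        then have "tensor_A e P h (X i) (X j) q = 0" using a[OF q] by blast
        then show ?thesis using 1 unfolding t by (auto simp: linear_0[OF lin] sff_def)
      qed (unfold t, use a[OF q] E[OF q] in \<open>auto simp: linear_cmul[OF lin] linear_neg[OF lin] sff_def\<close>)
    qed
    show "\<partial> (?E b) q (X 2 q) \<bullet> ?E 1 q = \<partial> (?E b) q (X 1 q) \<bullet> ?E 2 q" if b: "b \<in> {3, 4}" for b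
      by (rule integrable_span_derivative_symmetric[OF int legendrian_open[OF leg] D q legendrian_smooth[OF leg] Es])
        (use E b in auto)
  qed
qed

theorem theorem4p1:
  fixes M :: "'m topology"
    and \<A> :: "(real^4, 'm) atlas"
    and f :: "'m \<Rightarrow> (complex^5) set"
  assumes "smooth_manifold M \<A>"
    and "special_lagrangian M \<A> f"
    and "so2_s3_symmetric M \<A> f"
    and "integrable_N1 M \<A> f"
  shows "\<forall>p\<in>topspace M. \<exists>W G. openin M W \<and> p \<in> W \<and> horizontal_lift \<A> f W G \<and>
    (\<exists>\<Theta> (\<phi> :: real^2 \<Rightarrow> complex^3). open \<Theta> \<and>
       special_lagrangian (top_of_set \<Theta>) {(\<Theta>, id)} (hopf \<circ> \<phi>) \<and>
       horizontal_lift {(\<Theta>, id)} (hopf \<circ> \<phi>) \<Theta> \<phi> \<and>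
       congruent_to_model M \<A> W G \<Theta> \<phi>)"
proof
  fix p assume p: "p \<in> topspace M"
  note M = assms(1)
  from bspec[OF conjunct2[OF assms(2)[unfolded special_lagrangian_def]] p]
  obtain D1 y1 e1 P1 h1 where rep1: "coord_rep \<A> f D1 y1 e1 P1 h1" and p1: "p \<in> y1 ` D1"
    and h1: "smooth_on D1 h1" "\<forall>q\<in>D1. inj (\<partial> h1 q)" "lagrangian_on e1 P1 D1 h1"
    by (elim exE conjE) (rule that)
  from bspec[OF assms(4)[unfolded integrable_N1_def] p]
  obtain D y e P h X r where rep: "coord_rep \<A> f D y e P h" and p2: "p \<in> y ` D"
    and ad: "adapted_frame e P D h X r" and int: "integrable_span D (X 1) (X 2)"
    by (elim exE conjE) (rule that)
  obtain E1 where E1: "(E1, y1) \<in> \<A>" "D1 \<subseteq> E1" and D1: "open D1" and fr1: "affine_frame e1 P1"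
    and f1: "\<And>q. q \<in> D1 \<Longrightarrow> f (y1 q) = hopf (affine_lift e1 P1 (h1 q))"
    using rep1 unfolding coord_rep_def by blast
  obtain E where E: "(E, y) \<in> \<A>" "D \<subseteq> E" and D: "open D" and fr: "affine_frame e P"
    and f: "\<And>q. q \<in> D \<Longrightarrow> f (y q) = hopf (affine_lift e P (h q))"
    using rep unfolding coord_rep_def by blast
  obtain q1 where q1: "q1 \<in> D1" "p = y1 q1" using p1 by blast
  obtain q0 where q0: "q0 \<in> D" "p = y q0" using p2 by blast
  obtain r1 G1 where r1: "r1 > 0" "ball q1 r1 \<subseteq> D1" and leg1: "legendrian_on (ball q1 r1) G1"
    and hopf1: "\<And>q. q \<in> ball q1 r1 \<Longrightarrow> hopf (G1 q) = hopf (affine_lift e1 P1 (h1 q))"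
    using lagrangian_horizontal_lift[OF fr1 D1 q1(1) h1(1) _ h1(3)] h1(2) by blast
  have B1: "ball q1 r1 \<subseteq> E1" using r1(2) E1(2) by blast
  \<comment> \<open>The lift is constructed in a chart in which the immersion is known to be smooth, and then
    transported to the chart that carries the adapted frame.\<close>
  define H where "H m = G1 (inv_into E1 y1 m)" for m
  have H: "H (y1 q) = G1 q" if "q \<in> ball q1 r1" for q
    using that B1 chart_inj[OF M E1(1)] by (auto simp: H_def inv_into_f_f)
  define G where "G = H \<circ> y"
  let ?S = "E \<inter> y -` (y1 ` ball q1 r1)"
  have legS: "legendrian_on ?S G"
    unfolding G_def by (rule legendrian_in_other_chart[OF M E1(1) B1 leg1 H E(1)])
  have fG: "f (y q) = hopf (G q)" if q: "q \<in> ?S" for q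
  proof -
    obtain q' where "q' \<in> ball q1 r1" "y q = y1 q'" using q by auto
    then show ?thesis using f1[of q'] hopf1[of q'] H[of q'] r1(2) by (auto simp: G_def)
  qed
  have "q0 \<in> ?S \<inter> D" using q0 q1 E(2) r1(1) by (auto intro!: image_eqI[of _ _ q1])
  moreover have "open (?S \<inter> D)" using legendrian_open[OF legS] D by (rule open_Int)
  ultimately obtain r2 where r2: "r2 > 0" "ball q0 r2 \<subseteq> ?S \<inter> D" using open_contains_ball by meson
  let ?B = "ball q0 r2"
  have leg: "legendrian_on ?B G" using legendrian_on_subset[OF legS open_ball] r2(2) by blast
  have fB: "f (y q) = hopf (G q)" if "q \<in> ?B" for q by (rule fG) (use that r2(2) in blast)
  have "hopf (G q) = hopf (affine_lift e P (h q))" if "q \<in> ?B" for q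
    using fB[OF that] f[of q] that r2(2) by auto
  from legendrian_lift_affine_coordinates[OF leg fr this]
  obtain c where "smooth_on ?B h" "smooth_on ?B c"
    "\<And>q. q \<in> ?B \<Longrightarrow> cmod (c q) = 1 \<and> G q = c q *s affine_lift e P (h q)" by blast
  then have lifted: "legendrian_chart ?B G e P h c" using leg fr by (intro legendrian_chart.intro) auto
  have "adapted_legendrian ?B G X r"
    by (rule adapted_frame_legendrian[OF lifted convex_ball _ ad int]) (use r2(2) in blast)
  moreover have "q0 \<in> ?B" using r2(1) by simp
  ultimately obtain U \<Theta> \<phi> Q \<Omega> \<psi> where U: "open U" "U \<subseteq> ?B" "q0 \<in> U"
    and \<phi>: "legendrian_on \<Theta> \<phi>" "\<And>w. w \<in> \<Theta> \<Longrightarrow> \<phi> w $ 1 \<noteq> 0" "\<And>w. w \<in> \<Theta> \<Longrightarrow> traceless_at \<phi> w"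
    and Q: "unitary_matrix Q" and \<Omega>: "open \<Omega>" and \<psi>: "smooth_on \<Omega> \<psi>" "\<psi> ` \<Omega> = U"
    and \<Theta>: "\<And>t s u v. (t, s, u, v) \<in> \<Omega> \<Longrightarrow> vector [u, v] \<in> \<Theta>"
    and inj: "\<And>t s u v. (t, s, u, v) \<in> \<Omega> \<Longrightarrow> sin s \<noteq> 0 \<Longrightarrow> inj (\<partial> \<psi> (t, s, u, v))"
    and model: "\<And>t s u v. (t, s, u, v) \<in> \<Omega> \<Longrightarrow> Q *v G (\<psi> (t, s, u, v)) = model_F \<phi> t s u v"
    by (rule adapted_legendrian_model) blast
  have UE: "U \<subseteq> E" using U(2) r2(2) E(2) by blast
  let ?W = "y ` U"
  define K where "K m = G (inv_into E y m)" for m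
  have K: "K (y q) = G q" if "q \<in> U" for q
    using that UE chart_inj[OF M E(1)] by (auto simp: K_def inv_into_f_f)
  have lift: "horizontal_lift \<A> f ?W K"
    by (rule legendrian_horizontal_lift[OF M E(1) UE legendrian_on_subset[OF leg U(1,2)] K fB]) (use U(2) in blast)+
  have W: "openin M ?W" by (rule chart_image_open[OF M E(1) U(1) UE])
  have pW: "p \<in> ?W" using U(3) q0(2) by blast
  let ?\<psi> = "y \<circ> \<psi>"
  have smooth: "smooth_map_into M \<A> \<Omega> ?\<psi>"
    and inj': "\<And>D' y' t s u v. (D', y') \<in> \<A> \<Longrightarrow> (t, s, u, v) \<in> \<Omega> \<inter> ?\<psi> -` (y' ` D') \<Longrightarrow> sin s \<noteq> 0 \<Longrightarrow>
      inj (\<partial> (inv_into D' y' \<circ> ?\<psi>) (t, s, u, v))"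
  proof -
    have \<psi>E: "\<psi> x \<in> E" if "x \<in> \<Omega>" for x using that \<psi>(2) UE by blast
    have "continuous_map (top_of_set \<Omega>) (top_of_set E) \<psi>"
      using smooth_on_imp_continuous_on[OF \<psi>(1)] \<psi>E by auto
    then have cont: "continuous_map (top_of_set \<Omega>) M ?\<psi>"
      by (rule continuous_map_compose[OF _ chart_continuous[OF M E(1)]])
    have key: "smooth_on (\<Omega> \<inter> ?\<psi> -` (y' ` D')) (inv_into D' y' \<circ> ?\<psi>) \<and>
      (\<forall>x\<in>\<Omega> \<inter> ?\<psi> -` (y' ` D'). \<forall>u. \<partial> (inv_into D' y' \<circ> ?\<psi>) x u = \<partial> (inv_into D' y' \<circ> y) (\<psi> x) (\<partial> \<psi> x u))"
      if D': "(D', y') \<in> \<A>" for D' y'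
    proof -
      let ?T = "E \<inter> y -` (y' ` D')" and ?O = "\<Omega> \<inter> ?\<psi> -` (y' ` D')" and ?\<tau> = "inv_into D' y' \<circ> y"
      have T: "open ?T" by (rule chart_preimage_open[OF M E(1) chart(2)[OF M D']])
      have \<tau>: "smooth_on ?T ?\<tau>" by (rule transition_smooth[OF M D' E(1)])
      have O_eq: "?O = \<psi> -` ?T \<inter> \<Omega>" using \<psi>E by auto
      have O: "open ?O"
        unfolding O_eq using T smooth_on_imp_continuous_on[OF \<psi>(1)] continuous_on_open_vimage[OF \<Omega>, of \<psi>] by blast
      have \<psi>O: "smooth_on ?O \<psi>" by (rule smooth_on_subset[OF \<psi>(1)]) blast
      have \<psi>T: "\<psi> x \<in> ?T" if "x \<in> ?O" for x using that unfolding O_eq by blast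
      have eq: "inv_into D' y' \<circ> ?\<psi> = (\<lambda>x. ?\<tau> (\<psi> x))" by (simp add: fun_eq_iff)
      have "smooth_on ?O (\<lambda>x. ?\<tau> (\<psi> x))" by (rule smooth_on_compose[OF \<tau> T \<psi>O O \<psi>T])
      moreover have "\<partial> (\<lambda>x. ?\<tau> (\<psi> x)) x u = \<partial> ?\<tau> (\<psi> x) (\<partial> \<psi> x u)" if "x \<in> ?O" for x u
        by (rule derivative_chain[OF smooth_on_differentiable[OF \<tau> \<psi>T[OF that]] smooth_on_differentiable[OF \<psi>O that]])
      ultimately show ?thesis unfolding eq by blast
    qed
    show "smooth_map_into M \<A> \<Omega> ?\<psi>"
      unfolding smooth_map_into_def using cont key by blast
    fix D' y' t s u v
    assume D': "(D', y') \<in> \<A>" and x: "(t, s, u, v) \<in> \<Omega> \<inter> ?\<psi> -` (y' ` D')" and s: "sin s \<noteq> 0"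
    have "inj (\<partial> (inv_into D' y' \<circ> y) (\<psi> (t, s, u, v)))"
      by (rule transition_derivative_inj[OF M D' E(1)]) (use x \<psi>E in auto)
    moreover have "inj (\<partial> \<psi> (t, s, u, v))" by (rule inj) (use x s in auto)
    moreover have "\<partial> (inv_into D' y' \<circ> ?\<psi>) (t, s, u, v)
        = \<partial> (inv_into D' y' \<circ> y) (\<psi> (t, s, u, v)) \<circ> \<partial> \<psi> (t, s, u, v)"
      using key[OF D'] x by (simp add: fun_eq_iff del: comp_apply) (simp add: comp_def)
    ultimately show "inj (\<partial> (inv_into D' y' \<circ> ?\<psi>) (t, s, u, v))" by (metis inj_compose)
  qed
  have "congruent_to_model M \<A> ?W K \<Theta> \<phi>"
    unfolding congruent_to_model_def
  proof (intro exI conjI)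
    show "unitary_matrix Q" by (rule Q)
    show "open \<Omega>" by (rule \<Omega>)
    show "\<forall>(t, s, u, v)\<in>\<Omega>. vector [u, v] \<in> \<Theta>" using \<Theta> by auto
    show "smooth_map_into M \<A> \<Omega> ?\<psi>" by (rule smooth)
    show "?\<psi> ` \<Omega> = ?W" unfolding \<psi>(2)[symmetric] by (simp add: image_comp)
    show "\<forall>(D', y')\<in>\<A>. \<forall>(t, s, u, v)\<in>\<Omega> \<inter> ?\<psi> -` (y' ` D'). sin s \<noteq> 0 \<longrightarrow>
        inj (\<partial> (inv_into D' y' \<circ> ?\<psi>) (t, s, u, v))"
      using inj' by blast
    show "\<forall>(t, s, u, v)\<in>\<Omega>. Q *v K (?\<psi> (t, s, u, v)) = model_F \<phi> t s u v"
      using model K \<psi>(2) by force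
  qed
  then show "\<exists>W G. openin M W \<and> p \<in> W \<and> horizontal_lift \<A> f W G \<and>
    (\<exists>\<Theta> (\<phi> :: real^2 \<Rightarrow> complex^3). open \<Theta> \<and>
       special_lagrangian (top_of_set \<Theta>) {(\<Theta>, id)} (hopf \<circ> \<phi>) \<and>
       horizontal_lift {(\<Theta>, id)} (hopf \<circ> \<phi>) \<Theta> \<phi> \<and>
       congruent_to_model M \<A> W G \<Theta> \<phi>)"
    using W pW lift legendrian_open[OF \<phi>(1)] special_lagrangian_of_legendrian[OF \<phi>] by blast
qed

end
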